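(* Let $\mathcal{D}\in\mathbb{C}[z,\frac{d}{dz}]$ be a differential operator such that $\infty$ is a regular singularity of $\mathcal{D}$ (or not a singularity at all), let $\Sigma$ be the set of finite singularities of $\mathcal{D}$, and let $\theta\in\mathbb{R}$ be such that $\arg(\rho-\rho')\not\equiv-\theta \pmod{\pi}$ whenever $\rho,\rho'\in\Sigma$ are distinct. For every $\rho\in\Sigma$ let $f_\rho\in\widehat{\mathcal{O}}_\rho$ be such that $\mathcal{D}f_\rho\in\mathcal{O}_\rho$. Then there exists a function $f$ holomorphic on the cut plane $\Omega_\theta$ such that: (1) $\mathcal{D}f$ is a polynomial; (2) for every $\rho\in\Sigma$, $f-f_\rho\in\mathcal{O}_\rho$ (where $f$ is restricted to a small cut disk around $\rho$). Moreover, if $f$ and $\tilde f$ both satisfy (1) and (2), then $f-\tilde f$ is a polynomial.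
   Context: The finite singularities of $\mathcal{D}=\sum_{j=0}^{\mu}P_{\mu-j}(z)(\frac{d}{dz})^j$ (with $P_0\neq 0$) are the zeros of the leading coefficient $P_0$. For $\rho\in\mathbb{C}$, $\mathcal{O}_\rho$ is the ring of germs of functions holomorphic at $\rho$. Given $\theta\in\mathbb{R}$, $\widehat{\mathcal{O}}_\rho$ is the inductive limit as $\varepsilon\to0$ of the spaces of functions holomorphic on the cut punctured disk $\{z\in\mathbb{C}: 0<|z-\rho|<\varepsilon,\ -\theta-\pi<\arg(z-\rho)<-\theta+\pi\}$; $\mathcal{O}_\rho$ is viewed as a subspace of $\widehat{\mathcal{O}}_\rho$ by restriction. $\Omega_\theta$ is the plane $\mathbb{C}$ minus the union over $\rho\in\Sigma$ of the closed half-lines starting at $\rho$ with direction $-\theta+\pi$, i.e. $\{\rho-te^{-i\theta}: t\ge0\}$; on $\Omega_\theta$ one uses $-\theta-\pi<\arg(z-\rho)<-\theta+\pi$ for each $\rho\in\Sigma$. *)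

theory Defs
  imports "HOL-Complex_Analysis.Complex_Analysis" "HOL-Library.Real_Mod"
begin

definition diff_op :: "nat \<Rightarrow> (nat \<Rightarrow> complex poly) \<Rightarrow> (complex \<Rightarrow> complex) \<Rightarrow> complex \<Rightarrow> complex"
  where "diff_op \<mu> P f z = (\<Sum>j\<le>\<mu>. poly (P (\<mu> - j)) z * (deriv ^^ j) f z)"

definition finite_singularities :: "(nat \<Rightarrow> complex poly) \<Rightarrow> complex set"
  where "finite_singularities P = {\<rho>. poly (P 0) \<rho> = 0}"

(* The operator \<Sum>j\<le>\<mu>. b j * (d/dw)^j has at \<rho> either an ordinary point or a regular
   singularity: b j / b \<mu> has at most a pole of order \<mu> - j at \<rho> for every j \<le> \<mu>. *)
definition at_most_regular_singular ::
    "nat \<Rightarrow> (nat \<Rightarrow> complex \<Rightarrow> complex) \<Rightarrow> complex \<Rightarrow> bool"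
  where "at_most_regular_singular \<mu> b \<rho> \<longleftrightarrow>
    (\<forall>j\<le>\<mu>. \<exists>h. h analytic_on {\<rho>} \<and>
       (\<forall>\<^sub>F w in at \<rho>. (w - \<rho>) ^ (\<mu> - j) * (b j w / b \<mu> w) = h w))"

(* Under z = 1/w one has d/dz = - w^2 d/dw, and inv_coeff j i is the coefficient of (d/dw)^i in
   the j-th power of - w^2 d/dw; see higher_deriv_inverse_comp. *)
fun inv_coeff :: "nat \<Rightarrow> nat \<Rightarrow> complex poly" where
  "inv_coeff 0 i = (if i = 0 then 1 else 0)"
| "inv_coeff (Suc j) 0 = - monom 1 2 * pderiv (inv_coeff j 0)"
| "inv_coeff (Suc j) (Suc i) = - monom 1 2 * (pderiv (inv_coeff j (Suc i)) + inv_coeff j i)"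

definition inf_coeff :: "nat \<Rightarrow> (nat \<Rightarrow> complex poly) \<Rightarrow> nat \<Rightarrow> complex \<Rightarrow> complex"
  where "inf_coeff \<mu> P i w = (\<Sum>j\<le>\<mu>. poly (P (\<mu> - j)) (1 / w) * poly (inv_coeff j i) w)"

definition at_most_regular_singular_at_infinity :: "nat \<Rightarrow> (nat \<Rightarrow> complex poly) \<Rightarrow> bool"
  where "at_most_regular_singular_at_infinity \<mu> P \<longleftrightarrow>
    at_most_regular_singular \<mu> (inf_coeff \<mu> P) 0"

definition cut_disk :: "real \<Rightarrow> complex \<Rightarrow> real \<Rightarrow> complex set"
  where "cut_disk \<theta> \<rho> \<epsilon> =
    {\<rho> + rcis r \<phi> |r \<phi>. 0 < r \<and> r < \<epsilon> \<and> - \<theta> - pi < \<phi> \<and> \<phi> < - \<theta> + pi}"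

(* Elements of the inductive limit are given by representatives, that is by total functions of
   which only the restriction to some (arbitrarily small) cut disk matters. *)
definition O_hat :: "real \<Rightarrow> complex \<Rightarrow> (complex \<Rightarrow> complex) set"
  where "O_hat \<theta> \<rho> = {g. \<exists>\<epsilon>>0. g holomorphic_on cut_disk \<theta> \<rho> \<epsilon>}"

(* The image in O_hat of the germs holomorphic at \<rho>. *)
definition O_germ :: "real \<Rightarrow> complex \<Rightarrow> (complex \<Rightarrow> complex) set"
  where "O_germ \<theta> \<rho> =
    {g. \<exists>\<epsilon>>0. \<exists>h. h holomorphic_on ball \<rho> \<epsilon> \<and> (\<forall>z\<in>cut_disk \<theta> \<rho> \<epsilon>. g z = h z)}"

definition cut_plane :: "real \<Rightarrow> complex set \<Rightarrow> complex set"
  where "cut_plane \<theta> \<Sigma> = UNIV - (\<Union>\<rho>\<in>\<Sigma>. {\<rho> - of_real t * cis (- \<theta>) |t. 0 \<le> t})"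

lemma inv_coeff_eq_0: "j < i \<Longrightarrow> inv_coeff j i = 0"
  by (induction j i rule: inv_coeff.induct) auto

lemma higher_deriv_inverse_comp:
  assumes g: "g holomorphic_on U" and U: "open U" "0 \<notin> U" and z: "1 / z \<in> U"
  shows "(deriv ^^ j) (\<lambda>z. g (1 / z)) z =
    (\<Sum>i\<le>j. poly (inv_coeff j i) (1 / z) * (deriv ^^ i) g (1 / z))"
  using z
proof (induction j arbitrary: z)
  case 0
  then show ?case by simp
next
  case (Suc j)
  define V where "V = (- {0 :: complex}) \<inter> (\<lambda>z. 1 / z) -` U"
  have "open V"
    unfolding V_def
    by (intro continuous_open_preimage) (auto intro!: continuous_intros U)
  have "z \<noteq> 0"
    using Suc.prems U by auto
  hence "z \<in> V"
    using Suc.prems by (auto simp: V_def)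
  let ?T = "\<lambda>i z. poly (inv_coeff j i) (1 / z) * (deriv ^^ i) g (1 / z)"
  let ?D = "\<lambda>i. - ((1 / z)\<^sup>2) * (poly (pderiv (inv_coeff j i)) (1 / z) * (deriv ^^ i) g (1 / z)
                + poly (inv_coeff j i) (1 / z) * (deriv ^^ Suc i) g (1 / z))"
  have inv: "((\<lambda>z. 1 / z) has_field_derivative - ((1 / z)\<^sup>2)) (at z)"
    using \<open>z \<noteq> 0\<close> by (auto intro!: derivative_eq_intros simp: power2_eq_square)
  have term_deriv: "(?T i has_field_derivative ?D i) (at z)" for i
  proof -
    have 1: "((deriv ^^ i) g has_field_derivative (deriv ^^ Suc i) g (1 / z)) (at (1 / z))"
      using holomorphic_derivI[OF holomorphic_higher_deriv[OF g U(1)] U(1) Suc.prems] by simp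
    have 2: "(poly (inv_coeff j i) has_field_derivative poly (pderiv (inv_coeff j i)) (1 / z))
               (at (1 / z))"
      by (rule poly_DERIV)
    show ?thesis
      by (rule DERIV_cong[OF DERIV_mult[OF DERIV_chain2[OF 2 inv] DERIV_chain2[OF 1 inv]]])
         (simp add: algebra_simps)
  qed
  have "(deriv ^^ Suc j) (\<lambda>z. g (1 / z)) z = deriv (\<lambda>z. \<Sum>i\<le>j. ?T i z) z"
    unfolding funpow.simps o_def
    by (rule deriv_cong_ev)
       (use eventually_nhds_in_open[OF \<open>open V\<close> \<open>z \<in> V\<close>] in
         \<open>auto elim!: eventually_mono simp: V_def Suc.IH\<close>)
  also have "\<dots> = (\<Sum>i\<le>j. ?D i)"
    by (intro DERIV_imp_deriv DERIV_sum term_deriv)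
  also have "\<dots> = (\<Sum>i\<le>Suc j. poly (inv_coeff (Suc j) i) (1 / z) * (deriv ^^ i) g (1 / z))"
  proof -
    let ?A = "\<lambda>i. - ((1 / z)\<^sup>2) * poly (pderiv (inv_coeff j i)) (1 / z) * (deriv ^^ i) g (1 / z)"
    let ?B = "\<lambda>i. - ((1 / z)\<^sup>2) * poly (inv_coeff j i) (1 / z) * (deriv ^^ Suc i) g (1 / z)"
    have "(\<Sum>i\<le>Suc j. poly (inv_coeff (Suc j) i) (1 / z) * (deriv ^^ i) g (1 / z)) =
            ?A 0 + (\<Sum>i\<le>j. ?A (Suc i) + ?B i)"
      by (subst sum.atMost_Suc_shift) (simp add: poly_monom algebra_simps)
    also have "\<dots> = (\<Sum>i\<le>Suc j. ?A i) + (\<Sum>i\<le>j. ?B i)"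
      unfolding sum.atMost_Suc_shift sum.distrib by (simp only: add.assoc)
    also have "(\<Sum>i\<le>Suc j. ?A i) = (\<Sum>i\<le>j. ?A i)"
      by (simp add: inv_coeff_eq_0)
    finally show ?thesis
      by (simp only: sum.distrib[symmetric] distrib_left mult.assoc)
  qed
  finally show ?case .
qed

lemma diff_op_inverse_comp:
  assumes "g holomorphic_on U" and "open U" "0 \<notin> U" and "w \<in> U"
  shows "diff_op \<mu> P (\<lambda>z. g (1 / z)) (1 / w) = (\<Sum>i\<le>\<mu>. inf_coeff \<mu> P i w * (deriv ^^ i) g w)"
proof -
  have *: "(deriv ^^ j) (\<lambda>z. g (1 / z)) (1 / w) =
             (\<Sum>i\<le>\<mu>. poly (inv_coeff j i) w * (deriv ^^ i) g w)" if "j \<le> \<mu>" for j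
  proof -
    have "(deriv ^^ j) (\<lambda>z. g (1 / z)) (1 / w) =
            (\<Sum>i\<le>j. poly (inv_coeff j i) w * (deriv ^^ i) g w)"
      using higher_deriv_inverse_comp[OF assms(1-3), of "1 / w" j] assms(4) by simp
    also have "\<dots> = (\<Sum>i\<le>\<mu>. poly (inv_coeff j i) w * (deriv ^^ i) g w)"
      using that by (intro sum.mono_neutral_left) (auto simp: inv_coeff_eq_0)
    finally show ?thesis .
  qed
  have "diff_op \<mu> P (\<lambda>z. g (1 / z)) (1 / w) =
          (\<Sum>j\<le>\<mu>. \<Sum>i\<le>\<mu>. poly (P (\<mu> - j)) (1 / w) * poly (inv_coeff j i) w * (deriv ^^ i) g w)"
    unfolding diff_op_def by (simp add: * sum_distrib_left mult.assoc)
  also have "\<dots> = (\<Sum>i\<le>\<mu>. inf_coeff \<mu> P i w * (deriv ^^ i) g w)"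
    unfolding inf_coeff_def sum_distrib_right by (rule sum.swap)
  finally show ?thesis .
qed

end

(* The theorem follows from counting dimensions. Let K = deg (P 0) and let m_rho be the order of P 0
   at rho, so that K is the sum of the m_rho. A contraction argument on Taylor coefficients shows that
   D maps O_rho to O_rho with index at least mu - m_rho, and the kernel of D on a cut disk has
   dimension at most mu; hence the space M_rho of all f in O^_rho with D f in O_rho, taken modulo
   O_rho, has dimension at most m_rho. On the other hand, D is onto on the simply connected domain
   Omega_theta, and regularity at infinity means that D raises degrees by exactly K - mu in high
   degrees; this gives K functions on Omega_theta, independent modulo polynomials, that D maps to
   polynomials. A combination of them that is holomorphic at every rho continues across the cuts
   (D is regular there) to an entire function, and regularity at infinity makes it a polynomial.
   So these functions embed into the sum of the M_rho, of dimension at most K, and therefore span it. *)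

theory Submission
  imports Defs "HOL-Computational_Algebra.Fundamental_Theorem_Algebra"
begin

section \<open>Action of the operator on power series\<close>

text \<open>The dimension count avoids quotient spaces and is run as one homogeneous linear system.
  The inverse of the operator is controlled only beyond an index \<open>N\<close> depending on the
  singularity, so each \<rho> brings \<open>N\<close> auxiliary unknowns and
  \<open>N + order \<rho> (P 0)\<close> equations; in the count the \<open>N\<close> cancel. The
  unknowns shared by all \<rho> are K + 1 coefficients, one for the given microsolutions and K for
  functions on the cut plane, which leaves one unknown more than equations. A nontrivial solution is
  useful for two reasons: the auxiliary unknowns vanish together with the shared ones, and the
  coefficient of the given microsolutions cannot be zero.

  The K functions have images (z - z0)^(n0 - \<mu> + i) with i < K and zero initial values at z0. A
  combination of them vanishes to order n0 at z0, whereas a polynomial with such an image has degree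
  below n0; this is their independence modulo polynomials.

  The condition on \<theta> puts the cuts on distinct parallel lines. Hence no cut meets another
  singularity, and continuation along a cut meets no obstacle.\<close>

definition falling :: "nat \<Rightarrow> nat \<Rightarrow> complex"
  where "falling n j = (\<Prod>i<j. of_nat n - of_nat i)"

definition fps_op :: "nat \<Rightarrow> (nat \<Rightarrow> complex poly) \<Rightarrow> complex fps \<Rightarrow> complex fps"
  where "fps_op \<mu> Q F = (\<Sum>j\<le>\<mu>. fps_of_poly (Q (\<mu> - j)) * (fps_deriv ^^ j) F)"

text \<open>The coefficient of \<open>z ^ (n - \<mu> + s)\<close> in the image of \<open>z ^ n\<close>, a polynomial in \<open>n\<close> of degree at
  most \<open>\<mu>\<close>; the degree is \<open>\<mu>\<close> exactly if \<open>z ^ s\<close> occurs in \<open>Q 0\<close>.\<close>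

definition op_coeff :: "nat \<Rightarrow> (nat \<Rightarrow> complex poly) \<Rightarrow> nat \<Rightarrow> nat \<Rightarrow> complex"
  where "op_coeff \<mu> Q s n =
    (\<Sum>j\<le>\<mu>. (if \<mu> \<le> s + j then coeff (Q (\<mu> - j)) (s + j - \<mu>) else 0) * falling n j)"

lemma falling_eq_0: "n < j \<Longrightarrow> falling n j = 0"
  unfolding falling_def by (rule prod_zero) auto

lemma falling_nonzero: "j \<le> n \<Longrightarrow> falling n j \<noteq> 0"
  unfolding falling_def by (subst prod_zero_iff) auto

lemma norm_falling_le: "norm (falling n j) \<le> real n ^ j"
proof (cases "j \<le> n")
  case True
  have "norm (falling n j) = (\<Prod>i<j. norm (of_nat n - of_nat i :: complex))"
    by (simp add: falling_def prod_norm)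
  also have "\<dots> = (\<Prod>i<j. real n - real i)"
    using True by (intro prod.cong refl) (metis norm_of_nat of_nat_diff less_imp_le_nat less_le_trans lessThan_iff)
  also have "\<dots> \<le> (\<Prod>i<j. real n)"
    using True by (intro prod_mono) auto
  finally show ?thesis by simp
qed (simp add: falling_eq_0)

lemma fps_nth_higher_deriv:
  "fps_nth ((fps_deriv ^^ j) F) n = falling (n + j) j * fps_nth F (n + j)"
proof (induction j arbitrary: n)
  case (Suc j)
  have "falling (n + Suc j) (Suc j) = falling (n + Suc j) j * of_nat (n + 1)"
    by (simp add: falling_def)
  with Suc[of "n + 1"] show ?case by (simp add: mult_ac)
qed (simp add: falling_def)

text \<open>Summation by the shift \<open>s\<close> instead of by \<open>j\<close> collects all
  contributions of one Taylor coefficient. The extra terms are zero: either the shift is too small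
  for a coefficient of \<open>Q (\<mu> - j)\<close>, or \<open>falling\<close> vanishes because the
  index is below \<open>j\<close>.\<close>

lemma fps_op_nth:
  "fps_nth (fps_op \<mu> Q F) e = (\<Sum>s\<le>e + \<mu>. op_coeff \<mu> Q s (e + \<mu> - s) * fps_nth F (e + \<mu> - s))"
proof -
  have *: "fps_nth (fps_of_poly (Q (\<mu> - j)) * (fps_deriv ^^ j) F) e =
      (\<Sum>s\<le>e + \<mu>. (if \<mu> \<le> s + j then coeff (Q (\<mu> - j)) (s + j - \<mu>) else 0) *
         falling (e + \<mu> - s) j * fps_nth F (e + \<mu> - s))" (is "_ = sum ?g _") if "j \<le> \<mu>" for j
  proof -
    have "fps_nth (fps_of_poly (Q (\<mu> - j)) * (fps_deriv ^^ j) F) e =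
        (\<Sum>i\<in>{0..e}. ?g (i + (\<mu> - j)))"
      unfolding fps_mult_nth using that
      by (intro sum.cong refl) (auto simp: fps_nth_higher_deriv mult_ac add_ac)
    also have "\<dots> = sum ?g ((\<lambda>i. i + (\<mu> - j)) ` {0..e})"
      by (subst sum.reindex) (auto simp: inj_on_def)
    also have "\<dots> = sum ?g {..e + \<mu>}"
    proof (rule sum.mono_neutral_left)
      show "\<forall>s\<in>{..e + \<mu>} - (\<lambda>i. i + (\<mu> - j)) ` {0..e}. ?g s = 0"
      proof
        fix s assume s: "s \<in> {..e + \<mu>} - (\<lambda>i. i + (\<mu> - j)) ` {0..e}"
        show "?g s = 0"
        proof (cases "\<mu> \<le> s + j")
          case True
          have "s = s - (\<mu> - j) + (\<mu> - j)" using True by simp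
          hence "s - (\<mu> - j) \<notin> {0..e}" using s by blast
          hence "e + \<mu> - s < j" using s True that by auto
          thus ?thesis by (simp add: falling_eq_0)
        qed auto
      qed
    qed (use that in auto)
    finally show ?thesis .
  qed
  show ?thesis
    unfolding fps_op_def fps_sum_nth op_coeff_def
    by (simp add: * sum_distrib_right) (rule sum.swap)
qed

text \<open>Uniform in \<open>s\<close> because only finitely many polynomial coefficients occur.
  The last bound gains a factor \<open>n\<close>: the term \<open>j = \<mu>\<close>, the only one of
  full degree, is absent. Multiplying by \<open>n\<close> avoids the exponent \<mu> - 1.\<close>

lemma op_coeff_bound:
  obtains A where "A > 0" "\<And>s n. n > 0 \<Longrightarrow> norm (op_coeff \<mu> Q s n) \<le> A * real n ^ \<mu>"
    "\<And>s n. n > 0 \<Longrightarrow> coeff (Q 0) s = 0 \<Longrightarrow> norm (op_coeff \<mu> Q s n) * real n \<le> A * real n ^ \<mu>"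
proof -
  define M where "M j = (\<Sum>i\<le>degree (Q j). norm (coeff (Q j) i))" for j
  have M: "norm (coeff (Q j) i) \<le> M j" for i j
  proof (cases "i \<le> degree (Q j)")
    case True thus ?thesis unfolding M_def by (intro member_le_sum) auto
  next
    case False thus ?thesis unfolding M_def by (simp add: coeff_eq_0 sum_nonneg)
  qed
  have M0: "M j \<ge> 0" for j unfolding M_def by (simp add: sum_nonneg)
  define A where "A = 1 + (\<Sum>j\<le>\<mu>. M (\<mu> - j))"
  have A: "A \<ge> 1" unfolding A_def by (simp add: sum_nonneg M0)
  let ?c = "\<lambda>s j. (if \<mu> \<le> s + j then coeff (Q (\<mu> - j)) (s + j - \<mu>) else 0)"
  have c: "norm (?c s j) \<le> M (\<mu> - j)" for s j using M M0 by auto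
  have 1: "norm (op_coeff \<mu> Q s n) \<le> A * real n ^ \<mu>" if n: "n > 0" for s n
  proof -
    have "norm (op_coeff \<mu> Q s n) \<le> (\<Sum>j\<le>\<mu>. norm (?c s j * falling n j))"
      unfolding op_coeff_def by (rule norm_sum)
    also have "\<dots> \<le> (\<Sum>j\<le>\<mu>. M (\<mu> - j) * real n ^ \<mu>)"
    proof (rule sum_mono)
      fix j assume "j \<in> {..\<mu>}"
      hence "real n ^ j \<le> real n ^ \<mu>" using n by (intro power_increasing) auto
      hence "norm (falling n j) \<le> real n ^ \<mu>" using norm_falling_le order_trans by blast
      thus "norm (?c s j * falling n j) \<le> M (\<mu> - j) * real n ^ \<mu>"
        unfolding norm_mult by (intro mult_mono c) (auto simp: M0)
    qed
    also have "\<dots> \<le> A * real n ^ \<mu>"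
      unfolding A_def sum_distrib_right[symmetric] by (intro mult_right_mono) auto
    finally show ?thesis .
  qed
  have 2: "norm (op_coeff \<mu> Q s n) * real n \<le> A * real n ^ \<mu>" if n: "n > 0" and s: "coeff (Q 0) s = 0" for s n
  proof -
    have "norm (op_coeff \<mu> Q s n) * real n \<le> (\<Sum>j\<le>\<mu>. norm (?c s j * falling n j)) * real n"
      unfolding op_coeff_def by (intro mult_right_mono norm_sum) auto
    also have "\<dots> = (\<Sum>j\<le>\<mu>. norm (?c s j * falling n j) * real n)"
      by (rule sum_distrib_right)
    also have "\<dots> \<le> (\<Sum>j\<le>\<mu>. M (\<mu> - j) * real n ^ \<mu>)"
    proof (rule sum_mono)
      fix j assume j: "j \<in> {..\<mu>}"
      show "norm (?c s j * falling n j) * real n \<le> M (\<mu> - j) * real n ^ \<mu>"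
      proof (cases "j = \<mu>")
        case True thus ?thesis using s M0[of 0] by simp
      next
        case False
        have "norm (falling n j) * real n \<le> real n ^ j * real n"
          by (intro mult_right_mono norm_falling_le) auto
        also have "\<dots> = real n ^ Suc j" by simp
        also have "\<dots> \<le> real n ^ \<mu>" using n j False by (intro power_increasing) auto
        finally have "norm (falling n j) * real n \<le> real n ^ \<mu>" .
        hence "norm (?c s j) * (norm (falling n j) * real n) \<le> M (\<mu> - j) * real n ^ \<mu>"
          by (intro mult_mono c) (auto simp: M0)
        thus ?thesis by (simp add: norm_mult mult_ac)
      qed
    qed
    also have "\<dots> \<le> A * real n ^ \<mu>"
      unfolding A_def sum_distrib_right[symmetric] by (intro mult_right_mono) auto
    finally show ?thesis .
  qed
  show ?thesis using that[of A] 1 2 A by force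
qed

lemma falling_asymp:
  assumes "j \<le> \<mu>"
  shows "(\<lambda>n. falling n j / of_nat n ^ \<mu>) \<longlonglongrightarrow> (if j = \<mu> then 1 else 0)"
proof -
  have 1: "(\<lambda>n. \<Prod>i<j. (1 - of_nat i * inverse (of_nat n) :: complex)) \<longlonglongrightarrow> (\<Prod>i<j. 1 - of_nat i * 0)"
    by (intro tendsto_intros lim_inverse_n)
  have 2: "(\<lambda>n. inverse (of_nat n) ^ (\<mu> - j) :: complex) \<longlonglongrightarrow> 0 ^ (\<mu> - j)"
    by (intro tendsto_intros lim_inverse_n)
  have "(\<lambda>n. (\<Prod>i<j. (1 - of_nat i * inverse (of_nat n) :: complex)) * inverse (of_nat n) ^ (\<mu> - j))
      \<longlonglongrightarrow> (\<Prod>i<j. 1 - of_nat i * 0) * 0 ^ (\<mu> - j)"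
    by (rule tendsto_mult[OF 1 2])
  moreover have "\<forall>\<^sub>F n in sequentially. (\<Prod>i<j. (1 - of_nat i * inverse (of_nat n) :: complex)) * inverse (of_nat n) ^ (\<mu> - j)
      = falling n j / of_nat n ^ \<mu>"
    using eventually_gt_at_top[of 0]
  proof eventually_elim
    case (elim n)
    have "falling n j = (\<Prod>i<j. of_nat n * (1 - of_nat i * inverse (of_nat n)))"
      unfolding falling_def using elim by (intro prod.cong) (auto simp: field_simps)
    also have "\<dots> = of_nat n ^ j * (\<Prod>i<j. (1 - of_nat i * inverse (of_nat n)))"
      by (simp add: prod.distrib)
    finally have "falling n j = of_nat n ^ j * (\<Prod>i<j. (1 - of_nat i * inverse (of_nat n)))" .
    moreover have "(of_nat n ^ \<mu> :: complex) = of_nat n ^ j * of_nat n ^ (\<mu> - j)"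
      using assms by (simp flip: power_add)
    ultimately show ?case using elim by (simp add: field_simps)
  qed
  ultimately show ?thesis
    using assms by (auto dest: Lim_transform_eventually simp: power_0_left)
qed

text \<open>After division by the power of order \<mu> only the term \<open>j = \<mu>\<close>
  survives in the limit, with value \<open>coeff (Q 0) s\<close>; half its modulus serves as
  \<open>c\<close>.\<close>

lemma op_coeff_lower_bound:
  assumes "coeff (Q 0) s \<noteq> 0"
  obtains c where "c > 0" "\<forall>\<^sub>F n in sequentially. norm (op_coeff \<mu> Q s n) \<ge> c * real n ^ \<mu>"
proof -
  let ?c = "\<lambda>j. (if \<mu> \<le> s + j then coeff (Q (\<mu> - j)) (s + j - \<mu>) else 0)"
  have "(\<lambda>n. \<Sum>j\<le>\<mu>. ?c j * (falling n j / of_nat n ^ \<mu>)) \<longlonglongrightarrow> (\<Sum>j\<le>\<mu>. ?c j * (if j = \<mu> then 1 else 0))"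
    by (intro tendsto_sum tendsto_mult tendsto_const falling_asymp) auto
  also have "(\<Sum>j\<le>\<mu>. ?c j * (if j = \<mu> then 1 else 0)) = coeff (Q 0) s"
    by (subst sum.remove[of _ \<mu>]) auto
  also have "(\<lambda>n. \<Sum>j\<le>\<mu>. ?c j * (falling n j / of_nat n ^ \<mu>)) = (\<lambda>n. op_coeff \<mu> Q s n / of_nat n ^ \<mu>)"
    by (simp add: op_coeff_def sum_divide_distrib)
  finally have "(\<lambda>n. norm (op_coeff \<mu> Q s n / of_nat n ^ \<mu>)) \<longlonglongrightarrow> norm (coeff (Q 0) s)"
    by (rule tendsto_norm)
  hence "\<forall>\<^sub>F n in sequentially. norm (op_coeff \<mu> Q s n / of_nat n ^ \<mu>) > norm (coeff (Q 0) s) / 2"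
    by (rule order_tendstoD) (use assms in auto)
  hence "\<forall>\<^sub>F n in sequentially. norm (op_coeff \<mu> Q s n) \<ge> (norm (coeff (Q 0) s) / 2) * real n ^ \<mu>"
    using eventually_gt_at_top[of 0]
    by eventually_elim (auto simp: norm_divide norm_power field_simps)
  thus ?thesis using that[of "norm (coeff (Q 0) s) / 2"] assms by auto
qed

text \<open>A Neumann series: the row sums bound the operator norm for the sup norm by 1/2, so the
  iterates \<open>y j\<close> decay geometrically. Finite rows make the exchange of the two sums
  elementary.\<close>

lemma bounded_system_solution:
  fixes b :: "nat \<Rightarrow> complex"
  assumes R: "\<And>n. finite (R n)" and \<beta>: "\<And>n. (\<Sum>k\<in>R n. norm (\<beta> n k)) \<le> 1 / 2"
    and b: "\<And>n. norm (b n) \<le> B"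
  obtains x where "bounded (range x)" "\<And>n. x n = b n + (\<Sum>k\<in>R n. \<beta> n k * x k)"
proof -
  define y where "y = rec_nat b (\<lambda>_ z n. \<Sum>k\<in>R n. \<beta> n k * z k)"
  have y: "y 0 = b" "y (Suc j) n = (\<Sum>k\<in>R n. \<beta> n k * y j k)" for j n
    by (simp_all add: y_def)
  have "B \<ge> 0" using b norm_ge_zero order_trans by blast
  have bound: "norm (y j n) \<le> B * (1 / 2) ^ j" for j n
  proof (induction j arbitrary: n)
    case (Suc j)
    have "norm (y (Suc j) n) \<le> (\<Sum>k\<in>R n. norm (\<beta> n k) * (B * (1 / 2) ^ j))"
      unfolding y by (rule sum_norm_le) (auto simp: norm_mult intro!: mult_left_mono Suc)
    also have "\<dots> \<le> 1 / 2 * (B * (1 / 2) ^ j)"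
      unfolding sum_distrib_right[symmetric] using \<open>B \<ge> 0\<close> by (intro mult_right_mono \<beta>) auto
    finally show ?case by simp
  qed (simp add: y b)
  have geo: "summable (\<lambda>j. B * (1 / 2) ^ j)" by (intro summable_mult summable_geometric) auto
  have summ: "summable (\<lambda>j. norm (y j n))" for n
    by (rule summable_comparison_test'[OF geo, of 0]) (use bound in auto)
  define x where "x n = (\<Sum>j. y j n)" for n
  have "norm (x n) \<le> (\<Sum>j. B * (1 / 2) ^ j)" for n
  proof -
    have "norm (x n) \<le> (\<Sum>j. norm (y j n))" unfolding x_def by (rule summable_norm[OF summ])
    also have "\<dots> \<le> (\<Sum>j. B * (1 / 2) ^ j)" by (intro suminf_le bound summ geo)
    finally show ?thesis .
  qed
  hence "bounded (range x)" by (auto simp: bounded_iff)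
  moreover have "x n = b n + (\<Sum>k\<in>R n. \<beta> n k * x k)" for n
  proof -
    have sy: "summable (\<lambda>j. y j n)" for n
      by (rule summable_norm_cancel[OF summ])
    have "x n = b n + (\<Sum>j. y (Suc j) n)"
      unfolding x_def using suminf_split_head[OF sy[of n]] by (simp add: y)
    also have "(\<Sum>j. y (Suc j) n) = (\<Sum>k\<in>R n. \<Sum>j. \<beta> n k * y j k)"
      unfolding y by (rule suminf_sum) (rule summable_mult[OF sy])
    also have "\<dots> = (\<Sum>k\<in>R n. \<beta> n k * x k)"
      unfolding x_def by (rule sum.cong[OF refl]) (rule suminf_mult[OF sy])
    finally show ?thesis .
  qed
  ultimately show ?thesis by (rule that)
qed

lemma sum_reverse_powers_le:
  fixes r :: real
  assumes "0 \<le> r" "r \<le> 1 / 2"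
  shows "(\<Sum>k<n. r ^ (n - k)) \<le> 2 * r"
proof (induction n)
  case (Suc n)
  have "(\<Sum>k<Suc n. r ^ (Suc n - k)) = r * (\<Sum>k<n. r ^ (n - k)) + r"
    by (simp add: sum_distrib_left Suc_diff_le)
  also have "\<dots> \<le> r * (2 * r) + r"
    using Suc assms by (intro add_mono mult_left_mono) auto
  also have "r * (2 * r) \<le> (1 / 2) * (2 * r)" using assms by (intro mult_right_mono) auto
  finally show ?case by simp
qed (use assms in auto)

text \<open>In the norm \<open>sup |a\<^sub>n| r\<^sup>n\<close> the terms with \<open>s > m\<close> are small for small \<open>r\<close>, and those with \<open>s < m\<close>
  are small for large \<open>n\<close> because their coefficients are of lower degree in \<open>n\<close>.\<close>

lemma fps_op_truncated_inverse:
  assumes low: "\<And>i. i < m \<Longrightarrow> coeff (Q 0) i = 0" and lead: "coeff (Q 0) m \<noteq> 0"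
  obtains r0 :: real where "r0 > 0" "\<And>r. 0 < r \<Longrightarrow> r < r0 \<Longrightarrow>
    \<exists>N\<ge>\<mu>. \<forall>b. bounded (range (\<lambda>n. fps_nth b n * of_real r ^ n)) \<longrightarrow>
      (\<exists>a. bounded (range (\<lambda>n. fps_nth a n * of_real r ^ n)) \<and> (\<forall>n<N. fps_nth a n = 0) \<and>
           (\<forall>e. N + m \<le> e + \<mu> \<longrightarrow> fps_nth (fps_op \<mu> Q a) e = fps_nth b e))"
proof -
  obtain A where A: "A > 0" "\<And>s n. n > 0 \<Longrightarrow> norm (op_coeff \<mu> Q s n) \<le> A * real n ^ \<mu>"
    "\<And>s n. n > 0 \<Longrightarrow> coeff (Q 0) s = 0 \<Longrightarrow> norm (op_coeff \<mu> Q s n) * real n \<le> A * real n ^ \<mu>"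
    using op_coeff_bound by blast
  obtain c where c: "c > 0" "\<forall>\<^sub>F n in sequentially. norm (op_coeff \<mu> Q m n) \<ge> c * real n ^ \<mu>"
    by (rule op_coeff_lower_bound[of Q m \<mu>, OF lead])
  \<comment> \<open>The second bound makes the total contribution \<open>A / c * (2 * r)\<close> of
    the indices below \<open>n\<close> at most 1/4; the first serves the geometric sum.\<close>
  define r0 where "r0 = min (1 / 2) (c / (8 * A))"
  have r0: "r0 > 0" using A(1) c(1) by (simp add: r0_def)
  show ?thesis
  proof (rule that[OF r0])
    fix r :: real assume r: "0 < r" "r < r0"
    have r': "r \<le> 1 / 2" "r < 1" and "r < c / (8 * A)" using r by (auto simp: r0_def)
    hence rA: "A / c * (2 * r) \<le> 1 / 4" using A(1) c(1) by (simp add: field_simps)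
    \<comment> \<open>\<open>E / n\<close> will bound each of the at most \<open>m\<close> entries
      with \<open>k > n\<close>: the power of 2 comes from \<open>k \<le> 2 * n\<close>, the power
      of \<open>r\<close> from the weights.\<close>
    define E where "E = A / c * (2 ^ \<mu> / r ^ m)"
    have "(\<lambda>n. real m * E * inverse (real n)) \<longlonglongrightarrow> real m * E * 0"
      by (intro tendsto_intros lim_inverse_n)
    hence "\<forall>\<^sub>F n in sequentially. real m * E * inverse (real n) < 1 / 4"
      by (rule order_tendstoD) auto
    with c(2) have "\<forall>\<^sub>F n in sequentially. norm (op_coeff \<mu> Q m n) \<ge> c * real n ^ \<mu> \<and>
        real m * E * inverse (real n) < 1 / 4" by eventually_elim auto
    then obtain N0 where N0: "\<And>n. n \<ge> N0 \<Longrightarrow> norm (op_coeff \<mu> Q m n) \<ge> c * real n ^ \<mu> \<and>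
        real m * E * inverse (real n) < 1 / 4" by (auto simp: eventually_at_top_linorder)
    \<comment> \<open>The summands provide, in turn, the eventual estimates, an exact difference
      \<open>n + m - \<mu>\<close>, the bound \<open>n + m \<le> 2 * n\<close>, and
      \<open>n > 0\<close>.\<close>
    define N where "N = N0 + \<mu> + m + 1"
    have lead_n: "norm (op_coeff \<mu> Q m n) \<ge> c * real n ^ \<mu>" "op_coeff \<mu> Q m n \<noteq> 0" if "n \<ge> N" for n
    proof -
      show *: "norm (op_coeff \<mu> Q m n) \<ge> c * real n ^ \<mu>" using N0[of n] that by (auto simp: N_def)
      have "c * real n ^ \<mu> > 0" using c(1) that by (auto simp: N_def)
      with * show "op_coeff \<mu> Q m n \<noteq> 0" by auto
    qed
    \<comment> \<open>Row \<open>n\<close> is the equation for the exponent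
      \<open>n + m - \<mu>\<close>, solved for the unknown of index \<open>n\<close>. The unknowns
      are weighted by \<open>r ^ n\<close>, and those below \<open>N\<close> are set to
      zero.\<close>
    define R where "R n = (if n < N then {} else {k. N \<le> k \<and> k \<le> n + m \<and> k \<noteq> n})" for n
    define \<beta> where "\<beta> n k = - (op_coeff \<mu> Q (n + m - k) k * of_real (r ^ n / r ^ k) / op_coeff \<mu> Q m n)"
      for n k
    have finR: "finite (R n)" for n
      by (rule finite_subset[of _ "{..n + m}"]) (auto simp: R_def)
    have \<beta>1: "norm (\<beta> n k) \<le> A / c * r ^ (n - k)" if "n \<ge> N" "N \<le> k" "k < n" for n k
    proof -
      have "norm (op_coeff \<mu> Q (n + m - k) k) \<le> A * real k ^ \<mu>" using that by (intro A) (auto simp: N_def)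
      also have "\<dots> \<le> A * real n ^ \<mu>" using that A(1) by (intro mult_left_mono power_mono) auto
      finally have 1: "norm (op_coeff \<mu> Q (n + m - k) k) \<le> A * real n ^ \<mu>" .
      have 2: "r ^ n / r ^ k = r ^ (n - k)" using that r by (simp add: power_diff)
      have "norm (\<beta> n k) = norm (op_coeff \<mu> Q (n + m - k) k) / norm (op_coeff \<mu> Q m n) * r ^ (n - k)"
        unfolding \<beta>_def 2 using r by (simp add: norm_mult norm_divide norm_power)
      also have "\<dots> \<le> (A * real n ^ \<mu>) / (c * real n ^ \<mu>) * r ^ (n - k)"
        using that r c(1) A(1) by (intro mult_right_mono frac_le 1 lead_n) (auto simp: N_def)
      also have "\<dots> = A / c * r ^ (n - k)" using that by (auto simp: N_def)
      finally show ?thesis .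
    qed
    have \<beta>2: "norm (\<beta> n k) \<le> E * inverse (real n)" if "n \<ge> N" "n < k" "k \<le> n + m" for n k
    proof -
      have "norm (op_coeff \<mu> Q (n + m - k) k) * real n \<le> norm (op_coeff \<mu> Q (n + m - k) k) * real k"
        using that by (intro mult_left_mono) auto
      also have "\<dots> \<le> A * real k ^ \<mu>"
        using that by (intro A low) (auto simp: N_def)
      also have "\<dots> \<le> A * (2 * real n) ^ \<mu>" using that A(1) by (intro mult_left_mono power_mono) (auto simp: N_def)
      finally have 1: "norm (op_coeff \<mu> Q (n + m - k) k) \<le> A * (2 * real n) ^ \<mu> / real n"
        using that by (simp add: N_def field_simps)
      have n0: "n \<noteq> 0" using that by (simp add: N_def)
      have "r ^ m \<le> r ^ (k - n)" using that r r' by (intro power_decreasing) auto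
      moreover have "r ^ k = r ^ n * r ^ (k - n)" using that by (simp flip: power_add)
      hence "r ^ n / r ^ k = 1 / r ^ (k - n)" using r by simp
      ultimately have 2: "r ^ n / r ^ k \<le> 1 / r ^ m" using r by (simp add: frac_le)
      have "norm (\<beta> n k) = norm (op_coeff \<mu> Q (n + m - k) k) / norm (op_coeff \<mu> Q m n) * (r ^ n / r ^ k)"
        unfolding \<beta>_def using r by (simp add: norm_mult norm_divide norm_power)
      also have "\<dots> \<le> (A * (2 * real n) ^ \<mu> / real n) / (c * real n ^ \<mu>) * (1 / r ^ m)"
        using that r c(1) A(1) by (intro mult_mono frac_le 1 2 lead_n) (auto simp: N_def)
      also have "\<dots> = E * inverse (real n)" using n0 c(1) r(1) by (simp add: E_def power_mult_distrib divide_simps)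
      finally show ?thesis .
    qed
    have \<beta>: "(\<Sum>k\<in>R n. norm (\<beta> n k)) \<le> 1 / 2" for n
    proof (cases "n < N")
      case False
      have "R n = {N..<n} \<union> {n<..n + m}" using False by (auto simp: R_def)
      hence "(\<Sum>k\<in>R n. norm (\<beta> n k)) = (\<Sum>k\<in>{N..<n}. norm (\<beta> n k)) + (\<Sum>k\<in>{n<..n+m}. norm (\<beta> n k))"
        by (simp only:) (subst sum.union_disjoint, auto)
      also have "(\<Sum>k\<in>{N..<n}. norm (\<beta> n k)) \<le> (\<Sum>k\<in>{N..<n}. A / c * r ^ (n - k))"
        using False by (intro sum_mono \<beta>1) auto
      also have "\<dots> \<le> (\<Sum>k\<in>{..<n}. A / c * r ^ (n - k))"
        using A(1) c(1) r by (intro sum_mono2) auto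
      also have "\<dots> \<le> A / c * (2 * r)"
        unfolding sum_distrib_left[symmetric] using A(1) c(1) r r' by (intro mult_left_mono sum_reverse_powers_le) auto
      also have "\<dots> \<le> 1 / 4" by (rule rA)
      also have "(\<Sum>k\<in>{n<..n+m}. norm (\<beta> n k)) \<le> (\<Sum>k\<in>{n<..n+m}. E * inverse (real n))"
        using False by (intro sum_mono \<beta>2) auto
      also have "\<dots> = real m * E * inverse (real n)" by simp
      also have "\<dots> \<le> 1 / 4" using N0[of n] False by (auto simp: N_def)
      finally show ?thesis by simp
    qed (simp add: R_def)
    have "\<exists>a. bounded (range (\<lambda>n. fps_nth a n * of_real r ^ n)) \<and> (\<forall>n<N. fps_nth a n = 0) \<and>
           (\<forall>e. N + m \<le> e + \<mu> \<longrightarrow> fps_nth (fps_op \<mu> Q a) e = fps_nth b e)"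
      if bb: "bounded (range (\<lambda>n. fps_nth b n * of_real r ^ n))" for b
    proof -
      obtain B where B: "\<And>n. norm (fps_nth b n * of_real r ^ n) \<le> B"
        using bb by (auto simp: bounded_iff)
      hence B0: "B \<ge> 0" using norm_ge_zero order_trans by blast
      define b' where "b' n = (if n < N then 0 else fps_nth b (n + m - \<mu>) * of_real r ^ n / op_coeff \<mu> Q m n)" for n
      have "norm (b' n) \<le> B * (r ^ \<mu> / r ^ m) / c" for n
      proof (cases "n < N")
        case True thus ?thesis using B0 r c(1) by (simp add: b'_def)
      next
        case False
        hence "r ^ n * r ^ m = r ^ (n + m - \<mu>) * r ^ \<mu>" by (simp add: N_def flip: power_add)
        hence "r ^ n = r ^ (n + m - \<mu>) * (r ^ \<mu> / r ^ m)" using r by (simp add: field_simps)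
        hence "norm (b' n) = norm (fps_nth b (n + m - \<mu>) * of_real r ^ (n + m - \<mu>)) * (r ^ \<mu> / r ^ m)
            / norm (op_coeff \<mu> Q m n)"
          using r False by (simp add: b'_def norm_mult norm_divide norm_power)
        also have "c * 1 \<le> c * real n ^ \<mu>" using False c(1) by (intro mult_left_mono one_le_power) (auto simp: N_def)
        hence "c \<le> norm (op_coeff \<mu> Q m n)" using lead_n[of n] False by auto
        hence "norm (fps_nth b (n + m - \<mu>) * of_real r ^ (n + m - \<mu>)) * (r ^ \<mu> / r ^ m) / norm (op_coeff \<mu> Q m n)
          \<le> B * (r ^ \<mu> / r ^ m) / c"
          using B0 r c(1) by (intro frac_le mult_right_mono B) auto
        finally show ?thesis .
      qed
      from bounded_system_solution[of R \<beta> b', OF finR \<beta> this]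
      obtain x where x: "bounded (range x)" "\<And>n. x n = b' n + (\<Sum>k\<in>R n. \<beta> n k * x k)" by blast
      define a where "a = Abs_fps (\<lambda>n. x n / of_real r ^ n)"
      have a: "fps_nth a n * of_real r ^ n = x n" for n using r by (simp add: a_def)
      have x0: "x n = 0" if "n < N" for n using x(2)[of n] that by (simp add: b'_def R_def)
      have "fps_nth (fps_op \<mu> Q a) e = fps_nth b e" if e: "N + m \<le> e + \<mu>" for e
      proof -
        define n where "n = e + \<mu> - m"
        have n: "e + \<mu> = n + m" "n \<ge> N" using e by (auto simp: n_def)
        have "fps_nth (fps_op \<mu> Q a) e = (\<Sum>s\<le>n + m. op_coeff \<mu> Q s (n + m - s) * fps_nth a (n + m - s))"
          unfolding fps_op_nth n ..
        also have "\<dots> = (\<Sum>k\<le>n + m. op_coeff \<mu> Q (n + m - k) k * fps_nth a k)"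
          by (rule sum.reindex_bij_witness[of _ "\<lambda>k. n + m - k" "\<lambda>k. n + m - k"]) auto
        also have "\<dots> = (\<Sum>k\<in>insert n (R n). op_coeff \<mu> Q (n + m - k) k * fps_nth a k)"
          using n by (intro sum.mono_neutral_right) (auto simp: R_def a_def x0)
        also have "\<dots> = op_coeff \<mu> Q m n * fps_nth a n + (\<Sum>k\<in>R n. op_coeff \<mu> Q (n + m - k) k * fps_nth a k)"
          using finR[of n] by (subst sum.insert) (simp_all add: R_def)
        also have "fps_nth a n = x n / of_real r ^ n" by (simp add: a_def)
        also have "x n = b' n + (\<Sum>k\<in>R n. \<beta> n k * x k)" by (rule x(2))
        also have "(\<Sum>k\<in>R n. \<beta> n k * x k) =
           - (of_real r ^ n / op_coeff \<mu> Q m n) * (\<Sum>k\<in>R n. op_coeff \<mu> Q (n + m - k) k * fps_nth a k)"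
          unfolding sum_distrib_left
          by (intro sum.cong refl) (simp add: \<beta>_def a_def field_simps)
        also have "op_coeff \<mu> Q m n * ((b' n +
           - (of_real r ^ n / op_coeff \<mu> Q m n) * (\<Sum>k\<in>R n. op_coeff \<mu> Q (n + m - k) k * fps_nth a k)) / of_real r ^ n)
           + (\<Sum>k\<in>R n. op_coeff \<mu> Q (n + m - k) k * fps_nth a k) = fps_nth b (n + m - \<mu>)"
          using lead_n(2)[OF n(2)] r n by (simp add: b'_def divide_simps)
        also have "n + m - \<mu> = e" using n by simp
        finally show ?thesis .
      qed
      moreover have "\<forall>n<N. fps_nth a n = 0" using x0 by (simp add: a_def)
      ultimately show ?thesis using x(1) by (intro exI[of _ a]) (simp add: a)
    qed
    moreover have "N \<ge> \<mu>" by (simp add: N_def)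
    ultimately show "\<exists>N\<ge>\<mu>. \<forall>b. bounded (range (\<lambda>n. fps_nth b n * of_real r ^ n)) \<longrightarrow>
      (\<exists>a. bounded (range (\<lambda>n. fps_nth a n * of_real r ^ n)) \<and> (\<forall>n<N. fps_nth a n = 0) \<and>
           (\<forall>e. N + m \<le> e + \<mu> \<longrightarrow> fps_nth (fps_op \<mu> Q a) e = fps_nth b e))" by blast
  qed
qed

section \<open>Local solutions\<close>

lemma has_fps_expansion_higher_deriv:
  fixes f :: "complex \<Rightarrow> complex"
  shows "f has_fps_expansion F \<Longrightarrow> (deriv ^^ j) f has_fps_expansion (fps_deriv ^^ j) F"
  by (induction j) (auto intro: has_fps_expansion_deriv)

lemma higher_deriv_translate: "(deriv ^^ j) f (\<rho> + w) = (deriv ^^ j) (\<lambda>w. f (\<rho> + w)) w"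
  for f :: "complex \<Rightarrow> complex"
  unfolding higher_deriv_shift_0[of j f "\<rho> + w"] higher_deriv_shift_0[of j "\<lambda>w. f (\<rho> + w)" w]
  by (simp add: o_def add.assoc)

lemma has_fps_expansion_poly: "poly p has_fps_expansion fps_of_poly p" for p :: "complex poly"
  unfolding has_fps_expansion_def by simp

lemma has_fps_expansion_diff_op:
  assumes "(\<lambda>w. f (\<rho> + w)) has_fps_expansion F"
  shows "(\<lambda>w. diff_op \<mu> P f (\<rho> + w)) has_fps_expansion fps_op \<mu> (\<lambda>k. P k \<circ>\<^sub>p [:\<rho>, 1:]) F"
proof -
  have "(\<lambda>w. \<Sum>j\<le>\<mu>. poly (P (\<mu> - j) \<circ>\<^sub>p [:\<rho>, 1:]) w * (deriv ^^ j) (\<lambda>w. f (\<rho> + w)) w)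
      has_fps_expansion fps_op \<mu> (\<lambda>k. P k \<circ>\<^sub>p [:\<rho>, 1:]) F"
    unfolding fps_op_def
    by (intro has_fps_expansion_sum has_fps_expansion_mult has_fps_expansion_poly
        has_fps_expansion_higher_deriv assms)
  thus ?thesis by (simp add: diff_op_def higher_deriv_translate poly_pcompose)
qed

lemma diff_op_cong_ev:
  assumes "\<forall>\<^sub>F x in nhds z. f x = g x"
  shows "diff_op \<mu> P f z = diff_op \<mu> P g z"
  unfolding diff_op_def by (intro sum.cong refl arg_cong2[of _ _ _ _ "(*)"] higher_deriv_cong_ev assms)

text \<open>Linearity is read off from Taylor expansions at \<open>z\<close>, so no common domain
  has to be chosen.\<close>

lemma diff_op_sum:
  assumes "\<And>i. i \<in> I \<Longrightarrow> f i analytic_on {z}"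
  shows "diff_op \<mu> P (\<lambda>z. \<Sum>i\<in>I. c i * f i z) z = (\<Sum>i\<in>I. c i * diff_op \<mu> P (f i) z)"
proof -
  have *: "(deriv ^^ j) (\<lambda>z. \<Sum>i\<in>I. c i * f i z) z = (\<Sum>i\<in>I. c i * (deriv ^^ j) (f i) z)" for j
  proof -
    have "(\<lambda>w. \<Sum>i\<in>I. c i * f i (z + w)) has_fps_expansion
        (\<Sum>i\<in>I. fps_const (c i) * fps_expansion (f i) z)"
      by (intro has_fps_expansion_sum has_fps_expansion_cmult_left analytic_at_imp_has_fps_expansion assms)
    from has_fps_expansion_higher_deriv[OF this, of j]
    have "(deriv ^^ j) (\<lambda>w. \<Sum>i\<in>I. c i * f i (z + w)) 0 =
        fps_nth ((fps_deriv ^^ j) (\<Sum>i\<in>I. fps_const (c i) * fps_expansion (f i) z)) 0"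
      using fps_nth_fps_expansion by fastforce
    also have "\<dots> = (\<Sum>i\<in>I. c i * fps_nth ((fps_deriv ^^ j) (fps_expansion (f i) z)) 0)"
      by (simp add: fps_nth_higher_deriv fps_sum_nth sum_distrib_left mult_ac)
    also have "\<dots> = (\<Sum>i\<in>I. c i * (deriv ^^ j) (\<lambda>w. f i (z + w)) 0)"
    proof (intro sum.cong refl)
      fix i assume "i \<in> I"
      from fps_nth_fps_expansion[OF has_fps_expansion_higher_deriv[OF
            analytic_at_imp_has_fps_expansion[OF assms[OF this]], of j], of 0]
      show "c i * fps_nth ((fps_deriv ^^ j) (fps_expansion (f i) z)) 0 =
          c i * (deriv ^^ j) (\<lambda>w. f i (z + w)) 0" by simp
    qed
    finally show ?thesis
      using higher_deriv_translate[of j _ z 0] by simp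
  qed
  show ?thesis
    unfolding diff_op_def * sum_distrib_left
    by (subst sum.swap) (simp add: mult_ac)
qed

lemma diff_op_lincomb2:
  assumes "f analytic_on {z}" "g analytic_on {z}"
  shows "diff_op \<mu> P (\<lambda>z. a * f z + b * g z) z = a * diff_op \<mu> P f z + b * diff_op \<mu> P g z"
  using diff_op_sum[of UNIV "\<lambda>i. if i then f else g" z \<mu> P "\<lambda>i. if i then a else b"] assms
  by (simp add: UNIV_bool add.commute)

section \<open>Uniqueness for initial values at an ordinary point\<close>

lemma fps_op_vanishing:
  assumes "coeff (Q 0) 0 \<noteq> 0" "\<And>k. k < \<mu> \<Longrightarrow> fps_nth F k = 0"
    and "\<And>e. e + \<mu> < M \<Longrightarrow> fps_nth (fps_op \<mu> Q F) e = 0"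
  shows "k < M \<Longrightarrow> fps_nth F k = 0"
proof (induction k rule: less_induct)
  case (less k)
  show ?case
  proof (cases "k < \<mu>")
    case False
    have "0 = fps_nth (fps_op \<mu> Q F) (k - \<mu>)" using assms(3)[of "k - \<mu>"] False less by simp
    also have "\<dots> = (\<Sum>s\<le>k. op_coeff \<mu> Q s (k - s) * fps_nth F (k - s))"
      using False by (simp add: fps_op_nth)
    also have "\<dots> = (\<Sum>s\<in>{0}. op_coeff \<mu> Q s (k - s) * fps_nth F (k - s))"
      using less by (intro sum.mono_neutral_right) auto
    also have "\<dots> = op_coeff \<mu> Q 0 k * fps_nth F k" by simp
    \<comment> \<open>For shift 0 only \<open>j = \<mu>\<close> contributes, so at an ordinary point
      the recursion is triangular with a nonzero diagonal.\<close>
    also have "op_coeff \<mu> Q 0 k = coeff (Q 0) 0 * falling k \<mu>"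
      unfolding op_coeff_def by (subst sum.remove[of _ \<mu>]) auto
    finally show ?thesis using assms(1) falling_nonzero[of \<mu> k] False by auto
  qed (use assms in auto)
qed

text \<open>The cutoff \<open>M\<close> is kept free: all \<open>M\<close> together give uniqueness,
  while a single \<open>M\<close> shows that solutions with a high-order zero in the image vanish to
  a prescribed order.\<close>

lemma diff_op_vanishing_order:
  assumes "poly (P 0) z \<noteq> 0" "f analytic_on {z}" "\<And>k. k < \<mu> \<Longrightarrow> (deriv ^^ k) f z = 0"
    and "(\<lambda>w. diff_op \<mu> P f (z + w)) has_fps_expansion G" "\<And>e. e + \<mu> < M \<Longrightarrow> fps_nth G e = 0"
  shows "k < M \<Longrightarrow> (deriv ^^ k) f z = 0"
proof -
  note F = analytic_at_imp_has_fps_expansion[OF assms(2)]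
  have nth: "fps_nth (fps_expansion f z) k = (deriv ^^ k) f z / fact k" for k
    by (simp add: fps_expansion_def)
  have "fps_op \<mu> (\<lambda>k. P k \<circ>\<^sub>p [:z, 1:]) (fps_expansion f z) = G"
    by (rule fps_expansion_unique_complex[OF has_fps_expansion_diff_op[OF F] assms(4)])
  moreover have "coeff (P 0 \<circ>\<^sub>p [:z, 1:]) 0 \<noteq> 0"
    using assms(1) by (simp add: poly_0_coeff_0[symmetric] poly_pcompose)
  ultimately have "fps_nth (fps_expansion f z) k = 0" if "k < M"
    using fps_op_vanishing[of "\<lambda>k. P k \<circ>\<^sub>p [:z, 1:]" \<mu> "fps_expansion f z" M k] assms(3,5) that
    by (simp add: nth)
  thus "k < M \<Longrightarrow> (deriv ^^ k) f z = 0" by (simp add: nth)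
qed

text \<open>The recursion at \<open>z\<close> kills every derivative there, and the identity theorem
  spreads this over \<open>S\<close>.\<close>

lemma diff_op_kernel_zero:
  assumes "open S" "connected S" "f holomorphic_on S" "\<And>w. w \<in> S \<Longrightarrow> diff_op \<mu> P f w = 0"
    and "z \<in> S" "poly (P 0) z \<noteq> 0" "\<And>k. k < \<mu> \<Longrightarrow> (deriv ^^ k) f z = 0" "w \<in> S"
  shows "f w = 0"
proof (rule holomorphic_fun_eq_0_on_connected[OF assms(3,1,2) _ assms(5,8)])
  fix n
  have an: "f analytic_on {z}" using assms analytic_at by blast
  have "\<forall>\<^sub>F w in nhds z. diff_op \<mu> P f w = 0"
    using eventually_nhds_in_open[OF assms(1,5)] by eventually_elim (use assms in auto)
  hence "(\<lambda>w. diff_op \<mu> P f (z + w)) has_fps_expansion 0"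
    by (auto simp: has_fps_expansion_0_iff nhds_to_0[of z] eventually_filtermap)
  from diff_op_vanishing_order[OF assms(6) an assms(7) this, of "Suc n" n]
  show "(deriv ^^ n) f z = 0" by simp
qed

section \<open>Local solvability up to finitely many Taylor coefficients\<close>

lemma bounded_imp_fps_conv_radius_ge:
  fixes a :: "complex fps"
  assumes "r > 0" "bounded (range (\<lambda>n. fps_nth a n * of_real r ^ n))"
  shows "fps_conv_radius a \<ge> ereal r"
  unfolding fps_conv_radius_def
proof (rule conv_radius_geI_ex')
  fix s :: real assume s: "0 < s" "ereal s < ereal r"
  obtain B where B: "\<And>n. norm (fps_nth a n * of_real r ^ n) \<le> B"
    using assms(2) by (auto simp: bounded_iff)
  have "summable (\<lambda>n. B * (s / r) ^ n)" using s assms(1) by (intro summable_mult summable_geometric) auto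
  thus "summable (\<lambda>n. fps_nth a n * of_real s ^ n)"
  proof (rule summable_comparison_test'[of _ 0])
    fix n
    have "norm (fps_nth a n * of_real s ^ n) = norm (fps_nth a n * of_real r ^ n) * (s / r) ^ n"
      using s assms(1) by (simp add: norm_mult norm_power power_divide)
    also have "\<dots> \<le> B * (s / r) ^ n" using s assms(1) by (intro mult_right_mono B) auto
    finally show "norm (fps_nth a n * of_real s ^ n) \<le> B * (s / r) ^ n" .
  qed
qed

lemma holomorphic_imp_bounded_taylor:
  assumes "h holomorphic_on ball \<rho> R" "0 < r" "r < R"
  shows "bounded (range (\<lambda>n. fps_nth (fps_expansion h \<rho>) n * of_real r ^ n))"
proof -
  have sub: "cball \<rho> r \<subseteq> ball \<rho> R" using assms by auto
  have cont: "continuous_on (cball \<rho> r) h"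
    using holomorphic_on_imp_continuous_on[OF assms(1)] sub continuous_on_subset by blast
  have "compact (h ` cball \<rho> r)" by (rule compact_continuous_image[OF cont]) auto
  then obtain B where B: "\<And>x. x \<in> cball \<rho> r \<Longrightarrow> norm (h x) \<le> B"
    by (metis bounded_iff compact_imp_bounded imageI)
  have "norm ((deriv ^^ n) h \<rho>) \<le> fact n * B / r ^ n" for n
    using assms(2) sub by (intro Cauchy_inequality holomorphic_on_subset[OF assms(1)] cont B)
      (auto simp: dist_norm norm_minus_commute)
  hence "norm (fps_nth (fps_expansion h \<rho>) n * of_real r ^ n) \<le> B" for n
    using assms(2) by (simp add: fps_expansion_def norm_mult norm_divide norm_power field_simps)
  thus ?thesis by (auto simp: bounded_iff)
qed

lemma coeff_translate_at_order:
  fixes p :: "complex poly"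
  assumes "p \<noteq> 0"
  shows "i < order \<rho> p \<Longrightarrow> coeff (p \<circ>\<^sub>p [:\<rho>, 1:]) i = 0" "coeff (p \<circ>\<^sub>p [:\<rho>, 1:]) (order \<rho> p) \<noteq> 0"
proof -
  obtain q where q: "p = [:- \<rho>, 1:] ^ order \<rho> p * q" "\<not> [:- \<rho>, 1:] dvd q"
    using order_decomp[OF assms] by blast
  have "poly q \<rho> \<noteq> 0" using q(2) by (simp add: poly_eq_0_iff_dvd)
  have "p \<circ>\<^sub>p [:\<rho>, 1:] = monom 1 (order \<rho> p) * (q \<circ>\<^sub>p [:\<rho>, 1:])"
  proof -
    have "poly (p \<circ>\<^sub>p [:\<rho>, 1:]) x = poly (monom 1 (order \<rho> p) * (q \<circ>\<^sub>p [:\<rho>, 1:])) x" for x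
      by (subst q(1)) (simp add: poly_pcompose poly_monom)
    thus ?thesis by (simp add: poly_eq_poly_eq_iff[symmetric] fun_eq_iff)
  qed
  hence *: "coeff (p \<circ>\<^sub>p [:\<rho>, 1:]) i = (if order \<rho> p \<le> i then coeff (q \<circ>\<^sub>p [:\<rho>, 1:]) (i - order \<rho> p) else 0)" for i
    by (simp add: coeff_monom_mult)
  show "i < order \<rho> p \<Longrightarrow> coeff (p \<circ>\<^sub>p [:\<rho>, 1:]) i = 0" by (simp add: *)
  show "coeff (p \<circ>\<^sub>p [:\<rho>, 1:]) (order \<rho> p) \<noteq> 0"
    using \<open>poly q \<rho> \<noteq> 0\<close> by (simp add: * poly_0_coeff_0[symmetric] poly_pcompose)
qed

text \<open>The index estimate in concrete form: \<open>N\<close> Taylor coefficients are given up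
  in the solution, and the error has at most \<open>N + order \<rho> (P 0) - \<mu>\<close>
  coefficients. Since \<open>N\<close> depends on \<open>r\<close> but not on \<open>h\<close>, one
  \<open>N\<close> serves a whole family of right-hand sides.\<close>

lemma local_solution_modulo_polynomials:
  assumes "P 0 \<noteq> 0"
  obtains r0 :: real where "r0 > 0" "\<And>r. 0 < r \<Longrightarrow> r < r0 \<Longrightarrow>
    \<exists>N\<ge>\<mu>. \<forall>h R. r < R \<longrightarrow> h holomorphic_on ball \<rho> R \<longrightarrow>
      (\<exists>u e. u analytic_on {\<rho>} \<and> (\<forall>k<N. (deriv ^^ k) u \<rho> = 0) \<and>
         (\<forall>i. N + order \<rho> (P 0) \<le> i + \<mu> \<longrightarrow> coeff e i = 0) \<and>
         (\<forall>\<^sub>F z in nhds \<rho>. diff_op \<mu> P u z = h z + poly e (z - \<rho>)))"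
proof -
  define Q where "Q = (\<lambda>k. P k \<circ>\<^sub>p [:\<rho>, 1:])"
  let ?m = "order \<rho> (P 0)"
  have "\<And>i. i < ?m \<Longrightarrow> coeff (Q 0) i = 0" "coeff (Q 0) ?m \<noteq> 0"
    using coeff_translate_at_order[OF assms] by (auto simp: Q_def)
  from fps_op_truncated_inverse[of ?m Q \<mu>, OF this]
  obtain r0 where r0: "r0 > 0" "\<And>r. 0 < r \<Longrightarrow> r < r0 \<Longrightarrow>
    \<exists>N\<ge>\<mu>. \<forall>b. bounded (range (\<lambda>n. fps_nth b n * of_real r ^ n)) \<longrightarrow>
      (\<exists>a. bounded (range (\<lambda>n. fps_nth a n * of_real r ^ n)) \<and> (\<forall>n<N. fps_nth a n = 0) \<and>
           (\<forall>e. N + ?m \<le> e + \<mu> \<longrightarrow> fps_nth (fps_op \<mu> Q a) e = fps_nth b e))" by blast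
  show ?thesis
  proof (rule that[OF r0(1)])
    fix r assume r: "0 < r" "r < r0"
    from r0(2)[OF this] obtain N where N: "N \<ge> \<mu>" and
      a: "\<And>b. bounded (range (\<lambda>n. fps_nth b n * of_real r ^ n)) \<Longrightarrow>
      (\<exists>a. bounded (range (\<lambda>n. fps_nth a n * of_real r ^ n)) \<and> (\<forall>n<N. fps_nth a n = 0) \<and>
           (\<forall>e. N + ?m \<le> e + \<mu> \<longrightarrow> fps_nth (fps_op \<mu> Q a) e = fps_nth b e))" by blast
    show "\<exists>N\<ge>\<mu>. \<forall>h R. r < R \<longrightarrow> h holomorphic_on ball \<rho> R \<longrightarrow>
      (\<exists>u e. u analytic_on {\<rho>} \<and> (\<forall>k<N. (deriv ^^ k) u \<rho> = 0) \<and>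
         (\<forall>i. N + order \<rho> (P 0) \<le> i + \<mu> \<longrightarrow> coeff e i = 0) \<and>
         (\<forall>\<^sub>F z in nhds \<rho>. diff_op \<mu> P u z = h z + poly e (z - \<rho>)))"
    proof (intro exI[of _ N] conjI allI impI N)
      fix h R assume R: "r < R" and h: "h holomorphic_on ball \<rho> R"
      define b where "b = fps_expansion h \<rho>"
      from a[OF holomorphic_imp_bounded_taylor[OF h r(1) R]] obtain a where
        a: "bounded (range (\<lambda>n. fps_nth a n * of_real r ^ n))" "\<And>n. n < N \<Longrightarrow> fps_nth a n = 0"
           "\<And>e. N + ?m \<le> e + \<mu> \<Longrightarrow> fps_nth (fps_op \<mu> Q a) e = fps_nth b e"
        unfolding b_def by blast
      define u where "u = (\<lambda>z. eval_fps a (z - \<rho>))"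
      have "fps_conv_radius a \<ge> ereal r" by (rule bounded_imp_fps_conv_radius_ge[OF r(1) a(1)])
      hence "fps_conv_radius a > 0" using r(1) by (metis ereal_less(2) less_le_trans)
      hence u: "(\<lambda>w. u (\<rho> + w)) has_fps_expansion a"
        by (simp add: u_def eval_fps_has_fps_expansion)
      have an: "u analytic_on {\<rho>}" by (rule has_fps_expansion_imp_analytic[OF u])
      define c where "c = fps_op \<mu> Q a - b"
      have c0: "fps_nth c i = 0" if "N + ?m \<le> i + \<mu>" for i using a(3)[OF that] by (simp add: c_def)
      \<comment> \<open>The discrepancy \<open>c\<close> vanishes from index
        \<open>N + ?m - \<mu>\<close> on, so it is a polynomial and the sum is long enough to
        contain it.\<close>
      define e where "e = (\<Sum>i<N + ?m. monom (fps_nth c i) i)"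
      have ce: "coeff e i = fps_nth c i" for i
      proof -
        have "coeff e i = (\<Sum>k<N + ?m. if k = i then fps_nth c k else 0)"
          by (simp add: e_def coeff_sum)
        also have "\<dots> = fps_nth c i" using c0[of i] by (auto simp: sum.delta)
        finally show ?thesis .
      qed
      have "h analytic_on {\<rho>}" using h r R by (metis analytic_at centre_in_ball less_trans open_ball)
      hence "(\<lambda>w. h (\<rho> + w)) has_fps_expansion b" unfolding b_def by (rule analytic_at_imp_has_fps_expansion)
      moreover have "(\<lambda>w. diff_op \<mu> P u (\<rho> + w)) has_fps_expansion fps_op \<mu> Q a"
        unfolding Q_def by (rule has_fps_expansion_diff_op[OF u])
      moreover have "fps_of_poly e = c" by (rule fps_ext) (simp add: ce)
      hence "poly e has_fps_expansion c" using has_fps_expansion_poly[of e] by simp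
      ultimately have "(\<lambda>w. diff_op \<mu> P u (\<rho> + w) - h (\<rho> + w) - poly e w) has_fps_expansion fps_op \<mu> Q a - b - c"
        by (intro has_fps_expansion_diff)
      hence "\<forall>\<^sub>F w in nhds 0. diff_op \<mu> P u (\<rho> + w) - h (\<rho> + w) - poly e w = 0"
        by (simp add: c_def has_fps_expansion_0_iff)
      hence "\<forall>\<^sub>F z in nhds \<rho>. diff_op \<mu> P u z = h z + poly e (z - \<rho>)"
        by (simp add: nhds_to_0[of \<rho>] eventually_filtermap) (simp add: algebra_simps)
      moreover have "(deriv ^^ k) u \<rho> = 0" if "k < N" for k
        using fps_nth_fps_expansion[OF u, of k] a(2)[OF that] higher_deriv_translate[of k u \<rho> 0] by simp
      ultimately show "\<exists>u e. u analytic_on {\<rho>} \<and> (\<forall>k<N. (deriv ^^ k) u \<rho> = 0) \<and>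
         (\<forall>i. N + order \<rho> (P 0) \<le> i + \<mu> \<longrightarrow> coeff e i = 0) \<and>
         (\<forall>\<^sub>F z in nhds \<rho>. diff_op \<mu> P u z = h z + poly e (z - \<rho>))"
        using an c0 ce by (intro exI[of _ u] exI[of _ e]) auto
    qed
  qed
qed

section \<open>Regularity at infinity\<close>

text \<open>Homogeneity: - w^2 d/dw raises degrees by one and d/dw lowers them by one, so the
  coefficient of (d/dw)^i in the \<open>j\<close>-th power has degree \<open>i + j\<close>. This
  lets w^i be factored out of \<open>inf_coeff\<close>.\<close>

lemma inv_coeff_monom: "\<exists>c. inv_coeff j i = monom c (i + j)"
proof (induction j i rule: inv_coeff.induct)
  case (1 i)
  show ?case by (cases "i = 0") (auto intro: exI[of _ 1] exI[of _ 0] simp: monom_0)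
next
  case (2 j)
  then obtain c where c: "inv_coeff j 0 = monom c j" by auto
  have "inv_coeff (Suc j) 0 = - monom 1 2 * pderiv (monom c j)"
    by (simp only: inv_coeff.simps c)
  also have "\<dots> = monom (- (of_nat j * c)) (0 + Suc j)"
    by (cases j) (simp_all add: pderiv_monom mult_monom minus_monom)
  finally have "inv_coeff (Suc j) 0 = monom (- (of_nat j * c)) (0 + Suc j)" .
  thus ?case by blast
next
  case (3 j i)
  then obtain c d where c: "inv_coeff j (Suc i) = monom c (Suc i + j)" "inv_coeff j i = monom d (i + j)" by auto
  have "inv_coeff (Suc j) (Suc i) = monom (- (of_nat (Suc i + j) * c + d)) (Suc i + Suc j)"
    by (simp add: c pderiv_monom add_monom mult_monom minus_monom)
  thus ?case by blast
qed

lemma inv_coeff_diag: "inv_coeff j j = monom ((- 1) ^ j) (2 * j)"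
proof (induction j)
  case (Suc j)
  thus ?case by (simp add: inv_coeff_eq_0 mult_monom minus_monom)
qed (simp add: monom_0)

lemma poly_inv_coeff: "poly (inv_coeff j i) w = coeff (inv_coeff j i) (i + j) * w ^ (i + j)"
  using inv_coeff_monom[of j i] by (auto simp: poly_monom)

lemma poly_inverse_nonzero:
  assumes "P \<noteq> (0 :: complex poly)"
  shows "\<forall>\<^sub>F w in at 0. poly P (1 / w) \<noteq> 0"
proof -
  have "finite {w. poly P (1 / w) = 0 \<and> w \<noteq> 0}"
  proof (rule finite_subset)
    show "{w. poly P (1 / w) = 0 \<and> w \<noteq> 0} \<subseteq> (\<lambda>z. 1 / z) ` {z. poly P z = 0}"
      by (auto simp: image_iff intro!: exI[of _ "1 / w" for w])
  qed (use assms poly_roots_finite in auto)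
  from finite_imp_closed[OF this] have "open (- {w. poly P (1 / w) = 0 \<and> w \<noteq> 0})" by blast
  from eventually_nhds_in_open[OF this, of 0] have "\<forall>\<^sub>F w in nhds 0. w \<noteq> 0 \<longrightarrow> poly P (1 / w) \<noteq> 0"
    by (auto elim!: eventually_mono)
  thus ?thesis by (simp add: eventually_at_filter)
qed

text \<open>The coefficient of \<open>(d/dw)^i\<close> at infinity is a triangular combination of the
  functions \<open>w ^ j * poly (P (\<mu> - j)) (1 / w)\<close> with \<open>j \<ge> i\<close>, hence the downward induction on \<open>i\<close>.\<close>

lemma fuchs_bigo:
  assumes reg: "at_most_regular_singular_at_infinity \<mu> P" and P0: "P 0 \<noteq> 0"
  shows "i \<le> \<mu> \<Longrightarrow> (\<lambda>w. poly (P (\<mu> - i)) (1 / w) * w ^ i) \<in> O[at 0](\<lambda>w. poly (P 0) (1 / w) * w ^ \<mu>)"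
proof (induction "\<mu> - i" arbitrary: i rule: less_induct)
  case less
  define X where "X j w = poly (P (\<mu> - j)) (1 / w) * w ^ j" for j and w :: complex
  define c where "c j = coeff (inv_coeff j i) (i + j)" for j
  have X\<mu>: "X \<mu> = (\<lambda>w. poly (P 0) (1 / w) * w ^ \<mu>)" by (simp add: X_def fun_eq_iff)
  have ci: "c i = (- 1) ^ i" by (simp add: c_def inv_coeff_diag flip: mult_2)
  have inf: "inf_coeff \<mu> P i w = w ^ i * (\<Sum>j\<in>{i..\<mu>}. c j * X j w)" for w
  proof -
    have "inf_coeff \<mu> P i w = (\<Sum>j\<le>\<mu>. w ^ i * (c j * X j w))"
      unfolding inf_coeff_def
      by (intro sum.cong refl) (simp add: X_def c_def poly_inv_coeff[of _ i] power_add mult_ac)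
    also have "\<dots> = (\<Sum>j\<in>{i..\<mu>}. w ^ i * (c j * X j w))"
      by (intro sum.mono_neutral_right) (auto simp: c_def inv_coeff_eq_0)
    finally show ?thesis by (simp add: sum_distrib_left)
  qed
  have inf\<mu>: "inf_coeff \<mu> P \<mu> w = w ^ \<mu> * ((- 1) ^ \<mu> * X \<mu> w)" for w
  proof -
    have "inf_coeff \<mu> P \<mu> w = (\<Sum>j\<in>{\<mu>}. poly (P (\<mu> - j)) (1 / w) * poly (inv_coeff j \<mu>) w)"
      unfolding inf_coeff_def by (intro sum.mono_neutral_right) (auto simp: inv_coeff_eq_0)
    moreover have "poly (inv_coeff \<mu> \<mu>) w = (- 1) ^ \<mu> * (w ^ \<mu> * w ^ \<mu>)"
      by (simp add: inv_coeff_diag poly_monom mult_2 power_add)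
    ultimately show ?thesis by (simp add: X_def)
  qed
  obtain h where h: "h analytic_on {0}"
    "\<forall>\<^sub>F w in at 0. w ^ (\<mu> - i) * (inf_coeff \<mu> P i w / inf_coeff \<mu> P \<mu> w) = h w"
    using reg less.prems unfolding at_most_regular_singular_at_infinity_def at_most_regular_singular_def
    by auto
  have "isCont h 0" using h(1) by (simp add: analytic_at_imp_isCont)
  hence hO: "h \<in> O[at 0](\<lambda>_. 1)"
    by (intro bigoI_tendsto[of _ _ "h 0"]) (auto simp: isCont_def)
  have "(\<lambda>w. \<Sum>j\<in>{i..\<mu>}. c j * X j w) \<in> O[at 0](X \<mu>)"
  proof -
    have nz: "\<forall>\<^sub>F w in at 0. w \<noteq> 0 \<and> X \<mu> w \<noteq> 0"
      using poly_inverse_nonzero[OF P0] eventually_neq_at_within[of 0 0 UNIV]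
      by eventually_elim (auto simp: X_def)
    \<comment> \<open>All powers of \<open>w\<close> cancel between \<open>inf\<close>,
      \<open>inf\<mu>\<close> and the factor in the regularity condition; what remains is the
      quotient of the triangular combination by \<open>X \<mu>\<close>.\<close>
    have "\<forall>\<^sub>F w in at 0. (\<Sum>j\<in>{i..\<mu>}. c j * X j w) = h w * ((- 1) ^ \<mu> * X \<mu> w)"
      using h(2) nz
    proof eventually_elim
      case (elim w)
      have "w ^ \<mu> = w ^ (\<mu> - i) * w ^ i" using less.prems by (simp flip: power_add)
      hence "h w = (\<Sum>j\<in>{i..\<mu>}. c j * X j w) / ((- 1) ^ \<mu> * X \<mu> w)"
        using elim unfolding elim(1)[symmetric] inf inf\<mu> by (simp add: field_simps)
      thus ?case using elim by simp
    qed
    moreover have "(\<lambda>w. h w * ((- 1) ^ \<mu> * X \<mu> w)) \<in> O[at 0](\<lambda>w. 1 * X \<mu> w)"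
      by (intro landau_o.big.mult hO) auto
    ultimately show ?thesis by (simp add: landau_o.big.in_cong)
  qed
  moreover have "(\<lambda>w. \<Sum>j\<in>{i<..\<mu>}. c j * X j w) \<in> O[at 0](X \<mu>)"
  proof (rule big_sum_in_bigo)
    fix j assume "j \<in> {i<..\<mu>}"
    hence "X j \<in> O[at 0](X \<mu>)" unfolding X\<mu> unfolding X_def by (intro less.hyps) auto
    thus "(\<lambda>w. c j * X j w) \<in> O[at 0](X \<mu>)" by (cases "c j = 0") auto
  qed
  ultimately have "(\<lambda>w. (\<Sum>j\<in>{i..\<mu>}. c j * X j w) - (\<Sum>j\<in>{i<..\<mu>}. c j * X j w)) \<in> O[at 0](X \<mu>)"
    by (rule sum_in_bigo)
  also have "(\<lambda>w. (\<Sum>j\<in>{i..\<mu>}. c j * X j w) - (\<Sum>j\<in>{i<..\<mu>}. c j * X j w)) = (\<lambda>w. (- 1) ^ i * X i w)"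
    using less.prems by (simp add: sum.head ci fun_eq_iff)
  finally have "X i \<in> O[at 0](X \<mu>)" by simp
  thus ?case unfolding X\<mu> unfolding X_def .
qed

lemma poly_inverse_limit:
  "((\<lambda>w. poly p (1 / w) * w ^ degree p) \<longlongrightarrow> lead_coeff p) (at 0)" for p :: "complex poly"
proof -
  have "poly (reflect_poly p) w = poly p (1 / w) * w ^ degree p" if "w \<noteq> 0" for w
    using poly_reflect_poly_nz[OF that, of p] by (simp add: inverse_eq_divide mult.commute)
  hence "\<forall>\<^sub>F w in at 0. poly (reflect_poly p) w = poly p (1 / w) * w ^ degree p"
    by (auto simp: eventually_at_filter)
  moreover have "(poly (reflect_poly p) \<longlongrightarrow> poly (reflect_poly p) 0) (at 0)"
    by (rule poly_isCont[unfolded isCont_def])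
  ultimately show ?thesis by (auto dest: Lim_transform_eventually)
qed

text \<open>The condition of Fuchs at infinity, with sums in place of differences. An excess
  \<open>d > 0\<close> would bound a nonzero leading coefficient by a quantity of size
  \<open>norm w ^ d\<close>, which tends to 0.\<close>

lemma fuchs_degree:
  assumes reg: "at_most_regular_singular_at_infinity \<mu> P" and P0: "P 0 \<noteq> 0" and "j \<le> \<mu>" "P (\<mu> - j) \<noteq> 0"
  shows "degree (P (\<mu> - j)) + \<mu> \<le> degree (P 0) + j"
proof (rule ccontr)
  assume neg: "\<not> ?thesis"
  define d where "d = degree (P (\<mu> - j)) + \<mu> - (degree (P 0) + j)"
  have d: "d > 0" "degree (P (\<mu> - j)) + \<mu> = degree (P 0) + j + d" using neg by (auto simp: d_def)
  obtain C where C: "\<forall>\<^sub>F w in at 0. norm (poly (P (\<mu> - j)) (1 / w) * w ^ j) \<le> C * norm (poly (P 0) (1 / w) * w ^ \<mu>)"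
    using fuchs_bigo[OF reg P0 assms(3)] by (auto elim!: landau_o.bigE)
  have "\<forall>\<^sub>F w in at 0. norm (poly (P (\<mu> - j)) (1 / w) * w ^ degree (P (\<mu> - j)))
      \<le> C * norm (poly (P 0) (1 / w) * w ^ degree (P 0)) * norm w ^ d"
    using C eventually_neq_at_within[of 0 0 UNIV]
  proof eventually_elim
    case (elim w)
    let ?a = "degree (P (\<mu> - j))" and ?b = "degree (P 0)"
    have "norm (poly (P (\<mu> - j)) (1 / w) * w ^ ?a) * norm w ^ (\<mu> + j) =
        norm (poly (P (\<mu> - j)) (1 / w) * w ^ j) * norm w ^ (?a + \<mu>)"
      by (simp add: norm_mult norm_power power_add mult_ac)
    also have "\<dots> \<le> C * norm (poly (P 0) (1 / w) * w ^ \<mu>) * norm w ^ (?a + \<mu>)"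
      by (intro mult_right_mono elim) auto
    also have "\<dots> = C * norm (poly (P 0) (1 / w) * w ^ ?b) * norm w ^ d * norm w ^ (\<mu> + j)"
      unfolding d(2) by (simp add: norm_mult norm_power power_add mult_ac)
    finally show ?case using elim by (simp add: mult_le_cancel_right)
  qed
  moreover have "((\<lambda>w. C * norm (poly (P 0) (1 / w) * w ^ degree (P 0)) * norm w ^ d) \<longlongrightarrow>
      C * norm (lead_coeff (P 0)) * norm (0 :: complex) ^ d) (at 0)"
    by (intro tendsto_intros poly_inverse_limit)
  moreover have "((\<lambda>w. norm (poly (P (\<mu> - j)) (1 / w) * w ^ degree (P (\<mu> - j)))) \<longlongrightarrow> norm (lead_coeff (P (\<mu> - j)))) (at 0)"
    by (intro tendsto_norm poly_inverse_limit)
  ultimately have "norm (lead_coeff (P (\<mu> - j))) \<le> C * norm (lead_coeff (P 0)) * norm (0 :: complex) ^ d"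
    by (intro tendsto_le[of "at (0 :: complex)"]) auto
  thus False using d(1) assms(4) by (simp add: power_0_left)
qed

text \<open>Degrees are raised by at most \<open>degree (P 0) - \<mu>\<close>. Regularity at
  infinity is used below only in this form.\<close>

lemma op_coeff_eq_0_fuchs:
  assumes reg: "at_most_regular_singular_at_infinity \<mu> P" and P0: "P 0 \<noteq> 0" and s: "s > degree (P 0)"
  shows "op_coeff \<mu> P s n = 0"
  unfolding op_coeff_def
proof (rule sum.neutral, rule ballI)
  fix j assume j: "j \<in> {..\<mu>}"
  show "(if \<mu> \<le> s + j then coeff (P (\<mu> - j)) (s + j - \<mu>) else 0) * falling n j = 0"
  proof (cases "P (\<mu> - j) = 0")
    case False
    hence "degree (P (\<mu> - j)) + \<mu> \<le> degree (P 0) + j" using fuchs_degree[OF reg P0 _ False] j by simp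
    thus ?thesis using s by (auto intro: coeff_eq_0)
  qed auto
qed

text \<open>The recursion read from the top: the coefficient of index \<open>n\<close> is governed
  by the next \<open>degree (P 0)\<close> ones, with the indicial polynomial at infinity as
  pivot.\<close>

lemma fps_op_nth_infinity:
  assumes reg: "at_most_regular_singular_at_infinity \<mu> P" and P0: "P 0 \<noteq> 0" and "n + degree (P 0) = e + \<mu>"
  shows "fps_nth (fps_op \<mu> P F) e =
    (\<Sum>k\<le>degree (P 0). op_coeff \<mu> P (degree (P 0) - k) (n + k) * fps_nth F (n + k))"
proof -
  let ?K = "degree (P 0)"
  have "fps_nth (fps_op \<mu> P F) e = (\<Sum>s\<le>n + ?K. op_coeff \<mu> P s (n + ?K - s) * fps_nth F (n + ?K - s))"
    unfolding fps_op_nth assms(3) ..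
  also have "\<dots> = (\<Sum>s\<le>?K. op_coeff \<mu> P s (n + ?K - s) * fps_nth F (n + ?K - s))"
    by (intro sum.mono_neutral_right) (auto simp: op_coeff_eq_0_fuchs[OF reg P0])
  also have "\<dots> = (\<Sum>k\<le>?K. op_coeff \<mu> P (?K - k) (n + k) * fps_nth F (n + k))"
    by (rule sum.reindex_bij_witness[of _ "\<lambda>k. ?K - k" "\<lambda>k. ?K - k"]) auto
  finally show ?thesis .
qed

text \<open>As a function of \<open>n\<close> this is the indicial polynomial at infinity; the lower
  bound of order \<mu> excludes large zeros. Taking \<open>n0 \<ge> \<mu>\<close> keeps
  \<open>n0 - \<mu>\<close> exact.\<close>

lemma op_coeff_indicial_nonzero:
  assumes "P 0 \<noteq> 0"
  obtains n0 where "n0 \<ge> \<mu>" "\<And>n. n \<ge> n0 \<Longrightarrow> op_coeff \<mu> P (degree (P 0)) n \<noteq> 0"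
proof -
  have "coeff (P 0) (degree (P 0)) \<noteq> 0" using assms by simp
  then obtain c where c: "c > 0" "\<forall>\<^sub>F n in sequentially. norm (op_coeff \<mu> P (degree (P 0)) n) \<ge> c * real n ^ \<mu>"
    by (rule op_coeff_lower_bound)
  have "\<forall>\<^sub>F n in sequentially. op_coeff \<mu> P (degree (P 0)) n \<noteq> 0"
    using c(2) eventually_gt_at_top[of 0]
  proof eventually_elim
    case (elim n)
    hence "c * real n ^ \<mu> > 0" using c by simp
    thus ?case using elim by auto
  qed
  then obtain n1 where "\<And>n. n \<ge> n1 \<Longrightarrow> op_coeff \<mu> P (degree (P 0)) n \<noteq> 0"
    by (auto simp: eventually_at_top_linorder)
  thus ?thesis using that[of "max n1 \<mu>"] by auto
qed

text \<open>The recursion for the Taylor coefficients bounds each coefficient of large index by a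
  constant times one of the next \<open>degree (P 0)\<close> coefficients. If one of them were nonzero, they would
  decay at most geometrically along a subsequence, which is impossible for an entire function.\<close>

lemma entire_imp_polynomial:
  assumes reg: "at_most_regular_singular_at_infinity \<mu> P" and P0: "P 0 \<noteq> 0"
    and U: "U holomorphic_on UNIV" and D: "\<And>z. diff_op \<mu> P U z = poly p z"
  shows "\<exists>q. \<forall>z. U z = poly q z"
proof -
  let ?K = "degree (P 0)"
  define F where "F = fps_expansion U 0"
  have F: "(\<lambda>w. U (0 + w)) has_fps_expansion F"
    unfolding F_def by (rule analytic_at_imp_has_fps_expansion) (use U in \<open>auto simp: analytic_at\<close>)
  have "(\<lambda>w. diff_op \<mu> P U (0 + w)) has_fps_expansion fps_op \<mu> (\<lambda>k. P k \<circ>\<^sub>p [:0, 1:]) F"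
    by (rule has_fps_expansion_diff_op[OF F])
  hence "poly p has_fps_expansion fps_op \<mu> P F" by (simp add: D pcompose_idR)
  hence op: "fps_op \<mu> P F = fps_of_poly p"
    by (rule fps_expansion_unique_complex[OF _ has_fps_expansion_poly])
  have "coeff (P 0) ?K \<noteq> 0" using P0 by simp
  then obtain c where c: "c > 0" "\<forall>\<^sub>F n in sequentially. norm (op_coeff \<mu> P ?K n) \<ge> c * real n ^ \<mu>"
    by (rule op_coeff_lower_bound)
  obtain n1 where n1: "\<And>n. n \<ge> n1 \<Longrightarrow> norm (op_coeff \<mu> P ?K n) \<ge> c * real n ^ \<mu>"
    using c(2) by (auto simp: eventually_at_top_linorder)
  obtain A where A: "A > 0" "\<And>s n. n > 0 \<Longrightarrow> norm (op_coeff \<mu> P s n) \<le> A * real n ^ \<mu>"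
    using op_coeff_bound[of \<mu> P] by metis
  \<comment> \<open>The term \<open>degree p\<close> puts the relevant coefficients of the image
    beyond \<open>p\<close>, and \<open>?K\<close> gives \<open>n + k \<le> 2 * n\<close>. In
    \<open>M\<close>, the summand 1 makes the estimate for the \<open>?K\<close> later terms
    strict.\<close>
  define N where "N = n1 + \<mu> + ?K + degree p + 1"
  define M where "M = 1 + real ?K * (A * 2 ^ \<mu> / c)"
  have M1: "M \<ge> 1" using A c by (simp add: M_def)
  have step: "\<exists>k>0. norm (fps_nth F n) \<le> M * norm (fps_nth F (n + k))" if n: "n \<ge> N" "fps_nth F n \<noteq> 0" for n
  proof (rule ccontr)
    assume neg: "\<not> ?thesis"
    have less: "M * norm (fps_nth F (n + k)) < norm (fps_nth F n)" if "k > 0" for k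
      using neg that by (meson not_le_imp_less)
    have n0: "n > 0" using n by (simp add: N_def)
    define e where "e = n + ?K - \<mu>"
    have "0 = fps_nth (fps_op \<mu> P F) e" unfolding op using n by (simp add: e_def N_def coeff_eq_0)
    also have "\<dots> = (\<Sum>k\<le>?K. op_coeff \<mu> P (?K - k) (n + k) * fps_nth F (n + k))"
      by (rule fps_op_nth_infinity[OF reg P0]) (use n in \<open>auto simp: e_def N_def\<close>)
    also have "\<dots> = op_coeff \<mu> P ?K n * fps_nth F n +
        (\<Sum>k\<in>{0<..?K}. op_coeff \<mu> P (?K - k) (n + k) * fps_nth F (n + k))"
      by (subst sum.head[of 0 ?K, folded atMost_atLeast0]) auto
    finally have "op_coeff \<mu> P ?K n * fps_nth F n =
        - (\<Sum>k\<in>{0<..?K}. op_coeff \<mu> P (?K - k) (n + k) * fps_nth F (n + k))"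
      by (simp add: eq_neg_iff_add_eq_0)
    hence "norm (op_coeff \<mu> P ?K n) * norm (fps_nth F n) =
        norm (\<Sum>k\<in>{0<..?K}. op_coeff \<mu> P (?K - k) (n + k) * fps_nth F (n + k))"
      by (metis norm_minus_cancel norm_mult)
    also have "\<dots> \<le> (\<Sum>k\<in>{0<..?K}. (A * (2 ^ \<mu> * real n ^ \<mu>)) * (norm (fps_nth F n) / M))"
    proof (rule sum_norm_le)
      fix k assume k: "k \<in> {0<..?K}"
      have "norm (op_coeff \<mu> P (?K - k) (n + k)) \<le> A * real (n + k) ^ \<mu>" using n0 by (intro A) auto
      also have "\<dots> \<le> A * (2 * real n) ^ \<mu>"
        using k n A(1) by (intro mult_left_mono power_mono) (auto simp: N_def)
      finally have 1: "norm (op_coeff \<mu> P (?K - k) (n + k)) \<le> A * (2 ^ \<mu> * real n ^ \<mu>)"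
        by (simp add: power_mult_distrib)
      have 2: "norm (fps_nth F (n + k)) \<le> norm (fps_nth F n) / M"
        using less[of k] k M1 by (simp add: field_simps)
      show "norm (op_coeff \<mu> P (?K - k) (n + k) * fps_nth F (n + k)) \<le> (A * (2 ^ \<mu> * real n ^ \<mu>)) * (norm (fps_nth F n) / M)"
        unfolding norm_mult using A(1) by (intro mult_mono 1 2) auto
    qed
    also have "\<dots> = real ?K * (A * 2 ^ \<mu> / c) / M * (c * real n ^ \<mu> * norm (fps_nth F n))"
      using c by simp
    also have "\<dots> < 1 * (c * real n ^ \<mu> * norm (fps_nth F n))"
    proof (rule mult_strict_right_mono)
      have "real ?K * (A * 2 ^ \<mu> / c) < M" unfolding M_def by linarith
      thus "real ?K * (A * 2 ^ \<mu> / c) / M < 1" using M1 by (subst divide_less_eq_1_pos) auto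
    qed (use c(1) n n0 in auto)
    also have "\<dots> \<le> norm (op_coeff \<mu> P ?K n) * norm (fps_nth F n)"
      using n1[of n] n by (simp add: N_def mult_right_mono)
    finally show False by simp
  qed
  have zero: "fps_nth F n = 0" if n: "n \<ge> N" for n
  proof (rule ccontr)
    assume nz: "fps_nth F n \<noteq> 0"
    have ex: "\<exists>k\<ge>j. norm (fps_nth F n) \<le> M ^ k * norm (fps_nth F (n + k))" for j
    proof (induction j)
      case (Suc j)
      then obtain k where k: "k \<ge> j" "norm (fps_nth F n) \<le> M ^ k * norm (fps_nth F (n + k))" by blast
      hence "fps_nth F (n + k) \<noteq> 0" using nz by auto
      with step[of "n + k"] n obtain l where l: "l > 0" "norm (fps_nth F (n + k)) \<le> M * norm (fps_nth F (n + k + l))"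
        by auto
      have "norm (fps_nth F n) \<le> M ^ k * (M * norm (fps_nth F (n + k + l)))"
        using k(2) l(2) M1 by (meson mult_left_mono order_trans zero_le_power zero_le_one)
      also have "\<dots> = M ^ Suc k * norm (fps_nth F (n + (k + l)))" by (simp add: add.assoc)
      also have "\<dots> \<le> M ^ (k + l) * norm (fps_nth F (n + (k + l)))"
        using l M1 by (intro mult_right_mono power_increasing) auto
      finally show ?case using k(1) l(1) by (intro exI[of _ "k + l"]) auto
    qed (auto intro: exI[of _ 0])
    \<comment> \<open>Radius \<open>2 * M\<close> beats the loss of a factor \<open>M\<close> per
      index: along the chain from \<open>ex\<close> a factor \<open>2 ^ k\<close> is left over,
      which is unbounded.\<close>
    have "bounded (range (\<lambda>i. fps_nth (fps_expansion U 0) i * of_real (2 * M) ^ i))"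
      by (rule holomorphic_imp_bounded_taylor[of _ _ "2 * M + 1"]) (use U M1 in \<open>auto intro: holomorphic_on_subset\<close>)
    then obtain B where B: "\<And>i. norm (fps_nth F i * of_real (2 * M) ^ i) \<le> B"
      by (auto simp: bounded_iff F_def)
    have "norm (fps_nth F n) * 2 ^ j \<le> B" for j
    proof -
      obtain k where k: "k \<ge> j" "norm (fps_nth F n) \<le> M ^ k * norm (fps_nth F (n + k))" using ex by blast
      have "norm (fps_nth F n) * 2 ^ j \<le> (M ^ k * norm (fps_nth F (n + k))) * 2 ^ k"
        using k M1 by (intro mult_mono power_increasing) auto
      also have "\<dots> = norm (fps_nth F (n + k)) * (2 * M) ^ k" by (simp add: power_mult_distrib)
      also have "\<dots> \<le> norm (fps_nth F (n + k)) * (2 * M) ^ (n + k)"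
        using M1 by (intro mult_left_mono power_increasing) auto
      also have "\<dots> \<le> B" using B[of "n + k"] M1 by (simp add: norm_mult norm_power)
      finally show ?thesis .
    qed
    moreover obtain j where "B / norm (fps_nth F n) < 2 ^ j" using real_arch_pow[of 2] by auto
    ultimately show False using nz by (auto simp: field_simps not_le[symmetric])
  qed
  define q where "q = (\<Sum>n<N. monom (fps_nth F n) n)"
  have "coeff q i = fps_nth F i" for i
  proof -
    have "coeff q i = (\<Sum>k<N. if k = i then fps_nth F k else 0)" by (simp add: q_def coeff_sum)
    thus ?thesis using zero[of i] by (auto simp: sum.delta)
  qed
  hence "fps_of_poly q = F" by (intro fps_ext) simp
  hence "(\<lambda>w. U w - poly q w) has_fps_expansion F - F"
    using has_fps_expansion_diff[OF F has_fps_expansion_poly[of q]] by simp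
  hence ev: "\<forall>\<^sub>F z in nhds 0. U z - poly q z = 0" by (simp add: has_fps_expansion_0_iff)
  have "U z - poly q z = 0" for z
  proof (rule holomorphic_fun_eq_0_on_connected[of "\<lambda>z. U z - poly q z" UNIV 0])
    show "(\<lambda>z. U z - poly q z) holomorphic_on UNIV" using U by (intro holomorphic_intros) auto
    show "(deriv ^^ n) (\<lambda>z. U z - poly q z) 0 = 0" for n
      using higher_deriv_cong_ev[OF ev refl, of n] by simp
  qed auto
  thus ?thesis by (intro exI[of _ q]) auto
qed

section \<open>Linear differential equations on simply connected domains\<close>

text \<open>The Riemann map gives a convex model of the domain, where integration along segments
  yields the factorial bounds of Picard iteration.\<close>

lemma simply_connected_uniformization:
  assumes "open S" "simply_connected S" "S \<noteq> {}"
  obtains W and \<phi> \<psi> :: "complex \<Rightarrow> complex" where "open W" "convex W" "\<phi> holomorphic_on W" "\<psi> holomorphic_on S"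
    "\<And>z. z \<in> S \<Longrightarrow> \<psi> z \<in> W \<and> \<phi> (\<psi> z) = z" "\<And>w. w \<in> W \<Longrightarrow> \<phi> w \<in> S"
proof -
  from Riemann_mapping_theorem[of S] assms consider "S = UNIV" |
    f g where "f holomorphic_on S" "g holomorphic_on ball 0 1"
      "\<forall>z\<in>S. f z \<in> ball 0 1 \<and> g (f z) = z" "\<forall>z\<in>ball 0 1. g z \<in> S \<and> f (g z) = z"
    by blast
  thus ?thesis
  proof cases
    case 1
    thus ?thesis using that[of UNIV "\<lambda>z. z" "\<lambda>z. z"] by auto
  next
    case (2 f g)
    thus ?thesis using that[of "ball 0 1" g f] by auto
  qed
qed

text \<open>\<open>I\<close> below is integration from \<open>z0\<close>; Picard iteration for
  \<open>w = f\<^sup>(\<^sup>\<mu>\<^sup>)\<close> turns the equation into \<open>w = g + (\<Sum>j<\<mu>. c j * I ^^ (\<mu> - j) w)\<close>.\<close>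

lemma linear_ode_solution:
  fixes c :: "nat \<Rightarrow> complex \<Rightarrow> complex"
  assumes S: "open S" "simply_connected S" and z0: "z0 \<in> S"
    and c: "\<And>j. j < \<mu> \<Longrightarrow> c j holomorphic_on S" and g: "g holomorphic_on S"
  obtains f where "f holomorphic_on S" "\<And>j. j < \<mu> \<Longrightarrow> (deriv ^^ j) f z0 = 0"
    "\<And>z. z \<in> S \<Longrightarrow> (deriv ^^ \<mu>) f z = (\<Sum>j<\<mu>. c j z * (deriv ^^ j) f z) + g z"
proof -
  have "S \<noteq> {}" using z0 by auto
  then obtain W \<phi> \<psi> where W: "open W" "convex W" and \<phi>: "\<phi> holomorphic_on W" and \<psi>: "\<psi> holomorphic_on S"
    and \<phi>\<psi>: "\<And>z. z \<in> S \<Longrightarrow> \<psi> z \<in> W \<and> \<phi> (\<psi> z) = z" and \<phi>S: "\<And>w. w \<in> W \<Longrightarrow> \<phi> w \<in> S"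
    using simply_connected_uniformization[OF S] by metis
  define \<zeta>0 where "\<zeta>0 = \<psi> z0"
  have \<zeta>0: "\<zeta>0 \<in> W" "\<phi> \<zeta>0 = z0" using \<phi>\<psi>[OF z0] by (auto simp: \<zeta>0_def)
  have "\<exists>h. (\<forall>z\<in>S. (h has_field_derivative w z) (at z)) \<and> h z0 = 0" if w: "w holomorphic_on S" for w
  proof -
    obtain h where h: "\<And>z. z \<in> S \<Longrightarrow> (h has_field_derivative w z) (at z)"
      using simply_connected_eq_global_primitive[OF S(1)] S(2) w by blast
    have "((\<lambda>z. h z - h z0) has_field_derivative w z) (at z)" if "z \<in> S" for z
      using DERIV_diff[OF h[OF that] DERIV_const[of "h z0"]] by simp
    thus ?thesis by (intro exI[of _ "\<lambda>z. h z - h z0"]) auto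
  qed
  then obtain I where I: "\<And>w z. w holomorphic_on S \<Longrightarrow> z \<in> S \<Longrightarrow> (I w has_field_derivative w z) (at z)"
    "\<And>w. w holomorphic_on S \<Longrightarrow> I w z0 = 0" by metis
  have I_hol: "I w holomorphic_on S" if "w holomorphic_on S" for w
    using I(1)[OF that] S(1) by (metis holomorphic_on_open)
  have Ik_hol: "(I ^^ k) w holomorphic_on S" if "w holomorphic_on S" for w k
    by (induction k) (auto intro: that I_hol)
  define K where "K w z = (\<Sum>j<\<mu>. c j z * (I ^^ (\<mu> - j)) w z)" for w z
  have K_hol: "K w holomorphic_on S" if "w holomorphic_on S" for w
    unfolding K_def using that by (intro holomorphic_intros c Ik_hol) auto
  define w where "w n = (K ^^ n) g" for n
  have w_hol: "w n holomorphic_on S" for n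
    unfolding w_def by (induction n) (auto intro: g K_hol)
  have local_bound: "\<exists>d h. 0 < d \<and> summable h \<and> (\<forall>n. \<forall>y\<in>ball z d \<inter> S. norm ((I ^^ k) (w n) y) \<le> h n)"
    if z: "z \<in> S" for z k
  proof -
    have "\<psi> z \<in> W" using \<phi>\<psi>[OF z] by blast
    then obtain \<epsilon> where \<epsilon>: "\<epsilon> > 0" "cball (\<psi> z) \<epsilon> \<subseteq> W" using W(1) open_contains_cball by blast
    \<comment> \<open>A compact convex set containing the base point: segments from
      \<open>\<zeta>0\<close> to points near \<open>\<psi> z\<close> stay inside it, so the
      constants below are finite and valid along them.\<close>
    define C where "C = convex hull (insert \<zeta>0 (cball (\<psi> z) \<epsilon>))"
    have C: "compact C" "convex C" "C \<subseteq> W" "\<zeta>0 \<in> C" "cball (\<psi> z) \<epsilon> \<subseteq> C"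
    proof -
      show "compact C" unfolding C_def by (intro compact_convex_hull compact_insert compact_cball)
      show "convex C" unfolding C_def by simp
      show "C \<subseteq> W" unfolding C_def by (rule hull_minimal) (use \<epsilon> \<zeta>0 W in auto)
      have "insert \<zeta>0 (cball (\<psi> z) \<epsilon>) \<subseteq> C" unfolding C_def by (rule hull_subset)
      thus "\<zeta>0 \<in> C" "cball (\<psi> z) \<epsilon> \<subseteq> C" by auto
    qed
    have bound: "\<exists>B\<ge>0. \<forall>\<zeta>\<in>C. norm (h \<zeta>) \<le> B" if "continuous_on C h" for h :: "complex \<Rightarrow> complex"
    proof -
      have "bounded (h ` C)" by (intro compact_imp_bounded compact_continuous_image that C(1))
      then obtain B where "\<And>\<zeta>. \<zeta> \<in> C \<Longrightarrow> norm (h \<zeta>) \<le> B" by (auto simp: bounded_iff)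
      thus ?thesis using C(4) by (meson norm_ge_zero order_trans)
    qed
    have comp: "continuous_on C (\<lambda>\<zeta>. h (\<phi> \<zeta>))" if "h holomorphic_on S" for h
    proof -
      have "(h \<circ> \<phi>) holomorphic_on C"
        by (rule holomorphic_on_compose_gen[OF holomorphic_on_subset[OF \<phi>] that]) (use C \<phi>S in auto)
      thus ?thesis by (metis comp_def continuous_on_cong holomorphic_on_imp_continuous_on)
    qed
    obtain G where G: "G \<ge> 0" "\<And>\<zeta>. \<zeta> \<in> C \<Longrightarrow> norm (g (\<phi> \<zeta>)) \<le> G" using bound[OF comp[OF g]] by blast
    have "deriv \<phi> holomorphic_on W" using \<phi> W(1) by (rule holomorphic_deriv)
    hence "continuous_on C (deriv \<phi>)"
      using C(3) holomorphic_on_imp_continuous_on continuous_on_subset by blast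
    then obtain B where B: "B \<ge> 0" "\<And>\<zeta>. \<zeta> \<in> C \<Longrightarrow> norm (deriv \<phi> \<zeta>) \<le> B" using bound by blast
    have "\<exists>M. \<forall>j<\<mu>. M j \<ge> 0 \<and> (\<forall>\<zeta>\<in>C. norm (c j (\<phi> \<zeta>)) \<le> M j)"
      using bound[OF comp[OF c]] by metis
    then obtain M where M: "\<And>j. j < \<mu> \<Longrightarrow> M j \<ge> 0" "\<And>j \<zeta>. j < \<mu> \<Longrightarrow> \<zeta> \<in> C \<Longrightarrow> norm (c j (\<phi> \<zeta>)) \<le> M j"
      by blast
    have "continuous_on C (\<lambda>\<zeta>. \<zeta> - \<zeta>0)" by (intro continuous_intros)
    then obtain R where R: "R \<ge> 0" "\<And>\<zeta>. \<zeta> \<in> C \<Longrightarrow> norm (\<zeta> - \<zeta>0) \<le> R" using bound by blast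
    \<comment> \<open>Integration along the segment raises the power of the distance by one and
      produces the next factorial; \<open>B\<close> pays for the substitution by
      \<open>\<phi>\<close>.\<close>
    have I_bound: "norm (I v (\<phi> \<zeta>)) \<le> A * B * norm (\<zeta> - \<zeta>0) ^ Suc n / fact (Suc n)"
      if v: "v holomorphic_on S" and A: "A \<ge> 0" "\<And>\<zeta>. \<zeta> \<in> C \<Longrightarrow> norm (v (\<phi> \<zeta>)) \<le> A * norm (\<zeta> - \<zeta>0) ^ n / fact n"
        and \<zeta>: "\<zeta> \<in> C" for v A n \<zeta>
    proof -
      define \<gamma> where "\<gamma> t = \<zeta>0 + complex_of_real t * (\<zeta> - \<zeta>0)" for t
      define s where "s = norm (\<zeta> - \<zeta>0)"
      have \<gamma>C: "\<gamma> t \<in> C" if "0 \<le> t" "t \<le> 1" for t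
      proof -
        have "(1 - t) *\<^sub>R \<zeta>0 + t *\<^sub>R \<zeta> \<in> C" using that C \<zeta> by (intro convexD_alt) auto
        also have "(1 - t) *\<^sub>R \<zeta>0 + t *\<^sub>R \<zeta> = \<gamma> t" by (simp add: \<gamma>_def scaleR_conv_of_real algebra_simps)
        finally show ?thesis .
      qed
      have d\<gamma>: "(\<gamma> has_vector_derivative (\<zeta> - \<zeta>0)) (at t)" for t
        unfolding \<gamma>_def by (auto intro!: derivative_eq_intros)
      have dF: "((\<lambda>t. I v (\<phi> (\<gamma> t))) has_vector_derivative ((\<zeta> - \<zeta>0) * (deriv \<phi> (\<gamma> t) * v (\<phi> (\<gamma> t))))) (at t)"
        if "0 \<le> t" "t \<le> 1" for t
      proof -
        have "\<gamma> t \<in> W" using \<gamma>C[OF that] C by blast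
        hence 1: "(\<phi> has_field_derivative deriv \<phi> (\<gamma> t)) (at (\<gamma> t))" by (rule holomorphic_derivI[OF \<phi> W(1)])
        have 2: "(I v has_field_derivative v (\<phi> (\<gamma> t))) (at (\<phi> (\<gamma> t)))"
          using \<open>\<gamma> t \<in> W\<close> \<phi>S v by (intro I) auto
        have "((\<lambda>\<zeta>. I v (\<phi> \<zeta>)) has_field_derivative v (\<phi> (\<gamma> t)) * deriv \<phi> (\<gamma> t)) (at (\<gamma> t))"
          by (rule DERIV_chain2[OF 2 1])
        from field_vector_diff_chain_at[OF d\<gamma> this] show ?thesis by (simp add: o_def mult_ac)
      qed
      define p where "p t = A * B * s ^ Suc n * (t ^ Suc n / fact (Suc n))" for t :: real
      have dp: "(p has_vector_derivative (A * B * s ^ Suc n * (t ^ n / fact n))) (at t)" for t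
      proof -
        have "(p has_real_derivative (A * B * s ^ Suc n * (of_nat (Suc n) * t ^ n / fact (Suc n)))) (at t)"
          unfolding p_def using DERIV_pow[of "Suc n" t] by (intro DERIV_cmult DERIV_cdivide) simp
        also have "of_nat (Suc n) * t ^ n / fact (Suc n) = t ^ n / fact n" by (simp del: of_nat_Suc)
        finally show ?thesis by (simp add: has_real_derivative_iff_has_vector_derivative)
      qed
      have "norm (I v (\<phi> (\<gamma> 1)) - I v (\<phi> (\<gamma> 0))) \<le> p 1 - p 0"
      proof (rule differentiable_bound_general[where f = "\<lambda>t. I v (\<phi> (\<gamma> t))", OF zero_less_one _ _ dF dp])
        show "continuous_on {0..1} (\<lambda>t. I v (\<phi> (\<gamma> t)))"
          using has_vector_derivative_continuous[OF dF] by (intro continuous_at_imp_continuous_on) auto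
        show "continuous_on {0..1} p" unfolding p_def by (intro continuous_intros) auto
        fix t :: real assume t: "0 < t" "t < 1"
        have "norm (v (\<phi> (\<gamma> t))) \<le> A * norm (\<gamma> t - \<zeta>0) ^ n / fact n" using t by (intro A \<gamma>C) auto
        also have "norm (\<gamma> t - \<zeta>0) = t * s" using t by (simp add: \<gamma>_def s_def norm_mult)
        finally have "norm ((\<zeta> - \<zeta>0) * (deriv \<phi> (\<gamma> t) * v (\<phi> (\<gamma> t)))) \<le> s * (B * (A * (t * s) ^ n / fact n))"
          unfolding norm_mult using t B(1) by (intro mult_mono B \<gamma>C) (auto simp: s_def)
        also have "\<dots> = A * B * s ^ Suc n * (t ^ n / fact n)" by (simp add: power_mult_distrib mult_ac)
        finally show "norm ((\<zeta> - \<zeta>0) * (deriv \<phi> (\<gamma> t) * v (\<phi> (\<gamma> t)))) \<le> A * B * s ^ Suc n * (t ^ n / fact n)" .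
      qed auto
      thus ?thesis using I(2)[OF v] \<zeta>0 by (simp add: \<gamma>_def p_def s_def)
    qed
    have Ik_bound: "norm ((I ^^ k) v (\<phi> \<zeta>)) \<le> A * B ^ k * norm (\<zeta> - \<zeta>0) ^ (n + k) / fact (n + k)"
      if v: "v holomorphic_on S" and A: "A \<ge> 0" "\<And>\<zeta>. \<zeta> \<in> C \<Longrightarrow> norm (v (\<phi> \<zeta>)) \<le> A * norm (\<zeta> - \<zeta>0) ^ n / fact n"
        and \<zeta>: "\<zeta> \<in> C" for v A n k \<zeta>
      using \<zeta>
    proof (induction k arbitrary: \<zeta>)
      case (Suc k)
      from I_bound[OF Ik_hol[OF v, of k] _ Suc.IH Suc.prems] A(1) B(1)
      show ?case by (simp add: mult_ac del: fact_Suc)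
    qed (use A in auto)
    \<comment> \<open>Of the \<open>\<mu> - j\<close> integrations one feeds the factorial; the
      other \<open>\<mu> - j - 1\<close> are absorbed by powers of \<open>R\<close>. Each iteration
      thus costs one geometric factor \<open>L\<close>.\<close>
    define L where "L = (\<Sum>j<\<mu>. M j * (B ^ (\<mu> - j) * R ^ (\<mu> - j - 1)))"
    have L: "L \<ge> 0" unfolding L_def using M(1) B(1) R(1) by (intro sum_nonneg mult_nonneg_nonneg) auto
    have w_bound: "norm (w n (\<phi> \<zeta>)) \<le> (G * L ^ n) * norm (\<zeta> - \<zeta>0) ^ n / fact n" if "\<zeta> \<in> C" for n \<zeta>
      using that
    proof (induction n arbitrary: \<zeta>)
      case (Suc n)
      let ?s = "norm (\<zeta> - \<zeta>0)"
      have "norm (w (Suc n) (\<phi> \<zeta>)) = norm (\<Sum>j<\<mu>. c j (\<phi> \<zeta>) * (I ^^ (\<mu> - j)) (w n) (\<phi> \<zeta>))"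
        by (simp add: w_def K_def)
      also have "\<dots> \<le> (\<Sum>j<\<mu>. M j * (B ^ (\<mu> - j) * R ^ (\<mu> - j - 1)) * (G * L ^ n * (?s ^ Suc n / fact (Suc n))))"
      proof (rule sum_norm_le)
        fix j assume j: "j \<in> {..<\<mu>}"
        have "norm ((I ^^ (\<mu> - j)) (w n) (\<phi> \<zeta>)) \<le> G * L ^ n * B ^ (\<mu> - j) * ?s ^ (n + (\<mu> - j)) / fact (n + (\<mu> - j))"
          using G L by (intro Ik_bound w_hol Suc) auto
        also have "\<dots> \<le> G * L ^ n * B ^ (\<mu> - j) * (?s ^ Suc n * R ^ (\<mu> - j - 1)) / fact (Suc n)"
        proof (intro frac_le mult_left_mono fact_mono)
          have "n + (\<mu> - j) = Suc n + (\<mu> - j - 1)" using j by auto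
          hence "?s ^ (n + (\<mu> - j)) = ?s ^ Suc n * ?s ^ (\<mu> - j - 1)" by (simp only: power_add)
          also have "\<dots> \<le> ?s ^ Suc n * R ^ (\<mu> - j - 1)"
            using R Suc.prems by (intro mult_left_mono power_mono) auto
          finally show "?s ^ (n + (\<mu> - j)) \<le> ?s ^ Suc n * R ^ (\<mu> - j - 1)" .
        qed (use j G L B R in auto)
        finally have *: "norm ((I ^^ (\<mu> - j)) (w n) (\<phi> \<zeta>)) \<le>
            G * L ^ n * B ^ (\<mu> - j) * (?s ^ Suc n * R ^ (\<mu> - j - 1)) / fact (Suc n)" .
        have "norm (c j (\<phi> \<zeta>) * (I ^^ (\<mu> - j)) (w n) (\<phi> \<zeta>)) \<le>
            M j * (G * L ^ n * B ^ (\<mu> - j) * (?s ^ Suc n * R ^ (\<mu> - j - 1)) / fact (Suc n))"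
          unfolding norm_mult using j Suc.prems by (intro mult_mono * M) auto
        thus "norm (c j (\<phi> \<zeta>) * (I ^^ (\<mu> - j)) (w n) (\<phi> \<zeta>)) \<le>
            M j * (B ^ (\<mu> - j) * R ^ (\<mu> - j - 1)) * (G * L ^ n * (?s ^ Suc n / fact (Suc n)))"
          by (simp add: mult_ac del: fact_Suc power_Suc)
      qed
      also have "\<dots> = (G * L ^ Suc n) * ?s ^ Suc n / fact (Suc n)"
        unfolding sum_distrib_right[symmetric] L_def[symmetric] by (simp add: mult_ac del: fact_Suc)
      finally show ?case .
    qed (use G in \<open>auto simp: w_def\<close>)
    define h where "h n = G * B ^ k * R ^ k * ((L * R) ^ n /\<^sub>R fact n)" for n
    have "summable h" unfolding h_def by (intro summable_mult summable_exp_generic)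
    moreover have Ch: "norm ((I ^^ k) (w n) (\<phi> \<zeta>)) \<le> h n" if "\<zeta> \<in> C" for n \<zeta>
    proof -
      have "norm ((I ^^ k) (w n) (\<phi> \<zeta>)) \<le> G * L ^ n * B ^ k * norm (\<zeta> - \<zeta>0) ^ (n + k) / fact (n + k)"
        using G L that by (intro Ik_bound w_hol w_bound) auto
      also have "\<dots> \<le> G * L ^ n * B ^ k * R ^ (n + k) / fact n"
        using G L B R that by (intro frac_le mult_left_mono power_mono fact_mono) auto
      also have "\<dots> = h n" by (simp add: h_def power_add power_mult_distrib field_simps)
      finally show ?thesis .
    qed
    moreover obtain d where d: "d > 0" "\<And>y. y \<in> S \<Longrightarrow> dist y z < d \<Longrightarrow> dist (\<psi> y) (\<psi> z) < \<epsilon>"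
      using holomorphic_on_imp_continuous_on[OF \<psi>] \<epsilon>(1) z unfolding continuous_on_iff by metis
    have "norm ((I ^^ k) (w n) y) \<le> h n" if "y \<in> ball z d \<inter> S" for n y
    proof -
      have "\<psi> y \<in> cball (\<psi> z) \<epsilon>" using d(2)[of y] that by (auto simp: dist_commute)
      hence "\<psi> y \<in> C" using C by blast
      from Ch[OF this] show ?thesis using \<phi>\<psi>[of y] that by auto
    qed
    ultimately show ?thesis using d(1) by blast
  qed
  \<comment> \<open>\<open>T 0\<close> solves the integral equation, \<open>T \<mu>\<close> will be
    the solution of the differential equation, and \<open>T (\<mu> - j)\<close> its derivative of
    order \<open>j\<close>.\<close>
  define T where "T k z = (\<Sum>n. (I ^^ k) (w n) z)" for k z
  have T_sums: "(\<lambda>n. (I ^^ k) (w n) z) sums T k z" if z: "z \<in> S" for k z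
  proof -
    obtain d h where dh: "0 < d" "summable h" "\<forall>n. \<forall>y\<in>ball z d \<inter> S. norm ((I ^^ k) (w n) y) \<le> h n"
      using local_bound[OF z] by blast
    have "summable (\<lambda>n. (I ^^ k) (w n) z)"
      by (rule summable_comparison_test'[OF dh(2), of 0]) (use dh z in auto)
    thus ?thesis unfolding T_def by (rule summable_sums)
  qed
  have T_deriv: "\<exists>t. (T k has_field_derivative t) (at z) \<and> (\<lambda>n. v n z) sums t"
    if "z \<in> S" "\<And>n z. z \<in> S \<Longrightarrow> ((I ^^ k) (w n) has_field_derivative v n z) (at z)" for z k v
  proof -
    have "\<exists>g g'. \<forall>x\<in>S. ((\<lambda>n. (I ^^ k) (w n) x) sums g x) \<and> ((\<lambda>n. v n x) sums g' x) \<and>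
        (g has_field_derivative g' x) (at x)"
    proof (rule series_and_derivative_comparison_local[OF S(1)])
      fix x assume "x \<in> S"
      from local_bound[OF this, of k] obtain d h where "0 < d" "summable h"
        "\<forall>n. \<forall>y\<in>ball x d \<inter> S. norm ((I ^^ k) (w n) y) \<le> h n" by blast
      thus "\<exists>d h. 0 < d \<and> summable h \<and>
        (\<forall>\<^sub>F n in sequentially. \<forall>y\<in>ball x d \<inter> S. norm ((I ^^ k) (w n) y) \<le> h n)"
        by (intro exI[of _ d] exI[of _ h]) (simp add: always_eventually)
    qed (use that in auto)
    then obtain G G' where G: "\<And>x. x \<in> S \<Longrightarrow> ((\<lambda>n. (I ^^ k) (w n) x) sums G x)"
      "\<And>x. x \<in> S \<Longrightarrow> ((\<lambda>n. v n x) sums G' x)" "\<And>x. x \<in> S \<Longrightarrow> (G has_field_derivative G' x) (at x)" by blast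
    have eq: "G x = T k x" if "x \<in> S" for x using G(1)[OF that] T_sums[OF that] by (rule sums_unique2)
    have "(T k has_field_derivative G' z) (at z)"
      by (rule has_field_derivative_transform_within_open[OF G(3) S(1)]) (use that eq in auto)
    thus ?thesis using G(2) that by blast
  qed
  have T_deriv_Suc: "(T (Suc k) has_field_derivative T k z) (at z)" if "z \<in> S" for k z
  proof -
    have "((I ^^ Suc k) (w n) has_field_derivative (I ^^ k) (w n) z) (at z)" if "z \<in> S" for n z
      using I(1)[OF Ik_hol[OF w_hol] that] by simp
    from T_deriv[OF that this] T_sums[OF that] show ?thesis using sums_unique2 by blast
  qed
  have T_hol: "T k holomorphic_on S" for k
  proof (cases k)
    case 0
    \<comment> \<open>\<open>T 0\<close> does not arise by integration, so its holomorphy comes from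
      termwise differentiation of the series.\<close>
    have "(w n has_field_derivative deriv (w n) z) (at z)" if "z \<in> S" for n z
      by (rule holomorphic_derivI[OF w_hol S(1) that])
    with T_deriv[of _ k "\<lambda>n. deriv (w n)"] show ?thesis
      using 0 by (simp add: holomorphic_on_open[OF S(1)]) blast
  next
    case (Suc l)
    thus ?thesis using T_deriv_Suc by (auto simp: holomorphic_on_open[OF S(1)])
  qed
  have higher: "(deriv ^^ j) (T \<mu>) z = T (\<mu> - j) z" if "z \<in> S" "j \<le> \<mu>" for j z
    using that
  proof (induction j arbitrary: z)
    case (Suc j)
    have "\<forall>\<^sub>F x in nhds z. (deriv ^^ j) (T \<mu>) x = T (\<mu> - j) x"
      using eventually_nhds_in_open[OF S(1) Suc.prems(1)]
      by eventually_elim (use Suc in auto)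
    hence "(deriv ^^ Suc j) (T \<mu>) z = deriv (T (\<mu> - j)) z" by (simp add: deriv_cong_ev)
    also have "\<mu> - j = Suc (\<mu> - Suc j)" using Suc.prems by simp
    hence "deriv (T (\<mu> - j)) z = T (\<mu> - Suc j) z"
      using T_deriv_Suc[OF Suc.prems(1)] by (simp add: DERIV_imp_deriv)
    finally show ?case .
  qed simp
  show ?thesis
  proof (rule that[of "T \<mu>"])
    show "T \<mu> holomorphic_on S" by (rule T_hol)
    show "(deriv ^^ j) (T \<mu>) z0 = 0" if j: "j < \<mu>" for j
    proof -
      obtain l where l: "\<mu> - j = Suc l" using j by (metis Suc_diff_Suc)
      have "(I ^^ (\<mu> - j)) (w n) z0 = 0" for n using I(2)[OF Ik_hol[OF w_hol]] by (simp add: l)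
      thus ?thesis using higher[OF z0, of j] j by (simp add: T_def)
    qed
    fix z assume z: "z \<in> S"
    have "(\<lambda>n. \<Sum>j<\<mu>. c j z * (I ^^ (\<mu> - j)) (w n) z) sums (\<Sum>j<\<mu>. c j z * T (\<mu> - j) z)"
      by (intro sums_sum sums_mult T_sums z)
    hence "(\<lambda>n. w (Suc n) z) sums (\<Sum>j<\<mu>. c j z * T (\<mu> - j) z)" by (simp add: w_def K_def)
    hence "(\<lambda>n. w n z) sums ((\<Sum>j<\<mu>. c j z * T (\<mu> - j) z) + w 0 z)"
      by (rule sums_Suc)
    moreover have "(\<lambda>n. w n z) sums T 0 z" using T_sums[OF z, of 0] by simp
    ultimately have "T 0 z = (\<Sum>j<\<mu>. c j z * T (\<mu> - j) z) + g z"
      using sums_unique2 by (fastforce simp: w_def)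
    thus "(deriv ^^ \<mu>) (T \<mu>) z = (\<Sum>j<\<mu>. c j z * (deriv ^^ j) (T \<mu>) z) + g z"
      using higher[OF z] by simp
  qed
qed

lemma diff_op_solution:
  assumes S: "open S" "simply_connected S" and z0: "z0 \<in> S" and P0: "\<And>z. z \<in> S \<Longrightarrow> poly (P 0) z \<noteq> 0"
    and g: "g holomorphic_on S"
  obtains f where "f holomorphic_on S" "\<And>z. z \<in> S \<Longrightarrow> diff_op \<mu> P f z = g z"
    "\<And>j. j < \<mu> \<Longrightarrow> (deriv ^^ j) f z0 = 0"
proof -
  have 1: "(\<lambda>z. - (poly (P (\<mu> - j)) z / poly (P 0) z)) holomorphic_on S" for j
    using P0 by (intro holomorphic_intros) auto
  have 2: "(\<lambda>z. g z / poly (P 0) z) holomorphic_on S"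
    using P0 g by (intro holomorphic_intros) auto
  show ?thesis
  proof (rule linear_ode_solution[OF S z0 1 2])
    fix f assume f: "f holomorphic_on S" "\<And>j. j < \<mu> \<Longrightarrow> (deriv ^^ j) f z0 = 0"
      "\<And>z. z \<in> S \<Longrightarrow> (deriv ^^ \<mu>) f z =
         (\<Sum>j<\<mu>. - (poly (P (\<mu> - j)) z / poly (P 0) z) * (deriv ^^ j) f z) + g z / poly (P 0) z"
    have "diff_op \<mu> P f z = g z" if "z \<in> S" for z
    proof -
      have "diff_op \<mu> P f z = poly (P 0) z * (deriv ^^ \<mu>) f z + (\<Sum>j<\<mu>. poly (P (\<mu> - j)) z * (deriv ^^ j) f z)"
        unfolding diff_op_def by (simp add: lessThan_Suc_atMost[symmetric])
      also have "\<dots> = g z"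
        unfolding f(3)[OF that] using P0[OF that]
        by (simp add: distrib_left right_diff_distrib sum_distrib_left sum_negf)
      finally show ?thesis .
    qed
    thus ?thesis using f(1,2) by (intro that[of f]) auto
  qed
qed

lemma higher_deriv_poly_translate:
  "(deriv ^^ j) (\<lambda>z. poly q (z - z0)) z0 = fact j * coeff q j" for q :: "complex poly"
  using fps_nth_fps_expansion[OF has_fps_expansion_poly[of q], of j]
    higher_deriv_translate[of j "\<lambda>z. poly q (z - z0)" z0 0] by simp

lemma diff_op_holomorphic:
  assumes "open S" "f holomorphic_on S"
  shows "diff_op \<mu> P f holomorphic_on S"
  unfolding diff_op_def[abs_def] by (intro holomorphic_intros holomorphic_higher_deriv assms)

text \<open>A polynomial with the prescribed derivatives at \<open>z0\<close> reduces this to zero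
  initial values.\<close>

lemma diff_op_solution_ivp:
  assumes S: "open S" "simply_connected S" and z0: "z0 \<in> S" and P0: "\<And>z. z \<in> S \<Longrightarrow> poly (P 0) z \<noteq> 0"
    and g: "g holomorphic_on S"
  obtains f where "f holomorphic_on S" "\<And>z. z \<in> S \<Longrightarrow> diff_op \<mu> P f z = g z"
    "\<And>j. j < \<mu> \<Longrightarrow> (deriv ^^ j) f z0 = a j"
proof -
  define q where "q = (\<Sum>j<\<mu>. monom (a j / fact j) j)"
  define t where "t = (\<lambda>z. poly q (z - z0))"
  have t: "t holomorphic_on A" for A unfolding t_def by (intro holomorphic_intros)
  have "coeff q j = a j / fact j" if "j < \<mu>" for j
    using that by (simp add: q_def coeff_sum sum.delta)
  hence tj: "(deriv ^^ j) t z0 = a j" if "j < \<mu>" for j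
    using that by (simp add: t_def higher_deriv_poly_translate)
  have "(\<lambda>z. g z - diff_op \<mu> P t z) holomorphic_on S"
    by (intro holomorphic_intros g diff_op_holomorphic S t)
  then obtain f where f: "f holomorphic_on S" "\<And>z. z \<in> S \<Longrightarrow> diff_op \<mu> P f z = g z - diff_op \<mu> P t z"
    "\<And>j. j < \<mu> \<Longrightarrow> (deriv ^^ j) f z0 = 0"
    using diff_op_solution[of S z0 P "\<lambda>z. g z - diff_op \<mu> P t z" \<mu>] S z0 P0 by blast
  have an: "f analytic_on {z}" "t analytic_on {z}" if "z \<in> S" for z
    using f(1) t[of S] S(1) that analytic_at by blast+
  show ?thesis
  proof (rule that[of "\<lambda>z. 1 * f z + 1 * t z"])
    show "(\<lambda>z. 1 * f z + 1 * t z) holomorphic_on S" by (intro holomorphic_intros f t)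
    show "diff_op \<mu> P (\<lambda>z. 1 * f z + 1 * t z) z = g z" if "z \<in> S" for z
      using diff_op_lincomb2[OF an[OF that], of \<mu> P 1 1] f(2)[OF that] by simp
    show "(deriv ^^ j) (\<lambda>z. 1 * f z + 1 * t z) z0 = a j" if "j < \<mu>" for j
      using higher_deriv_add[OF f(1) t[of S] S(1) z0, of j] f(3) tj that by simp
  qed
qed

section \<open>The cut plane\<close>

definition cut_ray :: "real \<Rightarrow> complex \<Rightarrow> complex set"
  where "cut_ray \<theta> \<rho> = {\<rho> - of_real t * cis (- \<theta>) |t. 0 \<le> t}"

text \<open>In these coordinates each cut is a horizontal half-line to the left, given by one
  equation and one inequality, which replaces reasoning about arguments.\<close>

definition rot_Re :: "real \<Rightarrow> complex \<Rightarrow> real" where "rot_Re \<theta> z = Re (z * cis \<theta>)"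
definition rot_Im :: "real \<Rightarrow> complex \<Rightarrow> real" where "rot_Im \<theta> z = Im (z * cis \<theta>)"

lemma rotated_coords [simp]:
  "rot_Re \<theta> (z + w) = rot_Re \<theta> z + rot_Re \<theta> w" "rot_Im \<theta> (z + w) = rot_Im \<theta> z + rot_Im \<theta> w"
  "rot_Re \<theta> (z - w) = rot_Re \<theta> z - rot_Re \<theta> w" "rot_Im \<theta> (z - w) = rot_Im \<theta> z - rot_Im \<theta> w"
  "rot_Re \<theta> (u * cis (- \<theta>)) = Re u" "rot_Im \<theta> (u * cis (- \<theta>)) = Im u"
  "rot_Re \<theta> (c *\<^sub>R z) = c * rot_Re \<theta> z" "rot_Im \<theta> (c *\<^sub>R z) = c * rot_Im \<theta> z"
  by (simp_all add: rot_Re_def rot_Im_def algebra_simps mult.assoc cis_mult del: cis.sel)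

lemma continuous_on_rotated_coords [continuous_intros]:
  "continuous_on A f \<Longrightarrow> continuous_on A (\<lambda>x. rot_Re \<theta> (f x))"
  "continuous_on A f \<Longrightarrow> continuous_on A (\<lambda>x. rot_Im \<theta> (f x))"
  unfolding rot_Re_def rot_Im_def by (auto intro!: continuous_intros)

lemma rotated_coords_eq: "z = Complex (rot_Re \<theta> z) (rot_Im \<theta> z) * cis (- \<theta>)"
proof -
  have "Complex (rot_Re \<theta> z) (rot_Im \<theta> z) = z * cis \<theta>" by (simp add: rot_Re_def rot_Im_def complex_eq_iff)
  thus ?thesis by (simp add: mult.assoc cis_mult)
qed

lemma cut_ray_iff: "z \<in> cut_ray \<theta> \<rho> \<longleftrightarrow> rot_Im \<theta> z = rot_Im \<theta> \<rho> \<and> rot_Re \<theta> z \<le> rot_Re \<theta> \<rho>"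
proof
  assume "rot_Im \<theta> z = rot_Im \<theta> \<rho> \<and> rot_Re \<theta> z \<le> rot_Re \<theta> \<rho>"
  moreover have "\<rho> - z = Complex (rot_Re \<theta> (\<rho> - z)) (rot_Im \<theta> (\<rho> - z)) * cis (- \<theta>)" by (rule rotated_coords_eq)
  ultimately have "\<rho> - z = of_real (rot_Re \<theta> (\<rho> - z)) * cis (- \<theta>)"
    by (simp add: complex_of_real_def)
  hence "z = \<rho> - of_real (rot_Re \<theta> (\<rho> - z)) * cis (- \<theta>)"
    by (metis diff_diff_eq2 add_diff_cancel_left')
  thus "z \<in> cut_ray \<theta> \<rho>" using \<open>rot_Im \<theta> z = rot_Im \<theta> \<rho> \<and> rot_Re \<theta> z \<le> rot_Re \<theta> \<rho>\<close>
    unfolding cut_ray_def by (intro CollectI exI[of _ "rot_Re \<theta> (\<rho> - z)"]) auto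
qed (auto simp: cut_ray_def)

lemma closed_cut_ray: "closed (cut_ray \<theta> \<rho>)"
proof -
  have "cut_ray \<theta> \<rho> = {z. rot_Im \<theta> z = rot_Im \<theta> \<rho>} \<inter> {z. rot_Re \<theta> z \<le> rot_Re \<theta> \<rho>}" by (auto simp: cut_ray_iff)
  also have "closed \<dots>" by (intro closed_Int closed_Collect_eq closed_Collect_le continuous_intros)
  finally show ?thesis .
qed

lemma cut_plane_iff: "z \<in> cut_plane \<theta> \<Sigma> \<longleftrightarrow> (\<forall>\<rho>\<in>\<Sigma>. z \<notin> cut_ray \<theta> \<rho>)"
  by (auto simp: cut_plane_def cut_ray_def)

lemma open_cut_plane: "finite \<Sigma> \<Longrightarrow> open (cut_plane \<theta> \<Sigma>)"
proof -
  assume "finite \<Sigma>"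
  hence "closed (\<Union>\<rho>\<in>\<Sigma>. cut_ray \<theta> \<rho>)" by (auto intro!: closed_UN closed_cut_ray)
  moreover have "cut_plane \<theta> \<Sigma> = - (\<Union>\<rho>\<in>\<Sigma>. cut_ray \<theta> \<rho>)" by (auto simp: cut_plane_iff)
  ultimately show ?thesis by (metis open_Compl)
qed

text \<open>The open range of angles omits exactly the direction of the cut. Ball minus ray gives
  openness and comparison with the cut plane; the polar form, as the image of a rectangle, gives
  connectedness.\<close>

lemma cut_disk_eq: "cut_disk \<theta> \<rho> \<epsilon> = ball \<rho> \<epsilon> - cut_ray \<theta> \<rho>"
proof (intro set_eqI iffI)
  fix z assume "z \<in> cut_disk \<theta> \<rho> \<epsilon>"
  then obtain r \<phi> where z: "z = \<rho> + rcis r \<phi>" "0 < r" "r < \<epsilon>" "- \<theta> - pi < \<phi>" "\<phi> < - \<theta> + pi"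
    by (auto simp: cut_disk_def)
  have "z - \<rho> = (of_real r * cis (\<phi> + \<theta>)) * cis (- \<theta>)"
    by (simp add: z(1) rcis_def mult.assoc cis_mult)
  hence "rot_Re \<theta> (z - \<rho>) = r * cos (\<phi> + \<theta>)" "rot_Im \<theta> (z - \<rho>) = r * sin (\<phi> + \<theta>)"
    by (simp_all only: rotated_coords) auto
  hence XY: "rot_Re \<theta> z - rot_Re \<theta> \<rho> = r * cos (\<phi> + \<theta>)" "rot_Im \<theta> z - rot_Im \<theta> \<rho> = r * sin (\<phi> + \<theta>)" by auto
  have "z \<notin> cut_ray \<theta> \<rho>"
  proof
    assume "z \<in> cut_ray \<theta> \<rho>"
    hence "sin (\<phi> + \<theta>) = 0" "r * cos (\<phi> + \<theta>) \<le> 0" using XY z(2) by (auto simp: cut_ray_iff)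
    moreover have "\<phi> + \<theta> = 0"
      by (rule sin_eq_0_pi[OF _ _ \<open>sin (\<phi> + \<theta>) = 0\<close>]) (use z(4,5) in linarith)+
    ultimately show False using z(2) by simp
  qed
  moreover have "z \<in> ball \<rho> \<epsilon>" using z(1-3) by (simp add: dist_norm)
  ultimately show "z \<in> ball \<rho> \<epsilon> - cut_ray \<theta> \<rho>" by simp
next
  fix z assume z: "z \<in> ball \<rho> \<epsilon> - cut_ray \<theta> \<rho>"
  define w where "w = (z - \<rho>) * cis \<theta>"
  have "z \<noteq> \<rho>" using z by (auto simp: cut_ray_iff)
  hence w0: "w \<noteq> 0" by (simp add: w_def)
  have w: "w = rcis (norm w) (Arg w)" by (simp add: rcis_cmod_Arg)
  have "Arg w \<noteq> pi"
  proof
    assume "Arg w = pi"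
    hence "w = of_real (- norm w)" using w by (simp add: rcis_def)
    hence "Re w = - norm w" "Im w = 0" by (metis Re_complex_of_real, metis Im_complex_of_real)
    hence "Re w \<le> 0" "Im w = 0" by simp_all
    moreover have "Re w = rot_Re \<theta> z - rot_Re \<theta> \<rho>" "Im w = rot_Im \<theta> z - rot_Im \<theta> \<rho>"
      by (auto simp: w_def rot_Re_def rot_Im_def algebra_simps)
    ultimately show False using z by (simp add: cut_ray_iff)
  qed
  hence "- pi < Arg w" "Arg w < pi" using Arg_bounded[of w] by auto
  moreover have "z = \<rho> + rcis (norm w) (Arg w - \<theta>)"
  proof -
    have "rcis (norm w) (Arg w - \<theta>) = w * cis (- \<theta>)" by (subst w) (simp add: rcis_def cis_mult mult.assoc)
    also have "\<dots> = z - \<rho>" by (simp add: w_def mult.assoc cis_mult)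
    finally show ?thesis by simp
  qed
  moreover have "norm w < \<epsilon>" using z by (simp add: w_def norm_mult dist_norm norm_minus_commute)
  ultimately show "z \<in> cut_disk \<theta> \<rho> \<epsilon>"
    unfolding cut_disk_def using w0 by (intro CollectI exI[of _ "norm w"] exI[of _ "Arg w - \<theta>"]) auto
qed

lemma open_cut_disk: "open (cut_disk \<theta> \<rho> \<epsilon>)"
  unfolding cut_disk_eq by (intro open_Diff closed_cut_ray) auto

lemma connected_cut_disk: "connected (cut_disk \<theta> \<rho> \<epsilon>)"
proof -
  have "cut_disk \<theta> \<rho> \<epsilon> = (\<lambda>(r, \<phi>). \<rho> + rcis r \<phi>) ` ({0<..<\<epsilon>} \<times> {- \<theta> - pi<..<- \<theta> + pi})"
  proof (intro equalityI subsetI)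
    fix x assume "x \<in> cut_disk \<theta> \<rho> \<epsilon>"
    then obtain r \<phi> where "x = \<rho> + rcis r \<phi>" "0 < r" "r < \<epsilon>" "- \<theta> - pi < \<phi>" "\<phi> < - \<theta> + pi"
      by (auto simp: cut_disk_def)
    thus "x \<in> (\<lambda>(r, \<phi>). \<rho> + rcis r \<phi>) ` ({0<..<\<epsilon>} \<times> {- \<theta> - pi<..<- \<theta> + pi})"
      by (intro image_eqI[of _ _ "(r, \<phi>)"]) auto
  next
    fix x assume "x \<in> (\<lambda>(r, \<phi>). \<rho> + rcis r \<phi>) ` ({0<..<\<epsilon>} \<times> {- \<theta> - pi<..<- \<theta> + pi})"
    then obtain r \<phi> where "x = \<rho> + rcis r \<phi>" "0 < r" "r < \<epsilon>" "- \<theta> - pi < \<phi>" "\<phi> < - \<theta> + pi"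
      by auto
    thus "x \<in> cut_disk \<theta> \<rho> \<epsilon>" unfolding cut_disk_def by blast
  qed
  also have "connected \<dots>"
    by (intro connected_continuous_image convex_connected convex_Times convex_real_interval)
       (auto simp: case_prod_unfold rcis_def cis_conv_exp intro!: continuous_intros)
  finally show ?thesis .
qed

lemma cut_disk_mono: "\<epsilon> \<le> \<epsilon>' \<Longrightarrow> cut_disk \<theta> \<rho> \<epsilon> \<subseteq> cut_disk \<theta> \<rho> \<epsilon>'"
  by (auto simp: cut_disk_eq)

lemma rotated_dist: "dist z (z + u * cis (- \<theta>)) = norm u"
  by (simp add: dist_norm norm_mult)

lemma cut_disk_nonempty: "\<epsilon> > 0 \<Longrightarrow> \<rho> + of_real (\<epsilon> / 2) * cis (- \<theta>) \<in> cut_disk \<theta> \<rho> \<epsilon>"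
  by (simp add: cut_disk_eq rotated_dist cut_ray_iff del: of_real_divide)

text \<open>Equality would make \<open>(\<rho> - \<rho>') * cis \<theta>\<close> real, which is the
  excluded congruence. So distinct cuts lie on distinct parallel lines.\<close>

lemma rot_Im_distinct:
  assumes "\<not> [Arg (\<rho> - \<rho>') = - \<theta>] (rmod pi)" "\<rho> \<noteq> \<rho>'"
  shows "rot_Im \<theta> \<rho> \<noteq> rot_Im \<theta> \<rho>'"
proof
  assume eq: "rot_Im \<theta> \<rho> = rot_Im \<theta> \<rho>'"
  define a where "a = Arg (\<rho> - \<rho>')"
  have "(\<rho> - \<rho>') * cis \<theta> = rcis (norm (\<rho> - \<rho>')) (a + \<theta>)"
    by (subst rcis_cmod_Arg[of "\<rho> - \<rho>'", symmetric]) (simp add: a_def rcis_def cis_mult mult.assoc)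
  hence "rot_Im \<theta> (\<rho> - \<rho>') = norm (\<rho> - \<rho>') * sin (a + \<theta>)" by (simp add: rot_Im_def)
  hence "sin (a + \<theta>) = 0" using eq assms(2) by simp
  then obtain i :: int where "a + \<theta> = of_int i * pi" by (auto simp: sin_zero_iff_int2)
  hence "a = - \<theta> + of_int i * pi" by simp
  hence "[a = - \<theta>] (rmod pi)"
    unfolding rcong_altdef by (intro exI[of _ "- i"]) simp
  with assms(1) show False unfolding a_def by (rule notE)
qed

lemma cut_plane_shift:
  assumes "z \<in> cut_plane \<theta> \<Sigma>" "s \<ge> 0"
  shows "z + of_real s * cis (- \<theta>) \<in> cut_plane \<theta> \<Sigma>"
  unfolding cut_plane_iff
proof
  fix \<rho> assume "\<rho> \<in> \<Sigma>"
  hence "z \<notin> cut_ray \<theta> \<rho>" using assms(1) by (simp add: cut_plane_iff)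
  thus "z + of_real s * cis (- \<theta>) \<notin> cut_ray \<theta> \<rho>" using assms(2) by (auto simp: cut_ray_iff)
qed

text \<open>Sliding in the direction \<open>cis (- \<theta>)\<close>, opposite to the cuts, moves
  the cut plane within itself into a half-plane \<open>H\<close> beyond all singularities, and
  \<open>H\<close> is convex.\<close>

lemma simply_connected_cut_plane:
  assumes "finite \<Sigma>"
  shows "simply_connected (cut_plane \<theta> \<Sigma>)"
proof -
  obtain T where T: "\<And>\<rho>. \<rho> \<in> \<Sigma> \<Longrightarrow> rot_Re \<theta> \<rho> < T"
    using bdd_above_finite[of "rot_Re \<theta> ` \<Sigma>"] assms unfolding bdd_above_def
    by (metis finite_imageI gt_ex image_eqI le_less_trans)
  define H where "H = {z. rot_Re \<theta> z \<ge> T}"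
  have HS: "H \<subseteq> cut_plane \<theta> \<Sigma>" using T by (force simp: H_def cut_plane_iff cut_ray_iff)
  have "convex H"
  proof (rule convexI)
    fix x y u v assume "x \<in> H" "y \<in> H" "0 \<le> u" "0 \<le> v" "u + v = (1 :: real)"
    moreover from this have "u * rot_Re \<theta> x + v * rot_Re \<theta> y \<ge> u * T + v * T"
      by (intro add_mono mult_left_mono) (auto simp: H_def)
    ultimately show "u *\<^sub>R x + v *\<^sub>R y \<in> H" by (simp add: H_def flip: distrib_right)
  qed
  define m where "m z = max 0 (T - rot_Re \<theta> z)" for z
  define r where "r z = z + of_real (m z) * cis (- \<theta>)" for z
  define w0 where "w0 = of_real T * cis (- \<theta>)"
  have contr: "continuous_on A r" for A unfolding r_def m_def by (intro continuous_intros)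
  have rH: "r z \<in> H" for z by (simp add: r_def H_def m_def)
  have "homotopic_with_canon (\<lambda>_. True) (cut_plane \<theta> \<Sigma>) (cut_plane \<theta> \<Sigma>) id r"
  proof (rule homotopic_with_linear)
    fix z assume z: "z \<in> cut_plane \<theta> \<Sigma>"
    show "closed_segment (id z) (r z) \<subseteq> cut_plane \<theta> \<Sigma>"
    proof
      fix x assume "x \<in> closed_segment (id z) (r z)"
      then obtain u where u: "0 \<le> u" "u \<le> 1" "x = (1 - u) *\<^sub>R z + u *\<^sub>R r z" by (auto simp: in_segment)
      hence "x = z + of_real (u * m z) * cis (- \<theta>)"
        by (simp add: r_def scaleR_conv_of_real algebra_simps)
      thus "x \<in> cut_plane \<theta> \<Sigma>" using cut_plane_shift[OF z, of "u * m z"] u by (simp add: m_def)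
    qed
  qed (auto intro: contr continuous_on_id)
  moreover have "homotopic_with_canon (\<lambda>_. True) (cut_plane \<theta> \<Sigma>) (cut_plane \<theta> \<Sigma>) r (\<lambda>_. w0)"
  proof (rule homotopic_with_linear)
    fix z
    have "w0 \<in> H" by (simp add: w0_def H_def)
    thus "closed_segment (r z) w0 \<subseteq> cut_plane \<theta> \<Sigma>"
      using closed_segment_subset[OF rH _ \<open>convex H\<close>] HS by blast
  qed (auto intro: contr)
  ultimately have "contractible (cut_plane \<theta> \<Sigma>)"
    unfolding contractible_def using homotopic_with_trans by blast
  thus ?thesis by (rule contractible_imp_simply_connected)
qed

text \<open>A small displacement perpendicular to the cuts suffices, as only finitely many values of
  \<open>rot_Im\<close> must be avoided.\<close>

lemma cut_plane_dense:
  assumes "finite \<Sigma>" "e > 0"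
  obtains w where "w \<in> cut_plane \<theta> \<Sigma>" "dist w z < e"
proof -
  have "infinite ({0<..<e} - (\<lambda>\<rho>. rot_Im \<theta> \<rho> - rot_Im \<theta> z) ` \<Sigma>)"
    using assms by (intro Diff_infinite_finite) auto
  then obtain \<eta> where \<eta>: "0 < \<eta>" "\<eta> < e" "\<eta> \<notin> (\<lambda>\<rho>. rot_Im \<theta> \<rho> - rot_Im \<theta> z) ` \<Sigma>"
    by (metis Diff_iff ex_in_conv finite.emptyI greaterThanLessThan_iff)
  have "z + Complex 0 \<eta> * cis (- \<theta>) \<in> cut_plane \<theta> \<Sigma>"
    using \<eta>(3) by (force simp: cut_plane_iff cut_ray_iff)
  moreover have "dist (z + Complex 0 \<eta> * cis (- \<theta>)) z < e"
    using \<eta> by (simp add: dist_norm norm_mult complex_norm)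
  ultimately show ?thesis using that by blast
qed

text \<open>Two local extensions agree on their overlap by continuity, since both equal
  \<open>u\<close> on a dense set; so the choice \<open>U z = k z z\<close> is consistent.\<close>

lemma entire_extension_from_dense:
  fixes u :: "complex \<Rightarrow> complex"
  assumes dense: "\<And>z e. e > 0 \<Longrightarrow> \<exists>w\<in>S. dist w z < e"
    and loc: "\<And>z. \<exists>e>0. \<exists>k. k holomorphic_on ball z e \<and> (\<forall>w\<in>ball z e \<inter> S. k w = u w)"
  obtains U where "U holomorphic_on UNIV" "\<And>z. z \<in> S \<Longrightarrow> U z = u z"
proof -
  from loc obtain e k where e: "\<And>z. e z > 0" and k: "\<And>z. k z holomorphic_on ball z (e z)"
    "\<And>z w. w \<in> ball z (e z) \<inter> S \<Longrightarrow> k z w = u w" by metis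
  define U where "U z = k z z" for z
  have U: "U z' = k z z'" if z': "z' \<in> ball z (e z)" for z z'
  proof -
    have "z' \<in> ball z (e z) \<inter> ball z' (e z')" using z' e by auto
    moreover have "open (ball z (e z) \<inter> ball z' (e z'))" by auto
    ultimately obtain r where r: "r > 0" "cball z' r \<subseteq> ball z (e z) \<inter> ball z' (e z')"
      by (meson open_contains_cball)
    define A where "A = S \<inter> ball z' r"
    have clA: "closure A \<subseteq> cball z' r" unfolding A_def by (intro closure_minimal) auto
    have "z' \<in> closure A"
      unfolding closure_approachable
    proof (intro allI impI)
      fix d :: real assume "d > 0"
      with dense[of "min d r" z'] r(1) obtain w where "w \<in> S" "dist w z' < min d r" by auto
      thus "\<exists>y\<in>A. dist y z' < d" by (intro bexI[of _ w]) (auto simp: A_def dist_commute)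
    qed
    moreover have "continuous_on (closure A) (\<lambda>w. k z w - k z' w)"
      using clA r(2) by (intro continuous_on_diff holomorphic_on_imp_continuous_on holomorphic_on_subset[OF k(1)]) auto
    moreover have "k z w - k z' w = 0" if "w \<in> A" for w
    proof -
      have "w \<in> cball z' r" using that by (auto simp: A_def)
      hence "w \<in> ball z (e z)" "w \<in> ball z' (e z')" using r(2) by auto
      thus ?thesis using that k(2)[of w z] k(2)[of w z'] by (auto simp: A_def)
    qed
    ultimately have "k z z' - k z' z' = 0"
      using continuous_constant_on_closure[of A "\<lambda>w. k z w - k z' w" 0 z'] by blast
    thus ?thesis by (simp add: U_def)
  qed
  have "U holomorphic_on ball z (e z)" for z
    by (rule holomorphic_transform[OF k(1)]) (use U in auto)
  hence "U field_differentiable at z" for z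
    using e[of z] by (meson centre_in_ball holomorphic_on_imp_differentiable_at open_ball)
  hence "U holomorphic_on UNIV" by (simp add: holomorphic_on_def)
  moreover have "U z = u z" if "z \<in> S" for z using k(2)[of z z] e[of z] that by (simp add: U_def)
  ultimately show ?thesis by (rule that)
qed

section \<open>Relations between microsolutions\<close>

text \<open>Gaussian elimination with one pivot per equation. Arbitrary index types permit unknowns
  indexed by disjoint sums and equations indexed by pairs.\<close>

lemma underdetermined_system:
  fixes A :: "'e \<Rightarrow> 'i \<Rightarrow> 'f :: field"
  assumes "finite E" "finite I" "card E < card I"
  shows "\<exists>x. (\<exists>i\<in>I. x i \<noteq> 0) \<and> (\<forall>e\<in>E. (\<Sum>i\<in>I. A e i * x i) = 0)"
  using assms
proof (induction E arbitrary: I A rule: finite_induct)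
  case empty
  hence "I \<noteq> {}" by auto
  thus ?case by (intro exI[of _ "\<lambda>_. 1"]) auto
next
  case (insert e E)
  show ?case
  proof (cases "\<forall>i\<in>I. A e i = 0")
    case True
    from insert.IH[of I A] insert.prems insert.hyps obtain x where
      "\<exists>i\<in>I. x i \<noteq> 0" "\<forall>e\<in>E. (\<Sum>i\<in>I. A e i * x i) = 0" by auto
    thus ?thesis using True by (intro exI[of _ x]) auto
  next
    case False
    then obtain i0 where i0: "i0 \<in> I" "A e i0 \<noteq> 0" by blast
    define I' where "I' = I - {i0}"
    have I': "finite I'" "I = insert i0 I'" "i0 \<notin> I'" using insert.prems i0 by (auto simp: I'_def)
    have "card E < card I'" using insert.prems insert.hyps I' by simp
    with insert.IH[of I' "\<lambda>f i. A f i - A f i0 * A e i / A e i0"] I'(1) obtain x where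
      x: "\<exists>i\<in>I'. x i \<noteq> 0" "\<forall>f\<in>E. (\<Sum>i\<in>I'. (A f i - A f i0 * A e i / A e i0) * x i) = 0" by auto
    define y where "y = x(i0 := - (\<Sum>i\<in>I'. A e i * x i) / A e i0)"
    have y: "(\<Sum>i\<in>I. A f i * y i) = (\<Sum>i\<in>I'. A f i * x i) - A f i0 * (\<Sum>i\<in>I'. A e i * x i) / A e i0" for f
    proof -
      have "(\<Sum>i\<in>I'. A f i * y i) = (\<Sum>i\<in>I'. A f i * x i)"
        using I'(3) by (intro sum.cong) (auto simp: y_def)
      thus ?thesis using I' by (simp add: y_def)
    qed
    have "(\<Sum>i\<in>I. A f i * y i) = 0" if "f \<in> E" for f
      using x(2)[rule_format, OF that]
      by (simp add: y left_diff_distrib sum_subtractf sum_distrib_left sum_divide_distrib mult.assoc)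
    moreover have "(\<Sum>i\<in>I. A e i * y i) = 0" using i0 by (simp add: y)
    moreover have "\<exists>i\<in>I. y i \<noteq> 0" using x(1) I' by (auto simp: y_def)
    ultimately show ?thesis by blast
  qed
qed

lemma finite_positive_lower_bound:
  fixes e :: "'a \<Rightarrow> real"
  assumes "finite J" "\<And>i. i \<in> J \<Longrightarrow> e i > 0"
  obtains r where "r > 0" "\<And>i. i \<in> J \<Longrightarrow> r \<le> e i"
proof
  \<comment> \<open>The element 1 covers the case of empty \<open>J\<close>.\<close>
  show "Min (insert 1 (e ` J)) > 0" using assms by auto
  show "Min (insert 1 (e ` J)) \<le> e i" if "i \<in> J" for i using that assms by (intro Min_le) auto
qed

lemma higher_deriv_lincomb:
  assumes "\<And>i. i \<in> I \<Longrightarrow> f i analytic_on {z}"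
  shows "(deriv ^^ j) (\<lambda>z. \<Sum>i\<in>I. c i * f i z) z = (\<Sum>i\<in>I. c i * (deriv ^^ j) (f i) z)"
proof -
  \<comment> \<open>A pure derivative is itself a differential operator of the given form, so its
    linearity follows from \<open>diff_op_sum\<close>.\<close>
  have "(deriv ^^ j) g z = diff_op j (\<lambda>k. if k = 0 then 1 else 0) g z" for g
  proof -
    have "diff_op j (\<lambda>k. if k = 0 then 1 else 0) g z = (\<Sum>i\<in>{j}. (deriv ^^ i) g z)"
      unfolding diff_op_def by (intro sum.mono_neutral_cong_right) auto
    thus ?thesis by simp
  qed
  thus ?thesis using diff_op_sum[where I = I and f = f and z = z and \<mu> = j and c = c, OF assms] by simp
qed

lemma O_germ_lincomb:
  assumes "f \<in> O_germ \<theta> \<rho>" "g \<in> O_germ \<theta> \<rho>"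
  shows "(\<lambda>z. a * f z + b * g z) \<in> O_germ \<theta> \<rho>"
proof -
  from assms obtain e h e' h' where
    1: "e > 0" "h holomorphic_on ball \<rho> e" "\<forall>z\<in>cut_disk \<theta> \<rho> e. f z = h z" and
    2: "e' > 0" "h' holomorphic_on ball \<rho> e'" "\<forall>z\<in>cut_disk \<theta> \<rho> e'. g z = h' z"
    unfolding O_germ_def by blast
  have "(\<lambda>z. a * h z + b * h' z) holomorphic_on ball \<rho> (min e e')"
    by (intro holomorphic_intros holomorphic_on_subset[OF 1(2)] holomorphic_on_subset[OF 2(2)]) auto
  moreover have "\<forall>z\<in>cut_disk \<theta> \<rho> (min e e'). a * f z + b * g z = a * h z + b * h' z"
    using 1(3) 2(3) cut_disk_mono[of "min e e'" e \<theta> \<rho>] cut_disk_mono[of "min e e'" e' \<theta> \<rho>]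
    by (simp add: subset_iff)
  ultimately show ?thesis using 1(1) 2(1)
    unfolding O_germ_def by (intro CollectI exI[of _ "min e e'"] exI[of _ "\<lambda>z. a * h z + b * h' z"] conjI) auto
qed

lemma order_sum_eq_degree:
  assumes "p \<noteq> (0 :: complex poly)"
  shows "(\<Sum>\<rho> | poly p \<rho> = 0. order \<rho> p) = degree p"
  using size_proots_complex[of p] assms by (simp add: size_multiset_overloaded_eq)

text \<open>The dimension bound for \<open>M\<^sub>\<rho>\<close> as a linear system: besides the coefficients of the
  combination, the unknowns are \<open>N\<close> low-order Taylor coefficients at \<open>\<rho>\<close> of a germ in \<open>O\<^sub>\<rho>\<close>.
  The equations say that, for the difference of the combination and this germ, the remaining
  \<open>N + m - \<mu>\<close> coefficients of the image and the \<open>\<mu>\<close> initial values vanish.\<close>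

lemma microsolution_relations:
  fixes G :: "'a \<Rightarrow> complex \<Rightarrow> complex"
  assumes P0: "P 0 \<noteq> 0" and J: "finite J"
    and G: "\<And>i. i \<in> J \<Longrightarrow> G i \<in> O_hat \<theta> \<rho>" "\<And>i. i \<in> J \<Longrightarrow> diff_op \<mu> P (G i) \<in> O_germ \<theta> \<rho>"
  shows "\<exists>N (A :: nat \<Rightarrow> 'a + nat \<Rightarrow> complex). \<forall>x.
       (\<forall>e < N + order \<rho> (P 0). (\<Sum>i\<in>J <+> {..<N}. A e i * x i) = 0) \<longrightarrow>
       (\<lambda>z. \<Sum>i\<in>J. x (Inl i) * G i z) \<in> O_germ \<theta> \<rho> \<and>
       ((\<forall>i\<in>J. x (Inl i) = 0) \<longrightarrow> (\<forall>k<N. x (Inr k) = 0))"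
proof -
  let ?m = "order \<rho> (P 0)"
  obtain r0 :: real where r0: "r0 > 0" "\<And>r. 0 < r \<Longrightarrow> r < r0 \<Longrightarrow>
    \<exists>N\<ge>\<mu>. \<forall>h R. r < R \<longrightarrow> h holomorphic_on ball \<rho> R \<longrightarrow>
      (\<exists>u e. u analytic_on {\<rho>} \<and> (\<forall>k<N. (deriv ^^ k) u \<rho> = 0) \<and>
         (\<forall>i. N + ?m \<le> i + \<mu> \<longrightarrow> coeff e i = 0) \<and>
         (\<forall>\<^sub>F z in nhds \<rho>. diff_op \<mu> P u z = h z + poly e (z - \<rho>)))"
    by (rule local_solution_modulo_polynomials[where P = P and \<rho> = \<rho> and \<mu> = \<mu>, OF P0]) (rule that)
  have "\<exists>e h. e > 0 \<and> G i holomorphic_on cut_disk \<theta> \<rho> e \<and> h holomorphic_on ball \<rho> e \<and>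
      (\<forall>z\<in>cut_disk \<theta> \<rho> e. diff_op \<mu> P (G i) z = h z)" if "i \<in> J" for i
  proof -
    obtain e1 where e1: "e1 > 0" "G i holomorphic_on cut_disk \<theta> \<rho> e1" using G(1)[OF \<open>i \<in> J\<close>] by (auto simp: O_hat_def)
    obtain e2 h where e2: "e2 > 0" "h holomorphic_on ball \<rho> e2" "\<forall>z\<in>cut_disk \<theta> \<rho> e2. diff_op \<mu> P (G i) z = h z"
      using G(2)[OF \<open>i \<in> J\<close>] by (auto simp: O_germ_def)
    have "G i holomorphic_on cut_disk \<theta> \<rho> (min e1 e2)" "h holomorphic_on ball \<rho> (min e1 e2)"
      "\<forall>z\<in>cut_disk \<theta> \<rho> (min e1 e2). diff_op \<mu> P (G i) z = h z"
      using e1 e2 cut_disk_mono[of "min e1 e2" e1 \<theta> \<rho>] cut_disk_mono[of "min e1 e2" e2 \<theta> \<rho>]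
      by (auto elim!: holomorphic_on_subset)
    thus ?thesis using e1(1) e2(1) by (intro exI[of _ "min e1 e2"] exI[of _ h]) auto
  qed
  then obtain e h where eh: "\<And>i. i \<in> J \<Longrightarrow> e i > 0" "\<And>i. i \<in> J \<Longrightarrow> G i holomorphic_on cut_disk \<theta> \<rho> (e i)"
    "\<And>i. i \<in> J \<Longrightarrow> h i holomorphic_on ball \<rho> (e i)"
    "\<And>i z. i \<in> J \<Longrightarrow> z \<in> cut_disk \<theta> \<rho> (e i) \<Longrightarrow> diff_op \<mu> P (G i) z = h i z" by metis
  obtain R where R: "R > 0" "\<And>i. i \<in> J \<Longrightarrow> R \<le> e i" using finite_positive_lower_bound[of J e] J eh(1) by blast
  \<comment> \<open>Below \<open>r0\<close> for solvability and below \<open>R\<close> so that every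
    \<open>h i\<close> has bounded weighted Taylor coefficients; a single \<open>N\<close> then
    works for all \<open>i\<close>.\<close>
  define r where "r = min R r0 / 2"
  have r: "0 < r" "r < r0" "r < R" using r0(1) R(1) by (auto simp: r_def)
  from r0(2)[OF r(1,2)] obtain N where N: "N \<ge> \<mu>" and solve0:
    "\<And>h R. r < R \<Longrightarrow> h holomorphic_on ball \<rho> R \<Longrightarrow>
      (\<exists>u e. u analytic_on {\<rho>} \<and> (\<forall>k<N. (deriv ^^ k) u \<rho> = 0) \<and>
         (\<forall>i. N + ?m \<le> i + \<mu> \<longrightarrow> coeff e i = 0) \<and>
         (\<forall>\<^sub>F z in nhds \<rho>. diff_op \<mu> P u z = h z + poly e (z - \<rho>)))" by blast
  define sol where "sol h u e \<longleftrightarrow> u analytic_on {\<rho>} \<and> (\<forall>k<N. (deriv ^^ k) u \<rho> = 0) \<and>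
         (\<forall>i. N + ?m \<le> i + \<mu> \<longrightarrow> coeff e i = 0) \<and>
         (\<forall>\<^sub>F z in nhds \<rho>. diff_op \<mu> P u z = h z + poly e (z - \<rho>))" for h u e
  have solve: "\<exists>u e. sol h u e" if "r < R" "h holomorphic_on ball \<rho> R" for h R
    unfolding sol_def by (rule solve0[OF that])
  have "\<exists>u e. sol (h i) u e" if "i \<in> J" for i
    using solve[of "e i" "h i"] r(3) R(2)[OF that] eh(3)[OF that] by simp
  then obtain u p where up: "\<And>i. i \<in> J \<Longrightarrow> sol (h i) (u i) (p i)" by metis
  note u = up[unfolded sol_def, THEN conjunct1] up[unfolded sol_def, THEN conjunct2, THEN conjunct2, THEN conjunct1, rule_format]
    up[unfolded sol_def, THEN conjunct2, THEN conjunct2, THEN conjunct2]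
  \<comment> \<open>The \<open>b k\<close> supply the Taylor terms of order below \<open>N\<close>
    that the solutions \<open>u i\<close> lack. Each will be corrected by a \<open>v k\<close>,
    vanishing to order \<open>N\<close>, so that the image becomes a polynomial of bounded
    degree.\<close>
  define b where "b k z = poly (monom 1 k) (z - \<rho>)" for k z
  have b_hol: "b k holomorphic_on S" for k S unfolding b_def[abs_def] by (intro holomorphic_intros)
  have b_an: "b k analytic_on {z}" for k z unfolding analytic_at using b_hol[of k UNIV] by blast
  have "\<exists>u e. sol (\<lambda>z. - diff_op \<mu> P (b k) z) u e" for k
    using solve[of "r + 1" "\<lambda>z. - diff_op \<mu> P (b k) z"]
    by (simp add: holomorphic_on_minus diff_op_holomorphic b_hol)
  then obtain v q where vq: "\<And>k. sol (\<lambda>z. - diff_op \<mu> P (b k) z) (v k) (q k)" by metis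
  note v = vq[unfolded sol_def, THEN conjunct1] vq[unfolded sol_def, THEN conjunct2, THEN conjunct1, rule_format]
    vq[unfolded sol_def, THEN conjunct2, THEN conjunct2, THEN conjunct1, rule_format]
    vq[unfolded sol_def, THEN conjunct2, THEN conjunct2, THEN conjunct2]

  have an_ev: "\<forall>\<^sub>F z in nhds \<rho>. g analytic_on {z}" if "g analytic_on {\<rho>}" for g
  proof -
    note an = that
    obtain S where S: "open S" "\<rho> \<in> S" "g holomorphic_on S" using an unfolding analytic_at by blast
    show ?thesis
      by (rule eventually_mono[OF eventually_nhds_in_open[OF S(1,2)]]) (use S in \<open>unfold analytic_at, blast\<close>)
  qed
  have "finite ({z. poly (P 0) z = 0} - {\<rho>})" using poly_roots_finite[OF P0] by simp
  hence "open (- ({z. poly (P 0) z = 0} - {\<rho>}))" by (intro open_Compl finite_imp_closed)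
  from eventually_nhds_in_open[OF this, of \<rho>]
  have "\<forall>\<^sub>F z in nhds \<rho>. poly (P 0) z = 0 \<longrightarrow> z = \<rho>" by (auto elim!: eventually_mono)
  moreover have "\<forall>\<^sub>F z in nhds \<rho>. \<forall>i\<in>J. u i analytic_on {z} \<and> diff_op \<mu> P (u i) z = h i z + poly (p i) (z - \<rho>)"
    using u(1,3) an_ev by (intro eventually_ball_finite J ballI eventually_conj) auto
  moreover have "\<forall>\<^sub>F z in nhds \<rho>. \<forall>k\<in>{..<N}. v k analytic_on {z} \<and>
      diff_op \<mu> P (v k) z = - diff_op \<mu> P (b k) z + poly (q k) (z - \<rho>)"
    using v(1,4) an_ev by (intro eventually_ball_finite ballI eventually_conj) auto
  moreover have "\<forall>\<^sub>F z in nhds \<rho>. z \<in> ball \<rho> R" using R(1) by (intro eventually_nhds_in_open) auto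
  moreover define good where "good z \<longleftrightarrow> (poly (P 0) z = 0 \<longrightarrow> z = \<rho>) \<and>
      (\<forall>i\<in>J. u i analytic_on {z} \<and> diff_op \<mu> P (u i) z = h i z + poly (p i) (z - \<rho>)) \<and>
      (\<forall>k\<in>{..<N}. v k analytic_on {z} \<and> diff_op \<mu> P (v k) z = - diff_op \<mu> P (b k) z + poly (q k) (z - \<rho>)) \<and>
      z \<in> ball \<rho> R" for z
  ultimately have "\<forall>\<^sub>F z in nhds \<rho>. good z" unfolding good_def by (intro eventually_conj)
  then obtain \<delta> where \<delta>: "\<delta> > 0" and near0: "\<And>z. z \<in> ball \<rho> \<delta> \<Longrightarrow> good z"
    by (auto simp: eventually_nhds_metric dist_commute)
  note near = near0[unfolded good_def]
  let ?D = "cut_disk \<theta> \<rho> \<delta>"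
  have DB: "z \<in> ball \<rho> \<delta>" "z \<noteq> \<rho>" if "z \<in> ?D" for z using that by (auto simp: cut_disk_eq cut_ray_iff)
  have De: "z \<in> cut_disk \<theta> \<rho> (e i)" if "z \<in> ?D" "i \<in> J" for z i
    using that near[OF DB(1)[OF that(1)]] R(2)[OF that(2)] by (auto simp: cut_disk_eq)
  have G_an: "G i analytic_on {z}" if "z \<in> ?D" "i \<in> J" for z i
    using De[OF that] eh(2)[OF that(2)] open_cut_disk unfolding analytic_at by blast
  \<comment> \<open>Every \<open>X i\<close> is sent to a polynomial \<open>s i\<close> in
    \<open>z - \<rho>\<close> with at most \<open>N + ?m - \<mu>\<close> coefficients, so membership
    of a combination in the kernel is a finite set of equations.\<close>
  define X where "X = case_sum (\<lambda>i z. 1 * G i z + (- 1) * u i z) (\<lambda>k z. 1 * b k z + 1 * v k z)"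
  define s where "s = case_sum (\<lambda>i. - p i) q"
  let ?I = "J <+> {..<N}"
  have X_an: "X i analytic_on {z}" if "z \<in> ?D" "i \<in> ?I" for z i
    using that near[OF DB(1)[OF that(1)]] G_an[OF that(1)] b_an
    by (auto simp: X_def intro!: analytic_intros)
  have X_op: "diff_op \<mu> P (X i) z = poly (s i) (z - \<rho>)" if "z \<in> ?D" "i \<in> ?I" for z i
    using that(2)
  proof (elim PlusE)
    fix j assume j: "j \<in> J" "i = Inl j"
    have "diff_op \<mu> P (X i) z = 1 * diff_op \<mu> P (G j) z + (- 1) * diff_op \<mu> P (u j) z"
      unfolding X_def j sum.case using near[OF DB(1)[OF that(1)]] G_an[OF that(1)] j(1)
      by (intro diff_op_lincomb2) auto
    thus ?thesis using near[OF DB(1)[OF that(1)]] eh(4)[OF j(1) De[OF that(1) j(1)]] j by (simp add: s_def)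
  next
    fix k assume k: "k \<in> {..<N}" "i = Inr k"
    have "diff_op \<mu> P (X i) z = 1 * diff_op \<mu> P (b k) z + 1 * diff_op \<mu> P (v k) z"
      unfolding X_def k sum.case using near[OF DB(1)[OF that(1)]] b_an k(1)
      by (intro diff_op_lincomb2) auto
    thus ?thesis using near[OF DB(1)[OF that(1)]] k by (simp add: s_def)
  qed
  have s0: "coeff (s i) j = 0" if "i \<in> ?I" "N + ?m \<le> j + \<mu>" for i j
    using that u(2) v(3) by (auto simp: s_def)
  define z1 where "z1 = \<rho> + of_real (\<delta> / 2) * cis (- \<theta>)"
  have z1: "z1 \<in> ?D" unfolding z1_def by (rule cut_disk_nonempty[OF \<delta>])
  define L where "L = N + ?m - \<mu>"
  have L: "N + ?m = L + \<mu>" using N by (simp add: L_def)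
  \<comment> \<open>The first \<open>L\<close> equations make the image vanish, the last \<mu> the
    initial values at the ordinary point \<open>z1\<close>; uniqueness then makes the whole
    combination zero on the cut disk.\<close>
  define A where "A e i = (if e < L then coeff (s i) e else (deriv ^^ (e - L)) (X i) z1)" for e i
  have finI: "finite ?I" using J by simp
  show ?thesis
  proof (intro exI[of _ N] exI[of _ A] allI impI)
    fix x assume "\<forall>e < N + ?m. (\<Sum>i\<in>?I. A e i * x i) = 0"
    hence sys: "\<And>e. e < N + ?m \<Longrightarrow> (\<Sum>i\<in>?I. A e i * x i) = 0" by blast
    define \<Psi> where "\<Psi> z = (\<Sum>i\<in>?I. x i * X i z)" for z
    have "\<Psi> analytic_on {z}" if "z \<in> ?D" for z
      unfolding \<Psi>_def[abs_def] using X_an[OF that] by (intro analytic_intros) auto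
    hence \<Psi>_hol: "\<Psi> holomorphic_on ?D" using analytic_imp_holomorphic analytic_on_analytic_at by blast
    have \<Psi>0: "\<Psi> z = 0" if "z \<in> ?D" for z
    proof (rule diff_op_kernel_zero[OF open_cut_disk connected_cut_disk \<Psi>_hol _ z1 _ _ that])
      fix w assume w: "w \<in> ?D"
      have "diff_op \<mu> P \<Psi> w = (\<Sum>i\<in>?I. x i * diff_op \<mu> P (X i) w)"
        unfolding \<Psi>_def[abs_def] by (rule diff_op_sum) (rule X_an[OF w])
      also have "\<dots> = (\<Sum>i\<in>?I. x i * poly (s i) (w - \<rho>))"
        by (intro sum.cong refl) (simp add: X_op[OF w])
      also have "\<dots> = poly (\<Sum>i\<in>?I. smult (x i) (s i)) (w - \<rho>)" by (simp add: poly_sum)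
      also have "(\<Sum>i\<in>?I. smult (x i) (s i)) = 0"
      proof (rule poly_eqI)
        fix j
        show "coeff (\<Sum>i\<in>?I. smult (x i) (s i)) j = coeff 0 j"
        proof (cases "j < L")
          case True
          thus ?thesis using sys[of j] L by (simp add: coeff_sum A_def mult.commute)
        next
          case False
          thus ?thesis using s0[of _ j] L by (simp add: coeff_sum sum.neutral)
        qed
      qed
      finally show "diff_op \<mu> P \<Psi> w = 0" by simp
    next
      show "poly (P 0) z1 \<noteq> 0" using near[OF DB(1)[OF z1]] DB(2)[OF z1] by blast
      fix k assume k: "k < \<mu>"
      have "(deriv ^^ k) \<Psi> z1 = (\<Sum>i\<in>?I. x i * (deriv ^^ k) (X i) z1)"
        unfolding \<Psi>_def[abs_def] by (rule higher_deriv_lincomb) (rule X_an[OF z1])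
      also have "\<dots> = 0" using sys[of "L + k"] k L by (simp add: A_def mult.commute)
      finally show "(deriv ^^ k) \<Psi> z1 = 0" .
    qed
    define w where "w z = (\<Sum>k<N. x (Inr k) * (1 * b k z + 1 * v k z))" for z
    define U where "U z = (\<Sum>i\<in>J. x (Inl i) * u i z) - w z" for z
    have w_an: "w analytic_on {z}" if "z \<in> ball \<rho> \<delta>" for z
      unfolding w_def[abs_def] using near[OF that] b_an by (auto intro!: analytic_intros)
    have "U analytic_on {z}" if "z \<in> ball \<rho> \<delta>" for z
      unfolding U_def[abs_def] using near[OF that] w_an[OF that] by (auto intro!: analytic_intros)
    hence U_hol: "U holomorphic_on ball \<rho> \<delta>" using analytic_imp_holomorphic analytic_on_analytic_at by blast
    have w_hol: "w holomorphic_on ball \<rho> \<delta>" using w_an analytic_imp_holomorphic analytic_on_analytic_at by blast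
    have split: "(\<Sum>i\<in>J. x (Inl i) * (G i z - u i z)) + w z = 0" if "z \<in> ?D" for z
      using \<Psi>0[OF that] J unfolding \<Psi>_def w_def by (simp add: sum.Plus X_def)
    hence "(\<Sum>i\<in>J. x (Inl i) * G i z) = U z" if "z \<in> ?D" for z
      using that by (fastforce simp: U_def right_diff_distrib sum_subtractf algebra_simps)
    hence "(\<lambda>z. \<Sum>i\<in>J. x (Inl i) * G i z) \<in> O_germ \<theta> \<rho>"
      unfolding O_germ_def using \<delta> U_hol by blast
    \<comment> \<open>Here \<open>w\<close> vanishes on the cut disk, hence on the full ball by the
      identity theorem. As each \<open>v k\<close> vanishes to order \<open>N\<close> at \<rho>, the
      low-order Taylor coefficients of \<open>w\<close> are the auxiliary unknowns
      themselves.\<close>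
    moreover have "x (Inr l) = 0" if c0: "\<forall>i\<in>J. x (Inl i) = 0" and l: "l < N" for l
    proof -
      have w0: "w z = 0" if "z \<in> ball \<rho> \<delta>" for z
      proof (rule analytic_continuation_open[of ?D "ball \<rho> \<delta>" w "\<lambda>_. 0" z])
        show "?D \<noteq> {}" using z1 by blast
        show "w z = 0" if "z \<in> ?D" for z using split[OF that] c0 by simp
      qed (use open_cut_disk w_hol that DB in auto)
      have "\<forall>\<^sub>F z in nhds \<rho>. z \<in> ball \<rho> \<delta>" using \<delta> by (intro eventually_nhds_in_open) auto
      hence "\<forall>\<^sub>F z in nhds \<rho>. w z = 0" by eventually_elim (rule w0)
      hence "0 = (deriv ^^ l) w \<rho>" using higher_deriv_cong_ev[of w "\<lambda>_. 0" \<rho> \<rho> l] by simp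
      also have "\<dots> = (\<Sum>k<N. x (Inr k) * (deriv ^^ l) (\<lambda>z. 1 * b k z + 1 * v k z) \<rho>)"
        unfolding w_def[abs_def] by (rule higher_deriv_lincomb) (auto intro!: analytic_intros b_an v)
      also have "\<dots> = (\<Sum>k<N. x (Inr k) * (if k = l then fact l else 0))"
      proof (intro sum.cong refl)
        fix k
        have "(deriv ^^ l) (\<lambda>z. \<Sum>i\<in>UNIV. 1 * (if i then b k else v k) z) \<rho>
            = (\<Sum>i\<in>UNIV. 1 * (deriv ^^ l) (if i then b k else v k) \<rho>)"
          using b_an v(1) by (intro higher_deriv_lincomb) auto
        hence "(deriv ^^ l) (\<lambda>z. 1 * b k z + 1 * v k z) \<rho> = (deriv ^^ l) (b k) \<rho> + (deriv ^^ l) (v k) \<rho>"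
          by (simp add: UNIV_bool add.commute)
        also have "\<dots> = (if k = l then fact l else 0)"
          using v(2)[OF l] higher_deriv_poly_translate[of l "monom 1 k" \<rho>] by (simp add: b_def[abs_def])
        finally show "x (Inr k) * (deriv ^^ l) (\<lambda>z. 1 * b k z + 1 * v k z) \<rho> = x (Inr k) * (if k = l then fact l else 0)"
          by simp
      qed
      also have "\<dots> = x (Inr l) * fact l" using l by (simp add: if_distrib cong: if_cong)
      finally show ?thesis by simp
    qed
    ultimately show "(\<lambda>z. \<Sum>i\<in>J. x (Inl i) * G i z) \<in> O_germ \<theta> \<rho> \<and>
       ((\<forall>i\<in>J. x (Inl i) = 0) \<longrightarrow> (\<forall>k<N. x (Inr k) = 0))" by blast
  qed
qed

section \<open>Continuation across the cuts\<close>

lemma convex_rotated_box: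
  "convex {z. a < rot_Re \<theta> z \<and> rot_Re \<theta> z < b \<and> c < rot_Im \<theta> z \<and> rot_Im \<theta> z < d}"
proof -
  have "linear (rot_Re \<theta>)" "linear (rot_Im \<theta>)"
    by (auto intro!: linearI)
  hence "convex (rot_Re \<theta> -` {a<..<b} \<inter> rot_Im \<theta> -` {c<..<d})"
    by (intro convex_Int convex_linear_vimage convex_real_interval)
  also have "rot_Re \<theta> -` {a<..<b} \<inter> rot_Im \<theta> -` {c<..<d} =
      {z. a < rot_Re \<theta> z \<and> rot_Re \<theta> z < b \<and> c < rot_Im \<theta> z \<and> rot_Im \<theta> z < d}" by auto
  finally show ?thesis .
qed

lemma open_rotated_box:
  "open {z. a < rot_Re \<theta> z \<and> rot_Re \<theta> z < b \<and> c < rot_Im \<theta> z \<and> rot_Im \<theta> z < d}"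
  by (intro open_Collect_conj open_Collect_less continuous_intros)

text \<open>The other cuts are closed and, lying on other parallel lines, do not contain \<rho>;
  near \<rho> only its own cut is seen.\<close>

lemma cut_plane_local:
  assumes "finite \<Sigma>" "\<rho> \<in> \<Sigma>"
    and Y: "\<And>\<rho>'. \<rho>' \<in> \<Sigma> \<Longrightarrow> \<rho>' \<noteq> \<rho> \<Longrightarrow> rot_Im \<theta> \<rho>' \<noteq> rot_Im \<theta> \<rho>"
  obtains \<epsilon> where "\<epsilon> > 0" "cut_disk \<theta> \<rho> \<epsilon> \<subseteq> cut_plane \<theta> \<Sigma>"
proof -
  have "closed (\<Union>\<rho>'\<in>\<Sigma> - {\<rho>}. cut_ray \<theta> \<rho>')" using assms(1) by (auto intro!: closed_UN closed_cut_ray)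
  hence "open (- (\<Union>\<rho>'\<in>\<Sigma> - {\<rho>}. cut_ray \<theta> \<rho>'))" by (rule open_Compl)
  moreover have "\<rho> \<in> - (\<Union>\<rho>'\<in>\<Sigma> - {\<rho>}. cut_ray \<theta> \<rho>')" using Y by (force simp: cut_ray_iff)
  ultimately obtain \<epsilon> where \<epsilon>: "\<epsilon> > 0" "ball \<rho> \<epsilon> \<subseteq> - (\<Union>\<rho>'\<in>\<Sigma> - {\<rho>}. cut_ray \<theta> \<rho>')"
    using open_contains_ball by blast
  have "cut_disk \<theta> \<rho> \<epsilon> \<subseteq> cut_plane \<theta> \<Sigma>"
    using \<epsilon>(2) unfolding cut_disk_eq subset_iff cut_plane_iff by blast
  with \<epsilon>(1) show ?thesis by (rule that)
qed

text \<open>Continuing a solution analytically from \<open>\<rho>\<close> along the cut shows that the values on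
  its two sides fit together.\<close>

lemma extension_across_cut:
  assumes fin: "finite \<Sigma>" and \<Sigma>: "\<Sigma> = finite_singularities P" and \<rho>: "\<rho> \<in> \<Sigma>"
    and Y: "\<And>\<rho>'. \<rho>' \<in> \<Sigma> \<Longrightarrow> \<rho>' \<noteq> \<rho> \<Longrightarrow> rot_Im \<theta> \<rho>' \<noteq> rot_Im \<theta> \<rho>"
    and u: "u holomorphic_on cut_plane \<theta> \<Sigma>"
    and D: "\<And>z. z \<in> cut_plane \<theta> \<Sigma> \<Longrightarrow> diff_op \<mu> P u z = poly p z"
    and germ: "u \<in> O_germ \<theta> \<rho>" and z: "z \<in> cut_ray \<theta> \<rho>"
  shows "\<exists>e>0. \<exists>k. k holomorphic_on ball z e \<and> (\<forall>w\<in>ball z e \<inter> cut_plane \<theta> \<Sigma>. k w = u w)"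
proof -
  let ?\<Omega> = "cut_plane \<theta> \<Sigma>"
  obtain e1 h where e1: "e1 > 0" "h holomorphic_on ball \<rho> e1" "\<And>z. z \<in> cut_disk \<theta> \<rho> e1 \<Longrightarrow> u z = h z"
    using germ by (auto simp: O_germ_def)
  obtain e2 where e2: "e2 > 0" "cut_disk \<theta> \<rho> e2 \<subseteq> ?\<Omega>"
    using cut_plane_local[OF fin \<rho>, of \<theta>] Y by blast
  define \<epsilon> where "\<epsilon> = min e1 e2"
  have \<epsilon>: "\<epsilon> > 0" using e1 e2 by (simp add: \<epsilon>_def)
  have h: "h holomorphic_on ball \<rho> \<epsilon>" by (rule holomorphic_on_subset[OF e1(2)]) (auto simp: \<epsilon>_def)
  have uh: "u z = h z" if "z \<in> cut_disk \<theta> \<rho> \<epsilon>" for z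
    using that e1(3) cut_disk_mono[of \<epsilon> e1 \<theta> \<rho>] by (auto simp: \<epsilon>_def)
  have sub: "cut_disk \<theta> \<rho> \<epsilon> \<subseteq> ?\<Omega>" using e2 cut_disk_mono[of \<epsilon> e2 \<theta> \<rho>] by (auto simp: \<epsilon>_def)
  show ?thesis
  proof (cases "z = \<rho>")
    case True
    have "h w = u w" if "w \<in> ball z \<epsilon> \<inter> ?\<Omega>" for w
    proof -
      have "w \<in> cut_disk \<theta> \<rho> \<epsilon>" using that True \<rho> by (auto simp: cut_disk_eq cut_plane_iff)
      thus ?thesis by (simp add: uh)
    qed
    thus ?thesis using \<epsilon> h True by (intro exI[of _ \<epsilon>] conjI exI[of _ h]) auto
  next
    case False
    have Dh: "diff_op \<mu> P h w = poly p w" if "w \<in> ball \<rho> \<epsilon>" for w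
    proof (rule analytic_continuation_open[of "cut_disk \<theta> \<rho> \<epsilon>" "ball \<rho> \<epsilon>" "diff_op \<mu> P h" "poly p" w])
      show "cut_disk \<theta> \<rho> \<epsilon> \<noteq> {}" using cut_disk_nonempty[OF \<epsilon>] by blast
      show "cut_disk \<theta> \<rho> \<epsilon> \<subseteq> ball \<rho> \<epsilon>" by (auto simp: cut_disk_eq)
      show "diff_op \<mu> P h holomorphic_on ball \<rho> \<epsilon>" by (intro diff_op_holomorphic h open_ball)
      show "poly p holomorphic_on ball \<rho> \<epsilon>" by (intro holomorphic_intros)
      fix w assume w: "w \<in> cut_disk \<theta> \<rho> \<epsilon>"
      have "\<forall>\<^sub>F x in nhds w. h x = u x"
        using eventually_nhds_in_open[OF open_cut_disk w] by eventually_elim (simp add: uh)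
      hence "diff_op \<mu> P h w = diff_op \<mu> P u w" by (rule diff_op_cong_ev)
      thus "diff_op \<mu> P h w = poly p w" using D w sub by auto
    qed (use open_cut_disk that in auto)
    obtain \<delta> where \<delta>: "\<delta> > 0" "\<And>\<rho>'. \<rho>' \<in> \<Sigma> - {\<rho>} \<Longrightarrow> \<delta> \<le> \<bar>rot_Im \<theta> \<rho>' - rot_Im \<theta> \<rho>\<bar>"
      using finite_positive_lower_bound[of "\<Sigma> - {\<rho>}" "\<lambda>\<rho>'. \<bar>rot_Im \<theta> \<rho>' - rot_Im \<theta> \<rho>\<bar>"] fin Y by auto
    define box where "box c d = {w. rot_Re \<theta> z - 1 < rot_Re \<theta> w \<and> rot_Re \<theta> w < rot_Re \<theta> \<rho> \<and>
      rot_Im \<theta> \<rho> + c < rot_Im \<theta> w \<and> rot_Im \<theta> w < rot_Im \<theta> \<rho> + d}" for c d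
    have box: "open (box c d)" "convex (box c d)" for c d
      unfolding box_def by (rule open_rotated_box convex_rotated_box)+
    \<comment> \<open>A rotated rectangle about the segment of the cut from \<open>z\<close> to
      \<rho>, with \<rho> on its edge. The other singularities are off by at least \<delta> in
      \<open>rot_Im\<close>, so the equation is regular on it.\<close>
    define S where "S = box (- \<delta>) \<delta>"
    have S: "open S" "convex S" unfolding S_def by (rule box)+
    have zY: "rot_Im \<theta> z = rot_Im \<theta> \<rho>" "rot_Re \<theta> z \<le> rot_Re \<theta> \<rho>" using z by (auto simp: cut_ray_iff)
    have "rot_Re \<theta> z \<noteq> rot_Re \<theta> \<rho>" using False zY(1) rotated_coords_eq[of z \<theta>] rotated_coords_eq[of \<rho> \<theta>] by metis
    hence zX: "rot_Re \<theta> z < rot_Re \<theta> \<rho>" using zY by simp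
    have zS: "z \<in> S" using zX zY \<delta> by (simp add: S_def box_def)
    have P0: "poly (P 0) w \<noteq> 0" if "w \<in> S" for w
    proof
      assume "poly (P 0) w = 0"
      hence "w \<in> \<Sigma>" by (simp add: \<Sigma> finite_singularities_def)
      moreover have "w \<noteq> \<rho>" using that by (auto simp: S_def box_def)
      ultimately have "\<delta> \<le> \<bar>rot_Im \<theta> w - rot_Im \<theta> \<rho>\<bar>" using \<delta> by auto
      thus False using that by (auto simp: S_def box_def)
    qed
    \<comment> \<open>The points \<open>pt \<eta>\<close> with
      \<open>\<bar>\<eta>\<bar> \<le> t0\<close> lie within
      \<open>2 * t0 \<le> \<epsilon> / 4\<close> of \<rho>; the other two bounds keep them in the
      rectangle.\<close>
    define t0 where "t0 = min (min (\<epsilon> / 4) \<delta> / 2) ((rot_Re \<theta> \<rho> - rot_Re \<theta> z) / 2)"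
    have t0: "t0 > 0" "t0 \<le> \<epsilon> / 8" "t0 < \<delta>" "t0 < rot_Re \<theta> \<rho> - rot_Re \<theta> z"
    proof -
      have m: "t0 \<le> min (\<epsilon> / 4) \<delta> / 2" "t0 \<le> (rot_Re \<theta> \<rho> - rot_Re \<theta> z) / 2"
        unfolding t0_def by (rule min.cobounded1, rule min.cobounded2)
      have m': "min (\<epsilon> / 4) \<delta> \<le> \<epsilon> / 4" "min (\<epsilon> / 4) \<delta> \<le> \<delta>" by auto
      show "t0 \<le> \<epsilon> / 8" using m(1) m'(1) by linarith
      show "t0 < \<delta>" using m(1) m'(2) \<delta>(1) by linarith
      have "(rot_Re \<theta> \<rho> - rot_Re \<theta> z) / 2 < rot_Re \<theta> \<rho> - rot_Re \<theta> z" using zX by simp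
      thus "t0 < rot_Re \<theta> \<rho> - rot_Re \<theta> z" using m(2) by simp
      show "t0 > 0" using \<epsilon> \<delta>(1) zX by (simp add: t0_def)
    qed
    define pt where "pt \<eta> = \<rho> + Complex (- t0) \<eta> * cis (- \<theta>)" for \<eta>
    have pt_ball: "pt \<eta> \<in> ball \<rho> \<epsilon>" if "\<bar>\<eta>\<bar> \<le> t0" for \<eta>
    proof -
      have "norm (Complex (- t0) \<eta>) \<le> t0 + \<bar>\<eta>\<bar>" using cmod_le[of "Complex (- t0) \<eta>"] t0 by simp
      thus ?thesis using that t0 \<epsilon> by (simp add: pt_def rotated_dist)
    qed
    have pt_box: "pt \<eta> \<in> box c d" if "c < \<eta>" "\<eta> < d" for \<eta> c d
      using that t0 by (simp add: pt_def box_def)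
    have pt0: "pt 0 \<in> S" "pt 0 \<in> ball \<rho> \<epsilon>" using \<delta> t0 pt_ball[of 0] by (auto simp: S_def intro: pt_box)
    \<comment> \<open>The germ \<open>h\<close> provides initial values at a point of the cut
      itself; solving on the convex \<open>S\<close> continues it as far as
      \<open>z\<close>.\<close>
    obtain k where k: "k holomorphic_on S" "\<And>w. w \<in> S \<Longrightarrow> diff_op \<mu> P k w = poly p w"
      "\<And>j. j < \<mu> \<Longrightarrow> (deriv ^^ j) k (pt 0) = (deriv ^^ j) h (pt 0)"
    proof (rule diff_op_solution_ivp[where S = S and ?z0.0 = "pt 0" and P = P and g = "poly p" and \<mu> = \<mu>
          and a = "\<lambda>j. (deriv ^^ j) h (pt 0)"])
      show "simply_connected S" using S(2) by (rule convex_imp_simply_connected)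
      show "poly p holomorphic_on S" by (intro holomorphic_intros)
    qed (use S pt0 P0 in auto)
    have kh: "k w = h w" if w: "w \<in> S \<inter> ball \<rho> \<epsilon>" for w
    proof -
      have an: "k analytic_on {x}" "h analytic_on {x}" if "x \<in> S \<inter> ball \<rho> \<epsilon>" for x
        using that k(1) h S(1) unfolding analytic_at by auto
      have "1 * k w + (- 1) * h w = 0"
      proof (rule diff_op_kernel_zero[where S = "S \<inter> ball \<rho> \<epsilon>" and z = "pt 0" and \<mu> = \<mu> and P = P
            and f = "\<lambda>w. 1 * k w + (- 1) * h w" and w = w])
        show "open (S \<inter> ball \<rho> \<epsilon>)" using S by auto
        show "connected (S \<inter> ball \<rho> \<epsilon>)" using S by (intro convex_connected convex_Int) auto
        show "(\<lambda>w. 1 * k w + (- 1) * h w) holomorphic_on S \<inter> ball \<rho> \<epsilon>"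
          by (intro holomorphic_intros holomorphic_on_subset[OF k(1)] holomorphic_on_subset[OF h]) auto
        show "diff_op \<mu> P (\<lambda>w. 1 * k w + (- 1) * h w) x = 0" if "x \<in> S \<inter> ball \<rho> \<epsilon>" for x
          using diff_op_lincomb2[OF an[OF that], of \<mu> P 1 "- 1"] k(2)[of x] Dh[of x] that by simp
        show "(deriv ^^ j) (\<lambda>w. 1 * k w + (- 1) * h w) (pt 0) = 0" if "j < \<mu>" for j
        proof -
          have "(deriv ^^ j) (\<lambda>w. k w - h w) (pt 0) = (deriv ^^ j) k (pt 0) - (deriv ^^ j) h (pt 0)"
            using pt0 S by (intro higher_deriv_diff[of _ "S \<inter> ball \<rho> \<epsilon>"] holomorphic_on_subset[OF k(1)]
                holomorphic_on_subset[OF h]) auto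
          thus ?thesis using k(3)[OF that] by simp
        qed
      qed (use pt0 P0 w in auto)
      thus ?thesis by simp
    qed
    \<comment> \<open>The upper and lower halves of the rectangle avoid every cut and meet the ball,
      where \<open>k\<close>, \<open>h\<close> and \<open>u\<close> agree; the identity theorem
      applies to each half separately.\<close>
    have side: "k w = u w" if w: "w \<in> box c d" and cd: "c \<ge> - \<delta>" "d \<le> \<delta>" "c \<ge> 0 \<or> d \<le> 0"
      and \<eta>: "c < \<eta>" "\<eta> < d" "\<bar>\<eta>\<bar> \<le> t0" for w c d \<eta>
    proof (rule analytic_continuation_open[of "box c d \<inter> ball \<rho> \<epsilon>" "box c d" k u w])
      have bS: "box c d \<subseteq> S" using cd by (auto simp: S_def box_def)
      have b\<Omega>: "box c d \<subseteq> ?\<Omega>"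
      proof
        fix x assume x: "x \<in> box c d"
        have "x \<notin> cut_ray \<theta> \<rho>'" if "\<rho>' \<in> \<Sigma>" for \<rho>'
        proof (cases "\<rho>' = \<rho>")
          case True thus ?thesis using x cd by (auto simp: box_def cut_ray_iff)
        next
          case False
          hence "\<delta> \<le> \<bar>rot_Im \<theta> \<rho>' - rot_Im \<theta> \<rho>\<bar>" using \<delta> that by auto
          thus ?thesis using x cd by (auto simp: box_def cut_ray_iff)
        qed
        thus "x \<in> ?\<Omega>" by (simp add: cut_plane_iff)
      qed
      show "box c d \<inter> ball \<rho> \<epsilon> \<noteq> {}" using pt_ball[OF \<eta>(3)] pt_box[OF \<eta>(1,2)] by blast
      show "connected (box c d)" using box by (intro convex_connected)
      show "k holomorphic_on box c d" by (rule holomorphic_on_subset[OF k(1) bS])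
      show "u holomorphic_on box c d" by (rule holomorphic_on_subset[OF u b\<Omega>])
      fix x assume x: "x \<in> box c d \<inter> ball \<rho> \<epsilon>"
      have "x \<in> cut_disk \<theta> \<rho> \<epsilon>" using x b\<Omega> \<rho> by (auto simp: cut_disk_eq cut_plane_iff)
      thus "k x = u x" using kh[of x] uh[of x] x bS by auto
    qed (use box w in auto)
    have ku: "k w = u w" if w: "w \<in> S \<inter> ?\<Omega>" for w
    proof -
      have "rot_Im \<theta> w \<noteq> rot_Im \<theta> \<rho>" using w \<rho> by (auto simp: S_def box_def cut_plane_iff cut_ray_iff)
      hence "w \<in> box 0 \<delta> \<or> w \<in> box (- \<delta>) 0" using w by (auto simp: S_def box_def)
      thus ?thesis
        using side[of w 0 \<delta> t0] side[of w "- \<delta>" 0 "- t0"] t0 \<delta> by auto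
    qed
    obtain e where e: "e > 0" "ball z e \<subseteq> S" using S(1) zS open_contains_ball by blast
    have "k holomorphic_on ball z e" by (rule holomorphic_on_subset[OF k(1) e(2)])
    moreover have "\<forall>w\<in>ball z e \<inter> ?\<Omega>. k w = u w" using ku e(2) by blast
    ultimately show ?thesis using e(1) by blast
  qed
qed

text \<open>The extensions across the cuts glue to an entire function, to which
  \<open>entire_imp_polynomial\<close> applies. The equation for \<open>q\<close> is recorded on the
  whole plane for the degree count that follows.\<close>

lemma microlocally_trivial_imp_polynomial:
  assumes P0: "P 0 \<noteq> 0" and reg: "at_most_regular_singular_at_infinity \<mu> P"
    and \<Sigma>: "\<Sigma> = finite_singularities P"
    and Y: "\<And>\<rho> \<rho>'. \<rho> \<in> \<Sigma> \<Longrightarrow> \<rho>' \<in> \<Sigma> \<Longrightarrow> \<rho>' \<noteq> \<rho> \<Longrightarrow> rot_Im \<theta> \<rho>' \<noteq> rot_Im \<theta> \<rho>"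
    and u: "u holomorphic_on cut_plane \<theta> \<Sigma>"
    and D: "\<And>z. z \<in> cut_plane \<theta> \<Sigma> \<Longrightarrow> diff_op \<mu> P u z = poly p z"
    and germ: "\<And>\<rho>. \<rho> \<in> \<Sigma> \<Longrightarrow> u \<in> O_germ \<theta> \<rho>"
  shows "\<exists>q. (\<forall>z\<in>cut_plane \<theta> \<Sigma>. u z = poly q z) \<and> (\<forall>z. diff_op \<mu> P (poly q) z = poly p z)"
proof -
  let ?\<Omega> = "cut_plane \<theta> \<Sigma>"
  have fin: "finite \<Sigma>" using poly_roots_finite[OF P0] by (simp add: \<Sigma> finite_singularities_def)
  have op: "open ?\<Omega>" by (rule open_cut_plane[OF fin])
  have loc: "\<exists>e>0. \<exists>k. k holomorphic_on ball z e \<and> (\<forall>w\<in>ball z e \<inter> ?\<Omega>. k w = u w)" for z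
  proof (cases "z \<in> ?\<Omega>")
    case True
    then obtain e where "e > 0" "ball z e \<subseteq> ?\<Omega>" using op open_contains_ball by blast
    thus ?thesis using u by (intro exI[of _ e] conjI exI[of _ u]) (auto intro: holomorphic_on_subset)
  next
    case False
    then obtain \<rho> where \<rho>: "\<rho> \<in> \<Sigma>" "z \<in> cut_ray \<theta> \<rho>" by (auto simp: cut_plane_iff)
    show ?thesis
    proof (rule extension_across_cut[OF fin \<Sigma> \<rho>(1) _ u _ germ[OF \<rho>(1)] \<rho>(2)])
      show "rot_Im \<theta> \<rho>' \<noteq> rot_Im \<theta> \<rho>" if "\<rho>' \<in> \<Sigma>" "\<rho>' \<noteq> \<rho>" for \<rho>' by (rule Y[OF \<rho>(1) that])
      show "diff_op \<mu> P u z = poly p z" if "z \<in> ?\<Omega>" for z by (rule D[OF that])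
    qed
  qed
  obtain U where U: "U holomorphic_on UNIV" "\<And>z. z \<in> ?\<Omega> \<Longrightarrow> U z = u z"
  proof (rule entire_extension_from_dense[OF _ loc])
    show "\<exists>w\<in>?\<Omega>. dist w z < e" if "e > 0" for z e
      using cut_plane_dense[OF fin that, of \<theta> z] by blast
  qed (rule that)
  have DU: "diff_op \<mu> P U z = poly p z" for z
  proof (rule analytic_continuation_open[of ?\<Omega> UNIV "diff_op \<mu> P U" "poly p" z])
    show "?\<Omega> \<noteq> {}" using cut_plane_dense[OF fin zero_less_one, of \<theta> 0] by blast
    show "diff_op \<mu> P U holomorphic_on UNIV" by (intro diff_op_holomorphic U open_UNIV)
    show "poly p holomorphic_on UNIV" by (intro holomorphic_intros)
    fix w assume w: "w \<in> ?\<Omega>"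
    have "\<forall>\<^sub>F x in nhds w. U x = u x"
      using eventually_nhds_in_open[OF op w] by eventually_elim (rule U)
    hence "diff_op \<mu> P U w = diff_op \<mu> P u w" by (rule diff_op_cong_ev)
    thus "diff_op \<mu> P U w = poly p w" using D w by simp
  qed (use op in auto)
  from entire_imp_polynomial[OF reg P0 U(1) DU] obtain q where q: "\<And>z. U z = poly q z" by blast
  hence "U = poly q" by blast
  thus ?thesis using U(2) DU by (intro exI[of _ q]) auto
qed

text \<open>If \<open>degree q\<close> were at least \<open>n0\<close>, the top coefficient of the
  image would be the nonzero indicial value times the leading coefficient, in a degree where
  \<open>p\<close> has none.\<close>

lemma diff_op_poly_degree:
  assumes reg: "at_most_regular_singular_at_infinity \<mu> P" and P0: "P 0 \<noteq> 0"
    and ind: "\<And>n. n \<ge> n0 \<Longrightarrow> op_coeff \<mu> P (degree (P 0)) n \<noteq> 0" and n0: "n0 \<ge> \<mu>"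
    and D: "\<And>z. diff_op \<mu> P (poly q) z = poly p z"
    and p: "\<And>j. j \<ge> n0 - \<mu> + degree (P 0) \<Longrightarrow> coeff p j = 0"
    and i: "i \<ge> n0"
  shows "coeff q i = 0"
proof (rule ccontr)
  assume "coeff q i \<noteq> 0"
  hence "i \<le> degree q" "q \<noteq> 0" by (auto intro: le_degree)
  let ?K = "degree (P 0)" and ?d = "degree q"
  have "(\<lambda>w. poly q (0 + w)) has_fps_expansion fps_of_poly q" using has_fps_expansion_poly[of q] by simp
  from has_fps_expansion_diff_op[OF this, of \<mu> P]
  have "poly p has_fps_expansion fps_op \<mu> P (fps_of_poly q)" by (simp add: D)
  hence op: "fps_op \<mu> P (fps_of_poly q) = fps_of_poly p"
    by (rule fps_expansion_unique_complex[OF _ has_fps_expansion_poly])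
  have "0 = coeff p (?d + ?K - \<mu>)" using p[of "?d + ?K - \<mu>"] i \<open>i \<le> ?d\<close> n0 by simp
  also have "\<dots> = fps_nth (fps_op \<mu> P (fps_of_poly q)) (?d + ?K - \<mu>)" by (simp add: op)
  also have "\<dots> = (\<Sum>k\<le>?K. op_coeff \<mu> P (?K - k) (?d + k) * fps_nth (fps_of_poly q) (?d + k))"
    by (rule fps_op_nth_infinity[OF reg P0]) (use i \<open>i \<le> ?d\<close> n0 in auto)
  also have "\<dots> = (\<Sum>k\<in>{0}. op_coeff \<mu> P (?K - k) (?d + k) * fps_nth (fps_of_poly q) (?d + k))"
    by (intro sum.mono_neutral_right) (auto simp: coeff_eq_0)
  also have "\<dots> = op_coeff \<mu> P ?K ?d * lead_coeff q" by simp
  finally show False using ind[of ?d] i \<open>i \<le> ?d\<close> \<open>q \<noteq> 0\<close> by auto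
qed

section \<open>Existence and uniqueness\<close>

theorem theorem1:
  fixes \<mu> :: nat and P :: "nat \<Rightarrow> complex poly" and \<Sigma> :: "complex set" and \<theta> :: real
    and F :: "complex \<Rightarrow> complex \<Rightarrow> complex"
  assumes "P 0 \<noteq> 0"
    and "at_most_regular_singular_at_infinity \<mu> P"
    and "\<Sigma> = finite_singularities P"
    and "\<And>\<rho> \<rho>'. \<rho> \<in> \<Sigma> \<Longrightarrow> \<rho>' \<in> \<Sigma> \<Longrightarrow> \<rho> \<noteq> \<rho>' \<Longrightarrow> \<not> [Arg (\<rho> - \<rho>') = - \<theta>] (rmod pi)"
    and "\<And>\<rho>. \<rho> \<in> \<Sigma> \<Longrightarrow> F \<rho> \<in> O_hat \<theta> \<rho>"
    and "\<And>\<rho>. \<rho> \<in> \<Sigma> \<Longrightarrow> diff_op \<mu> P (F \<rho>) \<in> O_germ \<theta> \<rho>"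
  shows "(\<exists>f. f holomorphic_on cut_plane \<theta> \<Sigma> \<and>
            (\<exists>p. \<forall>z\<in>cut_plane \<theta> \<Sigma>. diff_op \<mu> P f z = poly p z) \<and>
            (\<forall>\<rho>\<in>\<Sigma>. (\<lambda>z. f z - F \<rho> z) \<in> O_germ \<theta> \<rho>)) \<and>
         (\<forall>f g. f holomorphic_on cut_plane \<theta> \<Sigma> \<and>
            (\<exists>p. \<forall>z\<in>cut_plane \<theta> \<Sigma>. diff_op \<mu> P f z = poly p z) \<and>
            (\<forall>\<rho>\<in>\<Sigma>. (\<lambda>z. f z - F \<rho> z) \<in> O_germ \<theta> \<rho>) \<and>
            g holomorphic_on cut_plane \<theta> \<Sigma> \<and>
            (\<exists>p. \<forall>z\<in>cut_plane \<theta> \<Sigma>. diff_op \<mu> P g z = poly p z) \<and>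
            (\<forall>\<rho>\<in>\<Sigma>. (\<lambda>z. g z - F \<rho> z) \<in> O_germ \<theta> \<rho>)
            \<longrightarrow> (\<exists>q. \<forall>z\<in>cut_plane \<theta> \<Sigma>. f z - g z = poly q z))"
proof -
  note P0 = assms(1) and reg = assms(2) and \<Sigma> = assms(3)
  let ?\<Omega> = "cut_plane \<theta> \<Sigma>"
  let ?K = "degree (P 0)"
  have fin: "finite \<Sigma>" using poly_roots_finite[OF P0] by (simp add: \<Sigma> finite_singularities_def)
  have op: "open ?\<Omega>" by (rule open_cut_plane[OF fin])
  have Y: "rot_Im \<theta> \<rho>' \<noteq> rot_Im \<theta> \<rho>" if "\<rho> \<in> \<Sigma>" "\<rho>' \<in> \<Sigma>" "\<rho>' \<noteq> \<rho>" for \<rho> \<rho>'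
    using rot_Im_distinct[OF assms(4)[OF that(2,1,3)] that(3)] .
  have rigid: "\<exists>q. (\<forall>z\<in>?\<Omega>. u z = poly q z) \<and> (\<forall>z. diff_op \<mu> P (poly q) z = poly p z)"
    if "u holomorphic_on ?\<Omega>" "\<And>z. z \<in> ?\<Omega> \<Longrightarrow> diff_op \<mu> P u z = poly p z"
      "\<And>\<rho>. \<rho> \<in> \<Sigma> \<Longrightarrow> u \<in> O_germ \<theta> \<rho>" for u p
    by (rule microlocally_trivial_imp_polynomial[OF P0 reg \<Sigma> _ that(1)]) (use Y that in auto)
  have an: "f analytic_on {z}" if "f holomorphic_on ?\<Omega>" "z \<in> ?\<Omega>" for f z
    using that op unfolding analytic_at by blast
  have uniq: "\<exists>q. \<forall>z\<in>?\<Omega>. f z - g z = poly q z"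
    if f: "f holomorphic_on ?\<Omega>" "\<forall>z\<in>?\<Omega>. diff_op \<mu> P f z = poly p1 z" "\<forall>\<rho>\<in>\<Sigma>. (\<lambda>z. f z - F \<rho> z) \<in> O_germ \<theta> \<rho>"
      and g: "g holomorphic_on ?\<Omega>" "\<forall>z\<in>?\<Omega>. diff_op \<mu> P g z = poly p2 z" "\<forall>\<rho>\<in>\<Sigma>. (\<lambda>z. g z - F \<rho> z) \<in> O_germ \<theta> \<rho>"
    for f g p1 p2
  proof -
    \<comment> \<open>The explicit factors give the shape of \<open>diff_op_lincomb2\<close> and
      \<open>O_germ_lincomb\<close>.\<close>
    define u where "u z = 1 * f z + (- 1) * g z" for z
    have "u holomorphic_on ?\<Omega>" unfolding u_def[abs_def] by (intro holomorphic_intros f g)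
    moreover have "diff_op \<mu> P u z = poly (p1 - p2) z" if "z \<in> ?\<Omega>" for z
      using diff_op_lincomb2[OF an[OF f(1) that] an[OF g(1) that], of \<mu> P 1 "- 1"] f(2) g(2) that
      by (simp add: u_def[abs_def])
    moreover have "u \<in> O_germ \<theta> \<rho>" if "\<rho> \<in> \<Sigma>" for \<rho>
      using O_germ_lincomb[OF f(3)[rule_format, OF that] g(3)[rule_format, OF that], of 1 "- 1"]
      by (simp add: u_def[abs_def])
    ultimately obtain q where "\<And>z. z \<in> ?\<Omega> \<Longrightarrow> u z = poly q z" using rigid[of u "p1 - p2"] by blast
    thus ?thesis by (intro exI[of _ q]) (simp add: u_def)
  qed

  \<comment> \<open>Functions on the cut plane with polynomial images\<close>
  obtain n0 where n0: "n0 \<ge> \<mu>" "\<And>n. n \<ge> n0 \<Longrightarrow> op_coeff \<mu> P ?K n \<noteq> 0"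
    by (rule op_coeff_indicial_nonzero[where P = P and \<mu> = \<mu>, OF P0]) (rule that)
  obtain z0 where z0: "z0 \<in> ?\<Omega>" using cut_plane_dense[OF fin zero_less_one, of \<theta> 0] by blast
  have P0\<Omega>: "poly (P 0) z \<noteq> 0" if "z \<in> ?\<Omega>" for z
    using that by (auto simp: \<Sigma> finite_singularities_def cut_plane_iff cut_ray_iff)
  \<comment> \<open>For \<open>i < ?K\<close> the exponents fill the gap between two bounds: from
    \<open>n0 - \<mu>\<close> on, the solutions vanish to order \<open>n0\<close> at
    \<open>z0\<close>; below \<open>n0 - \<mu> + ?K\<close>, polynomial preimages have degree below
    \<open>n0\<close>.\<close>
  have "\<exists>f. f holomorphic_on ?\<Omega> \<and> (\<forall>z\<in>?\<Omega>. diff_op \<mu> P f z = poly (monom 1 (n0 - \<mu> + i)) (z - z0)) \<and>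
      (\<forall>j<\<mu>. (deriv ^^ j) f z0 = 0)" for i
  proof -
    have g: "(\<lambda>z. poly (monom 1 (n0 - \<mu> + i)) (z - z0)) holomorphic_on ?\<Omega>" by (intro holomorphic_intros)
    show ?thesis
    proof (rule diff_op_solution[where S = "?\<Omega>" and ?z0.0 = z0 and P = P and \<mu> = \<mu>
          and g = "\<lambda>z. poly (monom 1 (n0 - \<mu> + i)) (z - z0)", OF op _ z0 _ g])
      show "simply_connected ?\<Omega>" by (rule simply_connected_cut_plane[OF fin])
      show "poly (P 0) z \<noteq> 0" if "z \<in> ?\<Omega>" for z by (rule P0\<Omega>[OF that])
    qed blast
  qed
  then obtain f where f: "\<And>i. f i holomorphic_on ?\<Omega>"
    "\<And>i z. z \<in> ?\<Omega> \<Longrightarrow> diff_op \<mu> P (f i) z = poly (monom 1 (n0 - \<mu> + i)) (z - z0)"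
    "\<And>i j. j < \<mu> \<Longrightarrow> (deriv ^^ j) (f i) z0 = 0" by metis
  \<comment> \<open>Index 0 is the given microsolution, the only entry that varies with \<rho>;
    indices 1 to \<open>?K\<close> are the global functions.\<close>
  define G where "G \<rho> = case_nat (F \<rho>) f" for \<rho>
  have "G \<rho> i \<in> O_hat \<theta> \<rho>" "diff_op \<mu> P (G \<rho> i) \<in> O_germ \<theta> \<rho>" if \<rho>: "\<rho> \<in> \<Sigma>" for \<rho> i
  proof -
    obtain \<epsilon> where \<epsilon>: "\<epsilon> > 0" "cut_disk \<theta> \<rho> \<epsilon> \<subseteq> ?\<Omega>"
      using cut_plane_local[OF fin \<rho>, of \<theta>] Y[OF \<rho>] by blast
    show "G \<rho> i \<in> O_hat \<theta> \<rho>"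
    proof (cases i)
      case (Suc j)
      have "f j holomorphic_on cut_disk \<theta> \<rho> \<epsilon>" by (rule holomorphic_on_subset[OF f(1) \<epsilon>(2)])
      thus ?thesis using Suc \<epsilon>(1) by (auto simp: G_def O_hat_def)
    qed (use assms(5)[OF \<rho>] in \<open>simp add: G_def\<close>)
    show "diff_op \<mu> P (G \<rho> i) \<in> O_germ \<theta> \<rho>"
    proof (cases i)
      case (Suc j)
      have "(\<lambda>z. poly (monom 1 (n0 - \<mu> + j)) (z - z0)) holomorphic_on ball \<rho> \<epsilon>" by (intro holomorphic_intros)
      moreover have "\<forall>z\<in>cut_disk \<theta> \<rho> \<epsilon>. diff_op \<mu> P (f j) z = poly (monom 1 (n0 - \<mu> + j)) (z - z0)"
        using f(2) \<epsilon>(2) by blast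
      ultimately show ?thesis using Suc \<epsilon>(1) unfolding O_germ_def G_def by auto
    qed (use assms(6)[OF \<rho>] in \<open>simp add: G_def\<close>)
  qed
  note G = this
  define rel where "rel \<rho> N A \<longleftrightarrow> (\<forall>x :: nat + nat \<Rightarrow> complex.
      (\<forall>e < N + order \<rho> (P 0). (\<Sum>i\<in>{..?K} <+> {..<N}. A e i * x i) = 0) \<longrightarrow>
       (\<lambda>z. \<Sum>i\<le>?K. x (Inl i) * G \<rho> i z) \<in> O_germ \<theta> \<rho> \<and>
       ((\<forall>i\<le>?K. x (Inl i) = 0) \<longrightarrow> (\<forall>k<N. x (Inr k) = 0)))" for \<rho> N A
  have "\<exists>N A. rel \<rho> N A" if \<rho>: "\<rho> \<in> \<Sigma>" for \<rho>
    unfolding rel_def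
    by (rule microsolution_relations[where P = P and J = "{..?K}" and G = "G \<rho>" and \<theta> = \<theta> and \<rho> = \<rho> and \<mu> = \<mu>,
            unfolded Ball_def atMost_iff])
       (use P0 G[OF \<rho>] in auto)
  then obtain N A where "\<And>\<rho>. \<rho> \<in> \<Sigma> \<Longrightarrow> rel \<rho> (N \<rho>) (A \<rho>)" by metis
  hence NA: "(\<lambda>z. \<Sum>i\<le>?K. x (Inl i) * G \<rho> i z) \<in> O_germ \<theta> \<rho> \<and>
       ((\<forall>i\<le>?K. x (Inl i) = 0) \<longrightarrow> (\<forall>k<N \<rho>. x (Inr k) = 0))"
    if "\<rho> \<in> \<Sigma>" "\<forall>e < N \<rho> + order \<rho> (P 0). (\<Sum>i\<in>{..?K} <+> {..<N \<rho>}. A \<rho> e i * x i) = 0" for \<rho> and x :: "nat + nat \<Rightarrow> complex"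
    using that unfolding rel_def by blast

  \<comment> \<open>The linear system over all singularities\<close>
  define E where "E = (SIGMA \<rho>:\<Sigma>. {..<N \<rho> + order \<rho> (P 0)})"
  define I where "I = {..?K} <+> (SIGMA \<rho>:\<Sigma>. {..<N \<rho>})"
  \<comment> \<open>The coefficients of the \<open>G \<rho> i\<close> are shared by all \<rho>,
    while auxiliary unknowns belong to one \<rho> each: hence the zero off the diagonal
    blocks.\<close>
  define B where "B = (\<lambda>(\<rho>, e). case_sum (\<lambda>i. A \<rho> e (Inl i)) (\<lambda>(\<rho>', k). if \<rho>' = \<rho> then A \<rho> e (Inr k) else 0))"
  have "finite E" "finite I" using fin by (auto simp: E_def I_def)
  \<comment> \<open>The \<open>N \<rho>\<close> cancel; the multiplicities add up to
    \<open>?K\<close>, against \<open>?K + 1\<close> shared unknowns.\<close>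
  moreover have "card E < card I"
  proof -
    have "card E = (\<Sum>\<rho>\<in>\<Sigma>. N \<rho>) + (\<Sum>\<rho>\<in>\<Sigma>. order \<rho> (P 0))" using fin by (simp add: E_def sum.distrib)
    also have "(\<Sum>\<rho>\<in>\<Sigma>. order \<rho> (P 0)) = ?K" using order_sum_eq_degree[OF P0] by (simp add: \<Sigma> finite_singularities_def)
    finally show ?thesis using fin by (simp add: I_def card_Plus)
  qed
  ultimately have "\<exists>x. (\<exists>i\<in>I. x i \<noteq> 0) \<and> (\<forall>e\<in>E. (\<Sum>i\<in>I. B e i * x i) = 0)"
    by (rule underdetermined_system)
  then obtain x where x: "\<exists>i\<in>I. x i \<noteq> 0" "\<And>e. e \<in> E \<Longrightarrow> (\<Sum>i\<in>I. B e i * x i) = 0" by blast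
  define c where "c i = x (Inl i)" for i
  have main: "(\<lambda>z. \<Sum>i\<le>?K. c i * G \<rho> i z) \<in> O_germ \<theta> \<rho>"
    "(\<forall>i\<le>?K. c i = 0) \<Longrightarrow> \<forall>k<N \<rho>. x (Inr (\<rho>, k)) = 0" if \<rho>: "\<rho> \<in> \<Sigma>" for \<rho>
  proof -
    define y where "y = case_sum c (\<lambda>k. x (Inr (\<rho>, k)))"
    have "(\<Sum>i\<in>{..?K} <+> {..<N \<rho>}. A \<rho> e i * y i) = 0" if e: "e < N \<rho> + order \<rho> (P 0)" for e
    proof -
      have "0 = (\<Sum>i\<in>I. B (\<rho>, e) i * x i)" using x(2)[of "(\<rho>, e)"] \<rho> e by (simp add: E_def)
      also have "\<dots> = (\<Sum>i\<le>?K. A \<rho> e (Inl i) * c i) +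
          (\<Sum>(\<rho>', k)\<in>(SIGMA \<rho>:\<Sigma>. {..<N \<rho>}). if \<rho>' = \<rho> then A \<rho> e (Inr k) * x (Inr (\<rho>', k)) else 0)"
        unfolding I_def using fin
        by (subst sum.Plus) (auto simp: B_def c_def intro!: sum.cong arg_cong2[of _ _ _ _ "(+)"])
      also have "(\<Sum>(\<rho>', k)\<in>(SIGMA \<rho>:\<Sigma>. {..<N \<rho>}). if \<rho>' = \<rho> then A \<rho> e (Inr k) * x (Inr (\<rho>', k)) else 0)
          = (\<Sum>\<rho>'\<in>\<Sigma>. \<Sum>k<N \<rho>'. if \<rho>' = \<rho> then A \<rho> e (Inr k) * x (Inr (\<rho>', k)) else 0)"
        using fin by (subst sum.Sigma) auto
      also have "\<dots> = (\<Sum>\<rho>'\<in>\<Sigma>. if \<rho>' = \<rho> then \<Sum>k<N \<rho>. A \<rho> e (Inr k) * x (Inr (\<rho>, k)) else 0)"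
        by (intro sum.cong) auto
      also have "\<dots> = (\<Sum>k<N \<rho>. A \<rho> e (Inr k) * x (Inr (\<rho>, k)))" using fin \<rho> by simp
      finally show ?thesis by (subst sum.Plus) (auto simp: y_def)
    qed
    with NA[OF \<rho>, of y] show "(\<lambda>z. \<Sum>i\<le>?K. c i * G \<rho> i z) \<in> O_germ \<theta> \<rho>"
      "(\<forall>i\<le>?K. c i = 0) \<Longrightarrow> \<forall>k<N \<rho>. x (Inr (\<rho>, k)) = 0" by (auto simp: y_def)
  qed
  have "\<exists>i\<le>?K. c i \<noteq> 0"
  proof (rule ccontr)
    assume "\<not> ?thesis"
    hence "\<forall>i\<le>?K. c i = 0" by blast
    hence "x i = 0" if "i \<in> I" for i using main(2) that by (auto simp: I_def c_def)
    thus False using x(1) by blast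
  qed
  note c_nz = this

  \<comment> \<open>Solving the relation for the given microsolutions\<close>
  define V where "V a z = (\<Sum>i<?K. a i * f i z)" for a z
  have V_hol: "V a holomorphic_on ?\<Omega>" for a unfolding V_def[abs_def] by (intro holomorphic_intros f)
  define t where "t a = (\<Sum>i<?K. monom (a i) (n0 - \<mu> + i))" for a :: "nat \<Rightarrow> complex"
  have V_op: "diff_op \<mu> P (V a) z = poly (t a) (z - z0)" if "z \<in> ?\<Omega>" for a z
  proof -
    have "diff_op \<mu> P (V a) z = (\<Sum>i<?K. a i * diff_op \<mu> P (f i) z)"
      unfolding V_def[abs_def] by (rule diff_op_sum) (rule an[OF f(1) that])
    also have "\<dots> = (\<Sum>i<?K. a i * (z - z0) ^ (n0 - \<mu> + i))" using f(2)[OF that] by (simp add: poly_monom)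
    finally show ?thesis by (simp add: t_def poly_sum poly_monom)
  qed
  have V_op': "diff_op \<mu> P (V a) z = poly (t a \<circ>\<^sub>p [:- z0, 1:]) z" if "z \<in> ?\<Omega>" for a z
    using V_op[OF that] by (simp add: poly_pcompose)
  have G_sum: "(\<Sum>i\<le>?K. c i * G \<rho> i z) = c 0 * F \<rho> z + V (\<lambda>i. c (Suc i)) z" for \<rho> z
    unfolding sum.atMost_shift by (simp add: G_def V_def)
  \<comment> \<open>Otherwise \<open>V a\<close> would be a germ at every singularity, hence a
    polynomial. Its degree is below \<open>n0\<close> by regularity at infinity, yet it vanishes to
    order \<open>n0\<close> at \<open>z0\<close>; so it is zero, and with it its image and all
    \<open>a i\<close>.\<close>
  have c0: "c 0 \<noteq> 0"
  proof
    assume c0: "c 0 = 0"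
    define a where "a i = c (Suc i)" for i
    have "V a \<in> O_germ \<theta> \<rho>" if "\<rho> \<in> \<Sigma>" for \<rho>
      using main(1)[OF that] by (simp add: G_sum c0 a_def[abs_def])
    then obtain q where q: "\<And>z. z \<in> ?\<Omega> \<Longrightarrow> V a z = poly q z"
      "\<And>z. diff_op \<mu> P (poly q) z = poly (t a \<circ>\<^sub>p [:- z0, 1:]) z"
      using rigid[of "V a" "t a \<circ>\<^sub>p [:- z0, 1:]"] V_hol V_op' by blast
    have ta: "coeff (t a) j = 0" if "j \<ge> n0 - \<mu> + ?K" for j
      using that by (auto simp: t_def coeff_sum intro!: sum.neutral)
    have ta': "coeff (t a) j = 0" if "j < n0 - \<mu>" for j
      using that by (auto simp: t_def coeff_sum intro!: sum.neutral)
    have "coeff (t a \<circ>\<^sub>p [:- z0, 1:]) j = 0" if j: "j \<ge> n0 - \<mu> + ?K" for j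
    proof (cases "t a = 0")
      case False
      hence "degree (t a) < n0 - \<mu> + ?K" using ta by (metis leading_coeff_0_iff not_le)
      thus ?thesis using j by (intro coeff_eq_0) (simp add: degree_pcompose)
    qed simp
    from diff_op_poly_degree[OF reg P0 n0(2) n0(1) q(2) this]
    have q_deg: "coeff q j = 0" if "j \<ge> n0" for j using that by blast
    have Vev: "\<forall>\<^sub>F z in nhds z0. V a z = poly q z"
      using eventually_nhds_in_open[OF op z0] by eventually_elim (rule q)
    have V0: "(deriv ^^ k) (V a) z0 = 0" if k: "k < n0" for k
    proof (rule diff_op_vanishing_order[where P = P and z = z0 and f = "V a" and M = n0 and \<mu> = \<mu>
          and G = "fps_of_poly (t a)"])
      show "poly (P 0) z0 \<noteq> 0" by (rule P0\<Omega>[OF z0])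
      show "V a analytic_on {z0}" by (rule an[OF V_hol z0])
      show "(deriv ^^ j) (V a) z0 = 0" if "j < \<mu>" for j
        unfolding V_def[abs_def] by (subst higher_deriv_lincomb) (auto simp: f(3)[OF that] intro: an[OF f(1) z0])
      have "\<forall>\<^sub>F z in nhds z0. diff_op \<mu> P (V a) z = poly (t a) (z - z0)"
        using eventually_nhds_in_open[OF op z0] by eventually_elim (rule V_op)
      hence "\<forall>\<^sub>F w in nhds 0. diff_op \<mu> P (V a) (z0 + w) = poly (t a) w"
        by (simp add: nhds_to_0[of z0] eventually_filtermap)
      thus "(\<lambda>w. diff_op \<mu> P (V a) (z0 + w)) has_fps_expansion fps_of_poly (t a)"
        by (simp add: has_fps_expansion_poly cong: has_fps_expansion_cong)
      show "fps_nth (fps_of_poly (t a)) e = 0" if "e + \<mu> < n0" for e using ta'[of e] that by simp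
    qed (rule k)
    define q' where "q' = q \<circ>\<^sub>p [:z0, 1:]"
    have qq: "poly q z = poly q' (z - z0)" for z by (simp add: q'_def poly_pcompose)
    have "coeff q' k = 0" for k
    proof (cases "k < n0")
      case True
      have "fact k * coeff q' k = (deriv ^^ k) (\<lambda>z. poly q' (z - z0)) z0" by (rule higher_deriv_poly_translate[symmetric])
      also have "\<dots> = (deriv ^^ k) (V a) z0"
        using Vev by (intro higher_deriv_cong_ev) (auto elim!: eventually_mono simp: qq)
      finally show ?thesis using V0[OF True] by simp
    next
      case False
      show ?thesis
      proof (cases "q = 0")
        case False
        hence "degree q < n0" using q_deg by (metis leading_coeff_0_iff not_le)
        thus ?thesis using \<open>\<not> k < n0\<close> unfolding q'_def by (intro coeff_eq_0) (simp add: degree_pcompose)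
      qed (simp add: q'_def)
    qed
    hence "q' = 0" by (simp add: poly_eq_iff)
    hence "poly q z = 0" for z by (simp add: qq)
    hence "poly q = (\<lambda>_. 0)" by blast
    hence "poly (t a \<circ>\<^sub>p [:- z0, 1:]) z = 0" for z
      using q(2)[of z] by (simp add: diff_op_def)
    from this[of "z + z0" for z] have "poly (t a) z = 0" for z by (simp add: poly_pcompose)
    hence "t a = 0" using poly_all_0_iff_0 by blast
    have "a i = 0" if "i < ?K" for i
    proof -
      have "0 = coeff (t a) (n0 - \<mu> + i)" by (simp add: \<open>t a = 0\<close>)
      also have "\<dots> = (\<Sum>k<?K. if k = i then a k else 0)" unfolding t_def coeff_sum by (intro sum.cong) auto
      also have "\<dots> = a i" using that by simp
      finally show ?thesis by simp
    qed
    hence "c i = 0" if "i \<le> ?K" for i using that c0 by (cases i) (auto simp: a_def)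
    thus False using c_nz by blast
  qed
  define a where "a i = - (c (Suc i) / c 0)" for i
  have Va: "V a z - F \<rho> z = (- 1 / c 0) * (\<Sum>i\<le>?K. c i * G \<rho> i z)" for z \<rho>
  proof -
    have "V a z = (- 1 / c 0) * V (\<lambda>i. c (Suc i)) z"
      unfolding V_def sum_distrib_left a_def by (intro sum.cong) auto
    thus ?thesis unfolding G_sum using c0 by (simp add: field_simps)
  qed
  \<comment> \<open>The zero summand fits the relation to \<open>O_germ_lincomb\<close>.\<close>
  have Va: "(\<lambda>z. V a z - F \<rho> z) =
      (\<lambda>z. (- 1 / c 0) * (\<Sum>i\<le>?K. c i * G \<rho> i z) + 0 * (\<Sum>i\<le>?K. c i * G \<rho> i z))" for \<rho>
    using Va[of _ \<rho>] by (intro ext) simp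
  have "(\<lambda>z. V a z - F \<rho> z) \<in> O_germ \<theta> \<rho>" if "\<rho> \<in> \<Sigma>" for \<rho>
    unfolding Va by (rule O_germ_lincomb[OF main(1)[OF that] main(1)[OF that]])
  hence ex: "\<exists>f. f holomorphic_on ?\<Omega> \<and> (\<exists>p. \<forall>z\<in>?\<Omega>. diff_op \<mu> P f z = poly p z) \<and>
            (\<forall>\<rho>\<in>\<Sigma>. (\<lambda>z. f z - F \<rho> z) \<in> O_germ \<theta> \<rho>)"
    using V_hol V_op' by blast
  show ?thesis
    by (intro conjI ex allI impI) (elim conjE exE, rule uniq)
qed

end
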